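(* Let $R(x_1,\ldots,x_n,y_1,\ldots,y_k)=c_1x_1+\ldots+c_nx_n+P(y_1,\ldots,y_k)$ be a Rado polynomial. Then every ultrafilter $\mathcal{U}\in\overline{K(\odot)}\cap\overline{\mathbb{I}(\oplus)}\cap\mathcal{BD}$ is a PR-witness of $R$ with injectivity $|\{x_1,\ldots,x_n\}|\ge n-1$ and $|\{y_1,\ldots,y_k\}|=k$ (simultaneously). When $n=2$, every $\mathcal{U}\in\overline{\mathbb{I}(\oplus)}\cap\mathcal{BD}$ satisfies this property, and one moreover has injectivity $|\{x_1,x_2\}|=2$ if $k=1$. Moreover, if $P\ne0$ is linear, then every $\mathcal{U}\in\overline{K(\odot)}$ is a PR-witness of $R$ with full injectivity $|\{x_1,\ldots,x_n,y_1,\ldots,y_k\}|=n+k$.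
   Context: $\mathbb{N}$ is the set of positive integers. A Rado polynomial is a polynomial with integer coefficients of the form $c_1x_1+\ldots+c_nx_n+P(y_1,\ldots,y_k)$ where the variables $x_1,\ldots,x_n,y_1,\ldots,y_k$ are distinct, $n\ge2$, $c_i\in\mathbb{Z}$, $P\in\mathbb{Z}[y_1,\ldots,y_k]$ has no constant term, and there is a nonempty $J\subseteq\{1,\ldots,n\}$ with $\sum_{j\in J}c_j=0$. An ultrafilter $\mathcal{U}$ on $\mathbb{N}$ is a PR-witness of $f$ with injectivity conditions $|\{x_{i_1},\ldots,x_{i_p}\}|\ge s$ (possibly several simultaneously) if for every $A\in\mathcal{U}$ there is a root of $f$ with all coordinates in $A$ satisfying all those conditions. $\beta\mathbb{N}$ is the space of ultrafilters on $\mathbb{N}$ with its compact topology and the operations: $A\in\mathcal{U}\oplus\mathcal{V}$ iff $\{n\mid A-n\in\mathcal{V}\}\in\mathcal{U}$ with $A-n=\{m\mid m+n\in A\}$; $A\in\mathcal{U}\odot\mathcal{V}$ iff $\{n\mid A/n\in\mathcal{V}\}\in\mathcal{U}$ with $A/n=\{m\mid mn\in A\}$. $K(\odot)$ is the smallest two-sided ideal of $(\beta\mathbb{N},\odot)$; $\mathbb{I}(\oplus)$ is the set of ultrafilters $\mathcal{U}$ with $\mathcal{U}\oplus\mathcal{U}=\mathcal{U}$; bars denote topological closure in $\beta\mathbb{N}$. $\mathcal{BD}$ is the set of ultrafilters all of whose members have positive Banach density, where the Banach density of $E\subseteq\mathbb{Z}$ is the greatest value of $\limsup_n |E\cap[a_n,b_n]|/(b_n-a_n+1)$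 over sequences of intervals with $b_n-a_n\to\infty$.
   Formalization: The coefficients c_j, j in J, are required to be nonzero (else 0x_1+x_2-2y_1 would be a Rado polynomial and a counterexample), and the clause |{x_1,x_2}|=2 for n=2, k=1 also requires P≠0 (for P=0 the equation forces x_1=x_2). *)

theory Defs
  imports "HOL-Analysis.Analysis" "HOL-Library.Poly_Mapping"
begin

abbreviation Npos :: "nat set" where
  "Npos \<equiv> {n. 0 < n}"

text \<open>An ultrafilter on the positive integers is the family of its members, all of them
  subsets of \<open>Npos\<close>.\<close>

definition betaN :: "nat set set set" where
  "betaN = {U. U \<subseteq> Pow Npos \<and> Npos \<in> U \<and> {} \<notin> U
     \<and> (\<forall>A B. A \<in> U \<longrightarrow> A \<subseteq> B \<longrightarrow> B \<subseteq> Npos \<longrightarrow> B \<in> U)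
     \<and> (\<forall>A B. A \<in> U \<longrightarrow> B \<in> U \<longrightarrow> A \<inter> B \<in> U)
     \<and> (\<forall>A. A \<subseteq> Npos \<longrightarrow> A \<in> U \<or> Npos - A \<in> U)}"

definition betaN_topology :: "nat set set topology" where
  "betaN_topology = topology_generated_by {{U \<in> betaN. A \<in> U} |A. A \<subseteq> Npos}"

definition uf_plus :: "nat set set \<Rightarrow> nat set set \<Rightarrow> nat set set" where
  "uf_plus U V = {A. A \<subseteq> Npos \<and> {n \<in> Npos. {m \<in> Npos. m + n \<in> A} \<in> V} \<in> U}"

definition uf_times :: "nat set set \<Rightarrow> nat set set \<Rightarrow> nat set set" where
  "uf_times U V = {A. A \<subseteq> Npos \<and> {n \<in> Npos. {m \<in> Npos. m * n \<in> A} \<in> V} \<in> U}"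

definition two_sided_ideal :: "('a \<Rightarrow> 'a \<Rightarrow> 'a) \<Rightarrow> 'a set \<Rightarrow> 'a set \<Rightarrow> bool" where
  "two_sided_ideal f S I \<longleftrightarrow> I \<noteq> {} \<and> I \<subseteq> S \<and> (\<forall>u\<in>S. \<forall>v\<in>I. f u v \<in> I \<and> f v u \<in> I)"

definition smallest_ideal :: "('a \<Rightarrow> 'a \<Rightarrow> 'a) \<Rightarrow> 'a set \<Rightarrow> 'a set" where
  "smallest_ideal f S = \<Inter>{I. two_sided_ideal f S I}"

definition K_times :: "nat set set set" where
  "K_times = smallest_ideal uf_times betaN"

definition I_plus :: "nat set set set" where
  "I_plus = {U \<in> betaN. uf_plus U U = U}"

definition banach_density :: "int set \<Rightarrow> ereal" where
  "banach_density E =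
     (SUP (a, b) \<in> {(a :: nat \<Rightarrow> int, b). (\<forall>n. a n \<le> b n) \<and>
                      filterlim (\<lambda>n. b n - a n) at_top sequentially}.
        limsup (\<lambda>n. ereal (real (card (E \<inter> {a n..b n})) / real_of_int (b n - a n + 1))))"

definition BD :: "nat set set set" where
  "BD = {U \<in> betaN. \<forall>A\<in>U. 0 < banach_density (int ` A)}"

text \<open>A polynomial with variables indexed by \<open>'v\<close> maps each monomial (a finitely
  supported exponent function) to its coefficient.\<close>

type_synonym 'v int_mpoly = "('v \<Rightarrow>\<^sub>0 nat) \<Rightarrow>\<^sub>0 int"

definition mpoly_eval :: "('v \<Rightarrow> int) \<Rightarrow> 'v int_mpoly \<Rightarrow> int" where
  "mpoly_eval a f = (\<Sum>m\<in>Poly_Mapping.keys f.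
     Poly_Mapping.lookup f m * (\<Prod>v\<in>Poly_Mapping.keys m. a v ^ Poly_Mapping.lookup m v))"

definition mpoly_vars :: "'v int_mpoly \<Rightarrow> 'v set" where
  "mpoly_vars f = (\<Union>m\<in>Poly_Mapping.keys f. Poly_Mapping.keys m)"

definition mpoly_linear :: "'v int_mpoly \<Rightarrow> bool" where
  "mpoly_linear f \<longleftrightarrow>
     (\<forall>m\<in>Poly_Mapping.keys f. (\<Sum>v\<in>Poly_Mapping.keys m. Poly_Mapping.lookup m v) \<le> 1)"

definition mpoly_var :: "'v \<Rightarrow> 'v int_mpoly" where
  "mpoly_var v = Poly_Mapping.single (Poly_Mapping.single v 1) 1"

definition mpoly_const :: "int \<Rightarrow> 'v int_mpoly" where
  "mpoly_const c = Poly_Mapping.single 0 c"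

text \<open>\<open>PR_witness U V f C\<close>: \<open>U\<close> is a PR-witness of \<open>f\<close>, a polynomial in the variables \<open>V\<close>, with
  all the injectivity conditions in \<open>C\<close>; a pair \<open>(W, s)\<close> in \<open>C\<close> stands for the condition that
  the variables in \<open>W\<close> take at least \<open>s\<close> distinct values.\<close>

definition PR_witness ::
    "nat set set \<Rightarrow> 'v set \<Rightarrow> 'v int_mpoly \<Rightarrow> ('v set \<times> nat) set \<Rightarrow> bool" where
  "PR_witness U V f C \<longleftrightarrow>
     (\<forall>A\<in>U. \<exists>a :: 'v \<Rightarrow> nat. (\<forall>v\<in>V. a v \<in> A) \<and> mpoly_eval (\<lambda>v. int (a v)) f = 0
        \<and> (\<forall>(W, s)\<in>C. s \<le> card (a ` W)))"

text \<open>The variable \<open>x\<^sub>i\<close> is \<open>Inl i\<close> and the variable \<open>y\<^sub>j\<close> is \<open>Inr j\<close>.\<close>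

definition x_vars :: "nat \<Rightarrow> (nat + nat) set" where
  "x_vars n = Inl ` {1..n}"

definition y_vars :: "nat \<Rightarrow> (nat + nat) set" where
  "y_vars k = Inr ` {1..k}"

definition rado_poly :: "nat \<Rightarrow> (nat \<Rightarrow> int) \<Rightarrow> (nat + nat) int_mpoly \<Rightarrow> (nat + nat) int_mpoly" where
  "rado_poly n c P = (\<Sum>i=1..n. mpoly_const (c i) * mpoly_var (Inl i)) + P"

text \<open>The coefficients indexed by \<open>J\<close> are nonzero, as in Rado's theorem. If \<open>J\<close> could consist of
  indices of zero coefficients then \<open>0 * x\<^sub>1 + x\<^sub>2 - 2 * y\<^sub>1\<close>, which is not partition regular,
  would be a Rado polynomial. Coefficients outside \<open>J\<close> may vanish.\<close>

definition is_rado :: "nat \<Rightarrow> nat \<Rightarrow> (nat \<Rightarrow> int) \<Rightarrow> (nat + nat) int_mpoly \<Rightarrow> bool" where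
  "is_rado n k c P \<longleftrightarrow> 2 \<le> n \<and> mpoly_vars P \<subseteq> y_vars k \<and> Poly_Mapping.lookup P 0 = 0
     \<and> (\<exists>J. J \<subseteq> {1..n} \<and> J \<noteq> {} \<and> (\<forall>j\<in>J. c j \<noteq> 0) \<and> (\<Sum>j\<in>J. c j) = 0)"

end

theory Submission
  imports Defs "HOL-Computational_Algebra.Polynomial" "HOL-Library.Ramsey"
begin

text \<open>Let \<open>J\<close> be the zero-sum set of coefficients, \<open>j\<^sub>0 \<in> J\<close>, and let \<open>f\<close> be the sum of \<open>P\<close> and of the
  terms \<open>c\<^sub>i x\<^sub>i\<close> with \<open>i \<notin> J\<close>. For \<open>A \<in> \<U>\<close>, the set \<open>A\<^sub>1\<close> of centres of progressions of fixed
  length in \<open>A\<close> is again in \<open>\<U>\<close>, since \<open>A - A\<^sub>1\<close> contains no such progression. Suppose that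
  \<open>c\<^bsub>j\<^sub>0\<^esub> (t - x\<^bsub>j\<^sub>0\<^esub>) = f(y)\<close> for some \<open>t, x\<^bsub>j\<^sub>0\<^esub> \<in> A\<^sub>1\<close> and distinct values \<open>y\<close> in \<open>A\<close>. Then the
  variables in \<open>J - {j\<^sub>0}\<close> can be taken from a progression around \<open>t\<close>, with \<open>t\<close> in place of \<open>x\<^bsub>j\<^sub>0\<^esub>\<close>
  solving \<open>\<Sum>\<^bsub>j \<in> J\<^esub> c\<^sub>j x\<^sub>j = 0\<close>.

  The set \<open>c\<^bsub>j\<^sub>0\<^esub> A\<^sub>1\<close> has positive Banach density, so such \<open>y\<close> exist by polynomial recurrence along an
  idempotent ultrafilter \<open>p\<close>. The correlation function \<open>\<phi>\<close> of the set is positive definite, and even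
  \<open>\<phi> - m\<^sup>2\<close> is, where \<open>m\<close> is the density; hence it is enough that positive definite functions are
  asymptotically nonnegative along polynomials. To see this, write \<open>\<phi>\<close> as a sum of positive
  definite parts: the \<open>i\<close>-th part is rigid along \<open>a n\<^sup>j\<close> for \<open>1 \<le> j \<le> i\<close> and some \<open>a\<close>, and almost nothing
  of it is so for \<open>j = i + 1\<close>. By the van der Corput trick a part is negligible along polynomials of
  higher degree in some variable, and along the others the limit is a projection.

  For linear \<open>P\<close> the witnesses with full injectivity form a two-sided ideal of \<open>(\<beta>\<nat>, \<odot>)\<close>, which contains
  \<open>K(\<odot>)\<close> as soon as it is nonempty; recurrence then follows from the pigeonhole principle, and idempotents
  are not needed.\<close>

section \<open>Ultrafilters and iterated quantifiers\<close>

text \<open>No Hilbert space is built. That \<rho> and \<nu> - \<rho> are both positive definite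
  expresses that \<rho> is a part of \<nu>, with \<nu> 0 as squared norm. Parts arise by nearly
  maximising the value at 0, so each splitting is exact only up to some e, which must be fixed in
  terms of the accuracy, the index i and the degree bound alone, before the part and its multiplier
  a are known. The multiplier is forced: a limit along Q with leading coefficient b yields rigidity
  only along multiples of b n^j. It does no harm, because Q (m + n) - Q m - Q n has coefficients
  divisible by m, and an idempotent ultrafilter contains the multiples of a. The values y are chosen
  one after another; they come out distinct because an idempotent ultrafilter on the positive
  integers is nonprincipal. The bound n - 1 stems from the case f(y) = 0: then t is the value of the
  variable with index j0, and another variable of J may take the value t too. If f(y) is nonzero,
  all variables can be made distinct; for linear nonzero P, and for n = 2, k = 1 with P nonzero,
  this is arranged.\<close>

definition ultra :: "'a filter \<Rightarrow> bool" where
  "ultra F \<longleftrightarrow> F \<noteq> bot \<and> (\<forall>P. eventually P F \<or> eventually (\<lambda>x. \<not> P x) F)"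

lemma ultra_not_bot: "ultra F \<Longrightarrow> F \<noteq> bot"
  by (simp add: ultra_def)

lemma ultra_not:
  assumes "ultra F"
  shows "eventually (\<lambda>x. \<not> P x) F \<longleftrightarrow> \<not> eventually P F"
proof
  assume a: "eventually (\<lambda>x. \<not> P x) F"
  show "\<not> eventually P F"
  proof
    assume "eventually P F"
    with a have "eventually (\<lambda>x. False) F"
      by eventually_elim simp
    then show False
      using assms by (simp add: ultra_def eventually_False)
  qed
next
  assume "\<not> eventually P F"
  then show "eventually (\<lambda>x. \<not> P x) F"
    using assms by (auto simp: ultra_def)
qed

lemma ultra_disj:
  assumes "ultra F" "eventually (\<lambda>x. P x \<or> Q x) F"
  shows "eventually P F \<or> eventually Q F"
proof (rule disjCI)
  assume "\<not> eventually Q F"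
  then have "eventually (\<lambda>x. \<not> Q x) F"
    using assms(1) by (simp add: ultra_not)
  with assms(2) show "eventually P F"
    by eventually_elim simp
qed

lemma ultra_finite_cases:
  assumes "ultra F" "finite S" "eventually (\<lambda>x. f x \<in> S) F"
  shows "\<exists>s\<in>S. eventually (\<lambda>x. f x = s) F"
  using assms(2,3)
proof (induction S)
  case empty
  then show ?case
    using ultra_not_bot[OF assms(1)] by (simp add: eventually_False)
next
  case (insert a S)
  then have "eventually (\<lambda>x. f x = a) F \<or> eventually (\<lambda>x. f x \<in> S) F"
    by (intro ultra_disj[OF assms(1)]) simp
  with insert.IH show ?case by auto
qed

text \<open>Zorn's lemma for the reversed order. The infimum of a chain of proper filters is proper,
  since what holds eventually for the infimum holds eventually for some member. A minimal proper
  filter decides every P: if it does not refute P, restricting it to P changes nothing.\<close>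

lemma ultra_exists:
  assumes "F \<noteq> bot"
  shows "\<exists>G. G \<le> F \<and> ultra G"
proof -
  define A where "A = {G. G \<le> F \<and> G \<noteq> bot}"
  have "\<exists>m\<in>A. \<forall>G\<in>A. m \<ge> G \<longrightarrow> G = m"
  proof (rule predicate_Zorn)
    show "partial_order_on A (relation_of (\<ge>) A)"
      by (rule partial_order_on_relation_ofI) auto
  next
    fix C assume C: "C \<in> Chains (relation_of (\<ge>) A)"
    then have sub: "C \<subseteq> A"
      and lin: "\<And>x y. x \<in> C \<Longrightarrow> y \<in> C \<Longrightarrow> x \<le> y \<or> y \<le> x"
      by (auto simp: Chains_def relation_of_def)
    show "\<exists>u\<in>A. \<forall>a\<in>C. a \<ge> u"
    proof (cases "C = {}")
      case True
      then show ?thesis using assms by (auto simp: A_def)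
    next
      case False
      have ev: "eventually P (Inf C) \<longleftrightarrow> (\<exists>b\<in>C. eventually P b)" for P
      proof (rule eventually_Inf_base[OF False])
        fix x y assume xy: "x \<in> C" "y \<in> C"
        show "\<exists>z\<in>C. z \<le> inf x y"
        proof (cases "x \<le> y")
          case True
          with xy(1) show ?thesis by (intro bexI[of _ x] le_infI) simp_all
        next
          case False
          with lin[OF xy] xy(2) show ?thesis by (intro bexI[of _ y] le_infI) simp_all
        qed
      qed
      have "Inf C \<noteq> bot"
        using sub ev[of "\<lambda>_. False"] unfolding trivial_limit_def A_def by blast
      moreover have "Inf C \<le> F"
        using False sub by (auto simp: A_def intro: Inf_lower2)
      ultimately show ?thesis
        by (intro bexI[of _ "Inf C"]) (auto simp: A_def Inf_lower)
    qed
  qed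
  then obtain m where m: "m \<le> F" "m \<noteq> bot" "\<And>G. G \<le> F \<Longrightarrow> G \<noteq> bot \<Longrightarrow> G \<le> m \<Longrightarrow> G = m"
    by (auto simp: A_def)
  have "eventually P m \<or> eventually (\<lambda>x. \<not> P x) m" for P
  proof (rule disjCI)
    assume n: "\<not> eventually (\<lambda>x. \<not> P x) m"
    define G where "G = inf m (principal {x. P x})"
    have "G \<noteq> bot"
      using n by (simp add: G_def trivial_limit_def eventually_inf_principal)
    then have "G = m"
      using m by (auto simp: G_def intro: le_infI1)
    moreover have "eventually P G"
      by (simp add: G_def eventually_inf_principal)
    ultimately show "eventually P m" by simp
  qed
  with m show ?thesis by (auto simp: ultra_def)
qed

text \<open>Compactness gives a cluster point, and an ultrafilter converges to each of its cluster
  points. All limits of correlations below exist for this reason.\<close>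

lemma ultra_tendsto_Lim:
  fixes f :: "'a \<Rightarrow> real"
  assumes "ultra F" "bounded (range f)"
  shows "(f \<longlongrightarrow> Lim F f) F"
proof -
  obtain B where B: "\<And>x. norm (f x) \<le> B"
    using assms(2) by (auto simp: bounded_iff)
  have "filtermap f F \<noteq> bot"
    using ultra_not_bot[OF assms(1)] by (simp add: filtermap_bot_iff)
  moreover have "eventually (\<lambda>x. x \<in> cball 0 B) (filtermap f F)"
    using B by (simp add: eventually_filtermap)
  ultimately obtain l where l: "inf (nhds l) (filtermap f F) \<noteq> bot"
    using compact_cball[of "0::real" B] unfolding compact_filter by metis
  have "(f \<longlongrightarrow> l) F"
  proof (rule topological_tendstoI)
    fix S assume S: "open S" "l \<in> S"
    show "eventually (\<lambda>x. f x \<in> S) F"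
    proof (rule ccontr)
      assume "\<not> ?thesis"
      then have "eventually (\<lambda>x. f x \<notin> S) F"
        using assms(1) by (simp add: ultra_not)
      then have "eventually (\<lambda>x. x \<notin> S) (filtermap f F)"
        by (simp add: eventually_filtermap)
      moreover have "eventually (\<lambda>x. x \<in> S) (nhds l)"
        using S by (rule eventually_nhds_in_open)
      ultimately have "eventually (\<lambda>x. False) (inf (nhds l) (filtermap f F))"
        unfolding eventually_inf by blast
      with l show False by (simp add: trivial_limit_def)
    qed
  qed
  then show ?thesis
    using tendsto_Lim[OF ultra_not_bot[OF assms(1)], of f l] by simp
qed

text \<open>The iterated quantifier ``for most \<open>x\<^sub>1\<close>, \dots, for most \<open>x\<^sub>k\<close>'', that is membership in the
  \<open>k\<close>-fold tensor power of an ultrafilter.\<close>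

primrec evk :: "nat filter \<Rightarrow> nat \<Rightarrow> (nat list \<Rightarrow> bool) \<Rightarrow> bool" where
  "evk p 0 P = P []"
| "evk p (Suc k) P = eventually (\<lambda>x. evk p k (\<lambda>xs. P (x # xs))) p"

lemma evk_mono:
  "evk p k P \<Longrightarrow> (\<And>xs. length xs = k \<Longrightarrow> P xs \<Longrightarrow> Q xs) \<Longrightarrow> evk p k Q"
proof (induction k arbitrary: P Q)
  case (Suc k)
  from Suc.prems(1) have "eventually (\<lambda>x. evk p k (\<lambda>xs. P (x # xs))) p" by simp
  then have "eventually (\<lambda>x. evk p k (\<lambda>xs. Q (x # xs))) p"
  proof (rule eventually_mono)
    fix x assume "evk p k (\<lambda>xs. P (x # xs))"
    then show "evk p k (\<lambda>xs. Q (x # xs))"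
      by (rule Suc.IH) (simp add: Suc.prems(2))
  qed
  then show ?case by simp
qed auto

lemma evk_conj: "evk p k P \<Longrightarrow> evk p k Q \<Longrightarrow> evk p k (\<lambda>xs. P xs \<and> Q xs)"
proof (induction k arbitrary: P Q)
  case (Suc k)
  then show ?case by simp (auto intro: Suc.IH elim: eventually_elim2)
qed auto

lemma evk_append: "evk p (a + b) P \<longleftrightarrow> evk p a (\<lambda>xs. evk p b (\<lambda>ys. P (xs @ ys)))"
  by (induction a arbitrary: P) auto

lemma evk_snoc: "evk p (Suc k) P \<longleftrightarrow> evk p k (\<lambda>xs. eventually (\<lambda>y. P (xs @ [y])) p)"
  using evk_append[of p k 1 P] by simp

lemma evk_ex: "ultra p \<Longrightarrow> evk p k P \<Longrightarrow> \<exists>xs. length xs = k \<and> P xs"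
proof (induction k arbitrary: P)
  case (Suc k)
  then obtain x where "evk p k (\<lambda>xs. P (x # xs))"
    using eventually_happens'[OF ultra_not_bot] by fastforce
  with Suc.IH Suc.prems obtain xs where "length xs = k" "P (x # xs)" by blast
  then show ?case by (intro exI[of _ "x # xs"]) simp
qed auto

lemma evk_disj_not: "ultra p \<Longrightarrow> evk p k P \<or> evk p k (\<lambda>xs. \<not> P xs)"
proof (induction k arbitrary: P)
  case (Suc k)
  define Q where "Q x \<longleftrightarrow> evk p k (\<lambda>xs. P (x # xs))" for x
  have "eventually Q p \<or> eventually (\<lambda>x. \<not> Q x) p"
    using Suc.prems by (auto simp: ultra_def)
  moreover have "\<not> Q x \<Longrightarrow> evk p k (\<lambda>xs. \<not> P (x # xs))" for x
    using Suc.IH[of "\<lambda>xs. P (x # xs)"] Suc.prems unfolding Q_def by blast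
  then have "eventually (\<lambda>x. \<not> Q x) p \<Longrightarrow> eventually (\<lambda>x. evk p k (\<lambda>xs. \<not> P (x # xs))) p"
    by (auto elim: eventually_mono)
  ultimately show ?case
    unfolding evk.simps Q_def[symmetric] by blast
qed auto

lemma evk_set:
  assumes "eventually P p"
  shows "evk p k (\<lambda>xs. \<forall>x\<in>set xs. P x)"
proof (induction k)
  case (Suc k)
  show ?case using assms
    by simp (auto elim!: eventually_mono intro: evk_mono[OF Suc])
qed auto

section \<open>Idempotent ultrafilters\<close>

locale idem_uf =
  fixes p :: "nat filter"
  assumes ultra: "ultra p"
    and idem: "eventually P p \<longleftrightarrow> eventually (\<lambda>n. eventually (\<lambda>m. P (n + m)) p) p"
    and pos: "eventually (\<lambda>n. 0 < n) p"
begin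

lemma not_bot: "p \<noteq> bot"
  using ultra by (rule ultra_not_bot)

text \<open>A principal idempotent ultrafilter at k would give k + k = k, which \<open>pos\<close>
  excludes.\<close>

lemma eventually_neq: "eventually (\<lambda>n. n \<noteq> k) p"
proof (rule ccontr)
  assume "\<not> ?thesis"
  then have k: "eventually (\<lambda>n. n = k) p"
    using ultra ultra_not[of p "\<lambda>n. n \<noteq> k"] by simp
  then have "eventually (\<lambda>n. eventually (\<lambda>m. n + m = k) p) p"
    using idem[of "\<lambda>n. n = k"] by simp
  with k pos have "eventually (\<lambda>n. n = k \<and> 0 < n \<and> eventually (\<lambda>m. n + m = k) p) p"
    by eventually_elim simp
  then have "eventually (\<lambda>m. k + m = k) p" "0 < k"
    using eventually_happens'[OF not_bot] by blast+
  with k have "eventually (\<lambda>m. False) p"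
    by (auto elim: eventually_elim2)
  with not_bot show False by (simp add: trivial_limit_def)
qed

text \<open>The residue r modulo a selected by p satisfies r + r = r modulo a, so it is 0.\<close>

lemma eventually_dvd:
  assumes "0 < a"
  shows "eventually (\<lambda>n. a dvd n) p"
proof -
  have "\<exists>r\<in>{..<a}. eventually (\<lambda>n. n mod a = r) p"
    using assms by (intro ultra_finite_cases[OF ultra]) auto
  then obtain r where r: "r < a" "eventually (\<lambda>n. n mod a = r) p" by auto
  from r(2) have "eventually (\<lambda>n. eventually (\<lambda>m. (n + m) mod a = r) p) p"
    using idem[of "\<lambda>n. n mod a = r"] by simp
  with r(2) have "eventually (\<lambda>n. n mod a = r \<and> eventually (\<lambda>m. (n + m) mod a = r) p) p"
    by eventually_elim simp
  then obtain n where "n mod a = r" "eventually (\<lambda>m. (n + m) mod a = r) p"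
    using eventually_happens'[OF not_bot] by blast
  with r(2) have "eventually (\<lambda>m. m mod a = r \<and> n mod a = r \<and> (n + m) mod a = r) p"
    by (auto elim: eventually_elim2)
  then obtain m where "m mod a = r" "n mod a = r" "(n + m) mod a = r"
    using eventually_happens'[OF not_bot] by blast
  then have "(r + r) mod a = r"
    by (metis mod_add_eq)
  then have "r = 0"
    using r(1) by (cases "r + r < a") (auto simp: mod_if[of "r + r"] mod_if[of "r + r - a"] split: if_splits)
  with r(2) show ?thesis by (simp add: dvd_eq_mod_eq_0)
qed

lemma evk_distinct: "evk p k distinct"
proof (induction k)
  case (Suc k)
  have "eventually (\<lambda>x. True) p" by simp
  then have "eventually (\<lambda>x. evk p k (\<lambda>xs. distinct (x # xs))) p"
  proof (rule eventually_mono)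
    fix x
    have "evk p k (\<lambda>xs. distinct xs \<and> (\<forall>y\<in>set xs. y \<noteq> x))"
      using Suc evk_set[OF eventually_neq] by (rule evk_conj)
    then show "evk p k (\<lambda>xs. distinct (x # xs))"
      by (rule evk_mono) auto
  qed
  then show ?case by simp
qed auto

lemma evk_sum_list: "eventually P p \<Longrightarrow> evk p (Suc k) (\<lambda>xs. P (sum_list xs))"
proof (induction k arbitrary: P)
  case (Suc k)
  from Suc.prems have "eventually (\<lambda>n. eventually (\<lambda>m. P (n + m)) p) p"
    using idem by blast
  then have "eventually (\<lambda>n. evk p (Suc k) (\<lambda>xs. P (n + sum_list xs))) p"
    by (rule eventually_mono) (rule Suc.IH)
  then show ?case by simp
qed auto

text \<open>The extra summand \<open>h\<close> carries the induction: by idempotence the induction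
  hypothesis holds at \<open>h + x\<close> for most \<open>h\<close> and most \<open>x\<close>,
  where \<open>x\<close> is the first generator.\<close>

lemma evk_splits:
  assumes "eventually (\<lambda>h. eventually (\<lambda>n. R h n) p) p"
  shows "eventually (\<lambda>h. evk p k (\<lambda>xs. \<forall>i<k. R (h + sum_list (take i xs)) (sum_list (drop i xs)))) p"
proof (induction k)
  case (Suc k)
  have "eventually (\<lambda>h. eventually (\<lambda>x. evk p k
      (\<lambda>xs. \<forall>i<k. R (h + x + sum_list (take i xs)) (sum_list (drop i xs)))) p) p"
    using Suc idem[of "\<lambda>h. evk p k
      (\<lambda>xs. \<forall>i<k. R (h + sum_list (take i xs)) (sum_list (drop i xs)))"] by simp
  with assms show ?case
  proof eventually_elim
    case (elim h)
    have "evk p (Suc k) (\<lambda>xs. R h (sum_list xs))"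
      using elim(1) by (rule evk_sum_list)
    moreover have "evk p (Suc k) (\<lambda>xs. \<forall>i<k. R (h + hd xs + sum_list (take i (tl xs))) (sum_list (drop i (tl xs))))"
      using elim(2) by simp
    ultimately have "evk p (Suc k) (\<lambda>xs. R h (sum_list xs) \<and>
        (\<forall>i<k. R (h + hd xs + sum_list (take i (tl xs))) (sum_list (drop i (tl xs)))))"
      by (rule evk_conj)
    then show ?case
    proof (rule evk_mono, intro allI impI)
      fix xs :: "nat list" and i
      assume len: "length xs = Suc k" and i: "i < Suc k"
        and *: "R h (sum_list xs) \<and>
          (\<forall>i<k. R (h + hd xs + sum_list (take i (tl xs))) (sum_list (drop i (tl xs))))"
      from len obtain y ys where xs: "xs = y # ys" by (cases xs) auto
      show "R (h + sum_list (take i xs)) (sum_list (drop i xs))"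
        using * i xs by (cases i) (auto simp: add.assoc)
    qed
  qed
qed simp

text \<open>Here \<open>ts\<close> lists the sums of the final segments of a sequence of generators.\<close>

lemma suffix_sums:
  assumes "eventually (\<lambda>h. eventually (\<lambda>n. R h n) p) p"
  shows "\<exists>ts. length ts = k \<and> sorted_wrt (\<lambda>t t'. \<exists>h. t = h + t' \<and> R h t') ts"
proof -
  define S where "S = (\<lambda>t t'. \<exists>h. t = h + t' \<and> R h t')"
  define suf where "suf xs = map (\<lambda>i. sum_list (drop i xs)) [0..<length xs]" for xs :: "nat list"
  have suf_Cons: "suf (x # xs) = sum_list (x # xs) # suf xs" for x xs
    by (simp add: suf_def map_upt_Suc del: upt_Suc)
  have "evk p k (\<lambda>xs. sorted_wrt S (suf xs))"
  proof (induction k)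
    case (Suc k)
    have "eventually (\<lambda>h. evk p k (\<lambda>xs. sorted_wrt S (suf (h # xs)))) p"
      using evk_splits[OF assms, of k]
    proof (rule eventually_mono)
      fix h assume "evk p k (\<lambda>xs. \<forall>i<k. R (h + sum_list (take i xs)) (sum_list (drop i xs)))"
      with Suc have "evk p k (\<lambda>xs. sorted_wrt S (suf xs) \<and>
          (\<forall>i<k. R (h + sum_list (take i xs)) (sum_list (drop i xs))))"
        by (rule evk_conj)
      then show "evk p k (\<lambda>xs. sorted_wrt S (suf (h # xs)))"
      proof (rule evk_mono)
        fix xs :: "nat list"
        assume len: "length xs = k" and *: "sorted_wrt S (suf xs) \<and>
          (\<forall>i<k. R (h + sum_list (take i xs)) (sum_list (drop i xs)))"
        \<comment> \<open>Two suffix sums differ by the sum of the block between them, and this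
          block sum is the witness.\<close>
        have "S (h + sum_list xs) t" if t: "t \<in> set (suf xs)" for t
        proof -
          obtain i where i: "i < k" "t = sum_list (drop i xs)"
            using t len by (auto simp: suf_def)
          have "sum_list xs = sum_list (take i xs) + sum_list (drop i xs)"
            by (metis append_take_drop_id sum_list_append)
          then show ?thesis
            unfolding S_def using * i
            by (intro exI[of _ "h + sum_list (take i xs)"]) auto
        qed
        with * show "sorted_wrt S (suf (h # xs))"
          by (simp add: suf_Cons)
      qed
    qed
    then show ?case by simp
  qed (simp add: suf_def)
  from evk_ex[OF ultra this] obtain xs where "length xs = k" "sorted_wrt S (suf xs)" by blast
  then show ?thesis
    unfolding S_def by (intro exI[of _ "suf xs"]) (simp add: suf_def)
qed

end

section \<open>Positive definite functions\<close>

text \<open>A formal combination \<open>xs\<close> of shifts \<open>(c, g)\<close> stands for the vector \<open>\<Sum> c U\<^sup>g f\<close>, where \<open>U\<close> is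
  a unitary operator and \<open>\<phi> h = \<langle>U\<^sup>h f, f\<rangle>\<close>.\<close>

definition ip :: "(int \<Rightarrow> real) \<Rightarrow> (real \<times> int) list \<Rightarrow> (real \<times> int) list \<Rightarrow> real" where
  "ip \<phi> xs ys = (\<Sum>x\<leftarrow>xs. \<Sum>y\<leftarrow>ys. fst x * fst y * \<phi> (snd x - snd y))"

definition pdef :: "(int \<Rightarrow> real) \<Rightarrow> bool" where
  "pdef \<phi> \<longleftrightarrow> (\<forall>h. \<phi> (-h) = \<phi> h) \<and> (\<forall>xs. 0 \<le> ip \<phi> xs xs)"

lemma pdef_even: "pdef \<phi> \<Longrightarrow> \<phi> (-h) = \<phi> h"
  by (simp add: pdef_def)

lemma pdef_ip: "pdef \<phi> \<Longrightarrow> 0 \<le> ip \<phi> xs xs"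
  by (simp add: pdef_def)

lemma sum_list_swap:
  fixes f :: "'a \<Rightarrow> 'b \<Rightarrow> 'c :: comm_monoid_add"
  shows "(\<Sum>x\<leftarrow>xs. \<Sum>y\<leftarrow>ys. f x y) = (\<Sum>y\<leftarrow>ys. \<Sum>x\<leftarrow>xs. f x y)"
  by (induction xs) (simp_all add: sum_list_addf)

lemma abs_sum_list_map_le:
  fixes f :: "'a \<Rightarrow> real"
  shows "\<bar>\<Sum>x\<leftarrow>xs. f x\<bar> \<le> (\<Sum>x\<leftarrow>xs. \<bar>f x\<bar>)"
  by (induction xs) auto

lemma ip_append_left: "ip \<phi> (xs @ ys) zs = ip \<phi> xs zs + ip \<phi> ys zs"
  by (simp add: ip_def)

lemma ip_append_right: "ip \<phi> xs (ys @ zs) = ip \<phi> xs ys + ip \<phi> xs zs"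
  by (simp add: ip_def sum_list_addf)

lemma ip_scale_left: "ip \<phi> (map (\<lambda>x. (t * fst x, snd x)) xs) ys = t * ip \<phi> xs ys"
  by (simp add: ip_def o_def sum_list_const_mult[symmetric] mult.assoc)

lemma ip_scale_right: "ip \<phi> xs (map (\<lambda>x. (t * fst x, snd x)) ys) = t * ip \<phi> xs ys"
  by (simp add: ip_def o_def sum_list_const_mult[symmetric] mult_ac)

lemma ip_shift:
  "ip \<phi> (map (\<lambda>x. (fst x, snd x + s)) xs) (map (\<lambda>x. (fst x, snd x + t)) ys)
    = ip (\<lambda>h. \<phi> (h + (s - t))) xs ys"
  by (simp add: ip_def o_def algebra_simps)

lemma ip_swap: "ip \<phi> xs ys = ip (\<lambda>h. \<phi> (-h)) ys xs"
  unfolding ip_def by (subst sum_list_swap) (simp add: mult_ac)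

lemma ip_commute: "pdef \<phi> \<Longrightarrow> ip \<phi> xs ys = ip \<phi> ys xs"
  by (subst ip_swap) (simp add: pdef_even)

lemma ip_add_fun: "ip (\<lambda>h. \<phi> h + \<psi> h) xs ys = ip \<phi> xs ys + ip \<psi> xs ys"
  by (simp add: ip_def sum_list_addf distrib_left)

lemma ip_diff_fun: "ip (\<lambda>h. \<phi> h - \<psi> h) xs ys = ip \<phi> xs ys - ip \<psi> xs ys"
  by (simp add: ip_def sum_list_subtractf right_diff_distrib)

lemma ip_concat_shifts:
  "ip \<phi> (concat (map (\<lambda>s. map (\<lambda>x. (fst x, snd x + s)) xs) ss))
        (concat (map (\<lambda>s. map (\<lambda>x. (fst x, snd x + s)) ys) ts))
    = (\<Sum>s\<leftarrow>ss. \<Sum>t\<leftarrow>ts. ip (\<lambda>h. \<phi> (h + (s - t))) xs ys)"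
proof (induction ss)
  case Nil
  then show ?case by (simp add: ip_def)
next
  case (Cons s ss)
  have "ip \<phi> (map (\<lambda>x. (fst x, snd x + s)) xs) (concat (map (\<lambda>s. map (\<lambda>x. (fst x, snd x + s)) ys) ts))
    = (\<Sum>t\<leftarrow>ts. ip (\<lambda>h. \<phi> (h + (s - t))) xs ys)"
    by (induction ts) (simp_all add: ip_append_right ip_shift, simp add: ip_def)
  with Cons show ?case by (simp add: ip_append_left)
qed

lemma ip_close:
  assumes "\<And>x y. x \<in> set xs \<Longrightarrow> y \<in> set ys \<Longrightarrow> \<bar>\<phi> (snd x - snd y) - \<psi> (snd x - snd y)\<bar> \<le> e"
  shows "\<bar>ip \<phi> xs ys - ip \<psi> xs ys\<bar> \<le> e * ((\<Sum>x\<leftarrow>xs. \<bar>fst x\<bar>) * (\<Sum>y\<leftarrow>ys. \<bar>fst y\<bar>))"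
proof -
  have "ip \<phi> xs ys - ip \<psi> xs ys
      = (\<Sum>x\<leftarrow>xs. \<Sum>y\<leftarrow>ys. fst x * fst y * (\<phi> (snd x - snd y) - \<psi> (snd x - snd y)))"
    unfolding ip_diff_fun[symmetric] by (simp add: ip_def)
  also have "\<bar>\<dots>\<bar> \<le> (\<Sum>x\<leftarrow>xs. \<bar>\<Sum>y\<leftarrow>ys. fst x * fst y * (\<phi> (snd x - snd y) - \<psi> (snd x - snd y))\<bar>)"
    by (rule abs_sum_list_map_le)
  also have "\<dots> \<le> (\<Sum>x\<leftarrow>xs. \<Sum>y\<leftarrow>ys. e * (\<bar>fst x\<bar> * \<bar>fst y\<bar>))"
  proof (rule sum_list_mono)
    fix x assume x: "x \<in> set xs"
    have "\<bar>\<Sum>y\<leftarrow>ys. fst x * fst y * (\<phi> (snd x - snd y) - \<psi> (snd x - snd y))\<bar>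
        \<le> (\<Sum>y\<leftarrow>ys. \<bar>fst x * fst y * (\<phi> (snd x - snd y) - \<psi> (snd x - snd y))\<bar>)"
      by (rule abs_sum_list_map_le)
    also have "\<dots> \<le> (\<Sum>y\<leftarrow>ys. e * (\<bar>fst x\<bar> * \<bar>fst y\<bar>))"
    proof (rule sum_list_mono)
      fix y assume y: "y \<in> set ys"
      have "\<bar>fst x * fst y\<bar> * \<bar>\<phi> (snd x - snd y) - \<psi> (snd x - snd y)\<bar> \<le> \<bar>fst x * fst y\<bar> * e"
        by (intro mult_left_mono assms x y) simp
      then show "\<bar>fst x * fst y * (\<phi> (snd x - snd y) - \<psi> (snd x - snd y))\<bar> \<le> e * (\<bar>fst x\<bar> * \<bar>fst y\<bar>)"
        by (simp add: abs_mult mult_ac)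
    qed
    finally show "\<bar>\<Sum>y\<leftarrow>ys. fst x * fst y * (\<phi> (snd x - snd y) - \<psi> (snd x - snd y))\<bar>
        \<le> (\<Sum>y\<leftarrow>ys. e * (\<bar>fst x\<bar> * \<bar>fst y\<bar>))" .
  qed
  also have "\<dots> = e * ((\<Sum>x\<leftarrow>xs. \<bar>fst x\<bar>) * (\<Sum>y\<leftarrow>ys. \<bar>fst y\<bar>))"
    by (simp add: sum_list_const_mult sum_list_mult_const)
  finally show ?thesis .
qed

lemma ip_Cauchy_Schwarz:
  assumes "pdef \<phi>"
  shows "(ip \<phi> xs ys)\<^sup>2 \<le> ip \<phi> xs xs * ip \<phi> ys ys"
proof -
  define a b c where "a = ip \<phi> xs xs" and "b = ip \<phi> xs ys" and "c = ip \<phi> ys ys"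
  have q: "0 \<le> a + 2 * t * b + t\<^sup>2 * c" for t
  proof -
    define W where "W = xs @ map (\<lambda>x. (t * fst x, snd x)) ys"
    have "ip \<phi> W W = a + 2 * t * b + t\<^sup>2 * c"
      using ip_commute[OF assms, of ys xs]
      by (simp add: W_def ip_append_left ip_append_right ip_scale_left ip_scale_right
          a_def b_def c_def power2_eq_square algebra_simps)
    with pdef_ip[OF assms] show ?thesis by metis
  qed
  have "0 \<le> c" using pdef_ip[OF assms] by (simp add: c_def)
  have "b\<^sup>2 \<le> a * c"
  proof (cases "c = 0")
    case True
    have "b = 0"
    proof (rule ccontr)
      assume "b \<noteq> 0"
      \<comment> \<open>For c = 0 the quadratic is affine in t, and this t gives it the value
        -1.\<close>
      then show False using q[of "- (a + 1) / (2 * b)"] True by (simp add: field_simps)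
    qed
    with True show ?thesis by simp
  next
    case False
    with \<open>0 \<le> c\<close> have "0 < c" by simp
    then show ?thesis using q[of "- b / c"]
      by (simp add: field_simps power2_eq_square)
  qed
  then show ?thesis by (simp add: a_def b_def c_def)
qed

lemma pdef_zero_nonneg: "pdef \<phi> \<Longrightarrow> 0 \<le> \<phi> 0"
  using pdef_ip[of \<phi> "[(1, 0)]"] by (simp add: ip_def)

lemma pdef_abs_le:
  assumes "pdef \<phi>"
  shows "\<bar>\<phi> h\<bar> \<le> \<phi> 0"
proof -
  have "(\<phi> h)\<^sup>2 \<le> (\<phi> 0)\<^sup>2"
    using ip_Cauchy_Schwarz[OF assms, of "[(1, h)]" "[(1, 0)]"]
    by (simp add: ip_def power2_eq_square)
  then show ?thesis
    using pdef_zero_nonneg[OF assms] abs_le_square_iff[of "\<phi> h" "\<phi> 0"] by simp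
qed

lemma pdef_bounded: "pdef \<phi> \<Longrightarrow> bounded (range (\<lambda>n. \<phi> (s n)))"
  using pdef_abs_le by (auto simp: bounded_iff)

text \<open>Cauchy-Schwarz against the vector U^(-s) f - f, whose squared norm is 2 (\<phi> 0 -
  \<phi> s). The bound is independent of h; this is why a shift by s can be ignored anywhere once
  \<phi> s is close to \<phi> 0.\<close>

lemma pdef_Krein:
  assumes "pdef \<phi>"
  shows "(\<phi> (h + s) - \<phi> h)\<^sup>2 \<le> 2 * \<phi> 0 * (\<phi> 0 - \<phi> s)"
  using ip_Cauchy_Schwarz[OF assms, of "[(1, h)]" "[(1, - s), (-1, 0)]"] pdef_even[OF assms, of s]
  by (simp add: ip_def power2_eq_square algebra_simps)

text \<open>Cauchy-Schwarz for U^g f against the sum of the vectors U^(-s) f.\<close>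

lemma pdef_Bessel:
  assumes "pdef \<phi>"
  shows "(\<Sum>s\<leftarrow>ss. \<phi> (g + s))\<^sup>2 \<le> \<phi> 0 * (\<Sum>s\<leftarrow>ss. \<Sum>t\<leftarrow>ss. \<phi> (s - t))"
proof -
  define ys where "ys = map (\<lambda>s. (1::real, - s)) ss"
  have "ip \<phi> ys ys = (\<Sum>s\<leftarrow>ss. \<Sum>t\<leftarrow>ss. \<phi> (t - s))"
    by (simp add: ip_def ys_def o_def)
  also have "\<dots> = (\<Sum>s\<leftarrow>ss. \<Sum>t\<leftarrow>ss. \<phi> (s - t))"
    by (subst sum_list_swap) simp
  finally show ?thesis
    using ip_Cauchy_Schwarz[OF assms, of "[(1, g)]" ys]
    by (simp add: ip_def ys_def o_def)
qed

lemma pdef_0: "pdef (\<lambda>_. 0)"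
  by (simp add: pdef_def ip_def)

lemma pdef_add: "pdef \<phi> \<Longrightarrow> pdef \<psi> \<Longrightarrow> pdef (\<lambda>h. \<phi> h + \<psi> h)"
  by (simp add: pdef_def ip_add_fun)

text \<open>Applied to the squared norm of a sum of N translates: after division by N^2 the N
  diagonal terms disappear in the limit and only B survives.\<close>

lemma double_sum_le:
  fixes f :: "'a \<Rightarrow> 'a \<Rightarrow> real" and B C :: real
  assumes "sorted_wrt (\<lambda>s t. f s t \<le> B \<and> f t s \<le> B) ss" "\<And>s. s \<in> set ss \<Longrightarrow> f s s \<le> C"
  shows "(\<Sum>s\<leftarrow>ss. \<Sum>t\<leftarrow>ss. f s t) \<le> length ss * C + length ss * (real (length ss) - 1) * B"
  using assms
proof (induction ss)
  case (Cons s ss)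
  have 1: "(\<Sum>t\<leftarrow>ss. f s t) \<le> length ss * B"
    using sum_list_mono[of ss "f s" "\<lambda>_. B"] Cons.prems by (simp add: sum_list_triv)
  have 2: "(\<Sum>t\<leftarrow>ss. f t s) \<le> length ss * B"
    using sum_list_mono[of ss "\<lambda>t. f t s" "\<lambda>_. B"] Cons.prems by (simp add: sum_list_triv)
  have 3: "(\<Sum>s\<leftarrow>ss. \<Sum>t\<leftarrow>ss. f s t) \<le> length ss * C + length ss * (real (length ss) - 1) * B"
    using Cons by simp
  have 4: "f s s \<le> C" using Cons.prems by simp
  have "(\<Sum>u\<leftarrow>s # ss. \<Sum>t\<leftarrow>s # ss. f u t)
      = f s s + (\<Sum>t\<leftarrow>ss. f s t) + (\<Sum>t\<leftarrow>ss. f t s) + (\<Sum>s\<leftarrow>ss. \<Sum>t\<leftarrow>ss. f s t)"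
    by (simp add: sum_list_addf)
  also have "\<dots> \<le> C + length ss * B + length ss * B + (length ss * C + length ss * (real (length ss) - 1) * B)"
    using 1 2 3 4 by linarith
  also have "\<dots> = length (s # ss) * C + length (s # ss) * (real (length (s # ss)) - 1) * B"
    by (simp add: algebra_simps)
  finally show ?case .
qed simp

text \<open>If \<open>U\<^bsup>s - t\<^esup>\<close> converges weakly to \<open>T\<close> along the pairs \<open>s\<close> before \<open>t\<close> of suitable long lists,
  then \<open>T\<close> behaves like an orthogonal projection. It is self-adjoint because averages of \<open>U\<^sup>s f\<close>
  over early and over late parts of the list are close in norm.\<close>

context
  fixes \<phi> T :: "int \<Rightarrow> real"
  assumes pd: "pdef \<phi>"
    and approx: "\<And>H e N. finite H \<Longrightarrow> 0 < e \<Longrightarrow>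
      \<exists>ss. length ss = N \<and> sorted_wrt (\<lambda>s t. \<forall>h\<in>H. \<bar>\<phi> (h + (s - t)) - T h\<bar> < e) ss"
begin

lemma shift_limit_even: "T (-g) = T g"
proof -
  have bd: "\<bar>T (-g) - T g\<bar> \<le> 2 / N + sqrt (\<phi> 0 * (4 * \<phi> 0 / N + 4 / N))" if N: "0 < N" for N :: nat
  proof -
    define e where "e = 1 / real N"
    have e: "0 < e" using N by (simp add: e_def)
    obtain ss where ss: "length ss = N + Suc N"
      "sorted_wrt (\<lambda>s t. \<forall>h\<in>{0, g, -g}. \<bar>\<phi> (h + (s - t)) - T h\<bar> < e) ss"
      using approx[of "{0, g, -g}" e "N + Suc N"] e by auto
    define R where "R = (\<lambda>s t. \<forall>h\<in>{0, g, -g}. \<bar>\<phi> (h + (s - t)) - T h\<bar> < e)"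
    define as where "as = take N ss"
    \<comment> \<open>The middle entry separates the halves: against U^(g + l) f, each early
      translate contributes about T (-g) and each late one about T g.\<close>
    define l where "l = ss ! N"
    define bs where "bs = drop (Suc N) ss"
    have split: "ss = as @ l # bs"
      unfolding as_def l_def bs_def using ss(1) by (simp add: id_take_nth_drop)
    have len: "length as = N" "length bs = N"
      using ss(1) by (auto simp: as_def bs_def)
    have srt: "sorted_wrt R (as @ l # bs)" using ss(2) split by (simp add: R_def)
    then have Ras: "sorted_wrt R as" and Rbs: "sorted_wrt R bs"
      and Rab: "\<And>a b. a \<in> set as \<Longrightarrow> b \<in> set bs \<Longrightarrow> R a b"
      and Ral: "\<And>a. a \<in> set as \<Longrightarrow> R a l" and Rlb: "\<And>b. b \<in> set bs \<Longrightarrow> R l b"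
      by (auto simp: sorted_wrt_append)
    have sym: "\<phi> (t - s) = \<phi> (s - t)" for s t
      using pdef_even[OF pd, of "s - t"] by simp
    have R0: "R s t \<Longrightarrow> \<phi> (s - t) \<le> T 0 + e \<and> \<phi> (t - s) \<le> T 0 + e" for s t
      unfolding R_def using sym[of t s] by auto
    \<comment> \<open>In the squared norm of \<open>W\<close> the terms N^2 T 0 cancel and a
      multiple of - N T 0 remains, which this bound controls.\<close>
    have T0: "- \<phi> 0 \<le> T 0 + e"
    proof -
      obtain a where "a \<in> set as" using len N by (cases as) auto
      from R0[OF Ral[OF this]] have "\<phi> (a - l) \<le> T 0 + e" by simp
      with pdef_abs_le[OF pd, of "a - l"] show ?thesis by linarith
    qed
    have dd: "(\<Sum>s\<leftarrow>us. \<Sum>t\<leftarrow>us. \<phi> (s - t)) \<le> N * \<phi> 0 + N * (real N - 1) * (T 0 + e)"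
      if "sorted_wrt R us" "length us = N" for us
    proof -
      have "sorted_wrt (\<lambda>s t. \<phi> (s - t) \<le> T 0 + e \<and> \<phi> (t - s) \<le> T 0 + e) us"
        using that(1) R0 by (rule sorted_wrt_mono_rel[rotated]) auto
      from double_sum_le[where f = "\<lambda>s t. \<phi> (s - t)", OF this, of "\<phi> 0"] that(2) show ?thesis by simp
    qed
    have ab: "real N * (real N * (T 0 - e)) \<le> (\<Sum>a\<leftarrow>as. \<Sum>b\<leftarrow>bs. \<phi> (a - b))"
    proof -
      have "(\<Sum>a\<leftarrow>as. \<Sum>b\<leftarrow>bs. T 0 - e) \<le> (\<Sum>a\<leftarrow>as. \<Sum>b\<leftarrow>bs. \<phi> (a - b))"
        using Rab by (intro sum_list_mono) (fastforce simp: R_def)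
      then show ?thesis by (simp add: sum_list_triv len)
    qed
    \<comment> \<open>The early translates minus the late ones: a vector whose squared norm is of
      order N instead of N^2.\<close>
    define W where "W = map (\<lambda>s. (1::real, s)) as @ map (\<lambda>s. (-1, s)) bs"
    have "ip \<phi> W W = (\<Sum>s\<leftarrow>as. \<Sum>t\<leftarrow>as. \<phi> (s - t)) + (\<Sum>s\<leftarrow>bs. \<Sum>t\<leftarrow>bs. \<phi> (s - t))
        - (\<Sum>a\<leftarrow>as. \<Sum>b\<leftarrow>bs. \<phi> (a - b)) - (\<Sum>b\<leftarrow>bs. \<Sum>a\<leftarrow>as. \<phi> (b - a))"
      by (simp add: W_def ip_append_left ip_append_right)
        (simp add: ip_def o_def sum_list_subtractf uminus_sum_list_map[symmetric, unfolded o_def])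
    also have "(\<Sum>b\<leftarrow>bs. \<Sum>a\<leftarrow>as. \<phi> (b - a)) = (\<Sum>a\<leftarrow>as. \<Sum>b\<leftarrow>bs. \<phi> (a - b))"
      by (subst sum_list_swap) (simp add: sym)
    finally have W0: "ip \<phi> W W = (\<Sum>s\<leftarrow>as. \<Sum>t\<leftarrow>as. \<phi> (s - t)) + (\<Sum>s\<leftarrow>bs. \<Sum>t\<leftarrow>bs. \<phi> (s - t))
        - (\<Sum>a\<leftarrow>as. \<Sum>b\<leftarrow>bs. \<phi> (a - b)) - (\<Sum>a\<leftarrow>as. \<Sum>b\<leftarrow>bs. \<phi> (a - b))" .
    have "a + b - c - c \<le> 2 * u - 2 * v" if "a \<le> u" "b \<le> u" "v \<le> c" for a b c u v :: real
      using that by simp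
    from this[OF dd[OF Ras len(1)] dd[OF Rbs len(2)] ab]
    have W1: "ip \<phi> W W \<le> 2 * (N * \<phi> 0 + N * (real N - 1) * (T 0 + e)) - 2 * (real N * (real N * (T 0 - e)))"
      unfolding W0 .
    also have "\<dots> = 2 * N * \<phi> 0 - 2 * N * (T 0 + e) + 4 * (real N)\<^sup>2 * e"
      by (simp add: algebra_simps power2_eq_square)
    also have "\<dots> \<le> 4 * N * \<phi> 0 + 4 * (real N)\<^sup>2 * e"
      using mult_left_mono[OF T0, of "2 * real N"] by simp
    finally have W2: "ip \<phi> W W \<le> (real N)\<^sup>2 * (4 * \<phi> 0 / N + 4 / N)"
    proof -
      have "4 * N * \<phi> 0 + 4 * (real N)\<^sup>2 * e = (real N)\<^sup>2 * (4 * \<phi> 0 / N + 4 / N)"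
        using N by (simp add: e_def power2_eq_square field_simps)
      then show "ip \<phi> W W \<le> 4 * N * \<phi> 0 + 4 * (real N)\<^sup>2 * e \<Longrightarrow> ?thesis" by simp
    qed
    define z where "z = ip \<phi> [(1, g + l)] W"
    have "z = (\<Sum>a\<leftarrow>as. \<phi> (g + l - a)) - (\<Sum>b\<leftarrow>bs. \<phi> (g + l - b))"
      by (simp add: z_def W_def ip_append_right)
        (simp add: ip_def o_def uminus_sum_list_map[symmetric, unfolded o_def])
    moreover have "(\<Sum>a\<leftarrow>as. \<phi> (g + l - a)) \<le> (\<Sum>a\<leftarrow>as. T (-g) + e)"
      "(\<Sum>a\<leftarrow>as. T (-g) - e) \<le> (\<Sum>a\<leftarrow>as. \<phi> (g + l - a))"
    proof -
      have "\<bar>\<phi> (g + l - a) - T (-g)\<bar> < e" if "a \<in> set as" for a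
        using Ral[OF that] pdef_even[OF pd, of "g + l - a"] by (simp add: R_def algebra_simps)
      then show "(\<Sum>a\<leftarrow>as. \<phi> (g + l - a)) \<le> (\<Sum>a\<leftarrow>as. T (-g) + e)"
        "(\<Sum>a\<leftarrow>as. T (-g) - e) \<le> (\<Sum>a\<leftarrow>as. \<phi> (g + l - a))"
        by (intro sum_list_mono; fastforce)+
    qed
    moreover have "(\<Sum>b\<leftarrow>bs. \<phi> (g + l - b)) \<le> (\<Sum>b\<leftarrow>bs. T g + e)"
      "(\<Sum>b\<leftarrow>bs. T g - e) \<le> (\<Sum>b\<leftarrow>bs. \<phi> (g + l - b))"
    proof -
      have "\<bar>\<phi> (g + l - b) - T g\<bar> < e" if "b \<in> set bs" for b
        using Rlb[OF that] by (simp add: R_def algebra_simps)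
      then show "(\<Sum>b\<leftarrow>bs. \<phi> (g + l - b)) \<le> (\<Sum>b\<leftarrow>bs. T g + e)"
        "(\<Sum>b\<leftarrow>bs. T g - e) \<le> (\<Sum>b\<leftarrow>bs. \<phi> (g + l - b))"
        by (intro sum_list_mono; fastforce)+
    qed
    ultimately have "\<bar>z - N * (T (-g) - T g)\<bar> \<le> 2 * N * e"
      unfolding sum_list_triv len by (simp add: algebra_simps)
    then have "N * \<bar>T (-g) - T g\<bar> \<le> 2 * N * e + \<bar>z\<bar>"
      using abs_mult[of "real N" "T (-g) - T g"] by linarith
    moreover have "\<bar>z\<bar> \<le> N * sqrt (\<phi> 0 * (4 * \<phi> 0 / N + 4 / N))"
    proof -
      have "z\<^sup>2 \<le> \<phi> 0 * ip \<phi> W W"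
        using ip_Cauchy_Schwarz[OF pd, of "[(1, g + l)]" W] by (simp add: z_def ip_def)
      also have "\<dots> \<le> \<phi> 0 * ((real N)\<^sup>2 * (4 * \<phi> 0 / N + 4 / N))"
        using W2 pdef_zero_nonneg[OF pd] by (rule mult_left_mono)
      finally have "z\<^sup>2 \<le> (real N)\<^sup>2 * (\<phi> 0 * (4 * \<phi> 0 / N + 4 / N))"
        by (simp add: mult_ac)
      then have "sqrt (z\<^sup>2) \<le> sqrt ((real N)\<^sup>2 * (\<phi> 0 * (4 * \<phi> 0 / N + 4 / N)))"
        by (rule real_sqrt_le_mono)
      then show ?thesis by (simp only: real_sqrt_mult real_sqrt_abs abs_of_nat)
    qed
    ultimately have "N * \<bar>T (-g) - T g\<bar> \<le> N * (2 * e + sqrt (\<phi> 0 * (4 * \<phi> 0 / N + 4 / N)))"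
      by (simp add: algebra_simps)
    with N show ?thesis by (simp add: e_def)
  qed
  have "(\<lambda>N. 2 / real N + sqrt (\<phi> 0 * (4 * \<phi> 0 / N + 4 / N))) \<longlonglongrightarrow> 0 + sqrt (\<phi> 0 * (0 + 0))"
    by (intro tendsto_intros lim_const_over_n)
  moreover have "eventually (\<lambda>N. \<bar>T (-g) - T g\<bar> \<le> 2 / real N + sqrt (\<phi> 0 * (4 * \<phi> 0 / N + 4 / N))) sequentially"
    using eventually_gt_at_top[of 0] by eventually_elim (rule bd)
  ultimately have "\<bar>T (-g) - T g\<bar> \<le> 0 + sqrt (\<phi> 0 * (0 + 0))"
    by (rule tendsto_lowerbound) simp
  then show ?thesis by simp
qed

text \<open>Passes from single values to the quadratic form, in which only the finitely many
  differences of the shifts in \<open>xs\<close> occur.\<close>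

lemma shift_limit_approx:
  assumes "0 < e"
  shows "\<exists>ss. length ss = N \<and>
    sorted_wrt (\<lambda>s t. \<bar>ip (\<lambda>h. \<phi> (h + (s - t))) xs xs - ip T xs xs\<bar> \<le> e * (\<Sum>x\<leftarrow>xs. \<bar>fst x\<bar>)\<^sup>2) ss"
proof -
  define H where "H = (\<lambda>(x, y). snd x - snd y) ` (set xs \<times> set xs)"
  obtain ss where ss: "length ss = N" "sorted_wrt (\<lambda>s t. \<forall>h\<in>H. \<bar>\<phi> (h + (s - t)) - T h\<bar> < e) ss"
    using approx[of H e N] assms by (auto simp: H_def)
  have "sorted_wrt (\<lambda>s t. \<bar>ip (\<lambda>h. \<phi> (h + (s - t))) xs xs - ip T xs xs\<bar> \<le> e * (\<Sum>x\<leftarrow>xs. \<bar>fst x\<bar>)\<^sup>2) ss"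
  proof (rule sorted_wrt_mono_rel[OF _ ss(2)])
    fix s t assume st: "\<forall>h\<in>H. \<bar>\<phi> (h + (s - t)) - T h\<bar> < e"
    have "\<bar>ip (\<lambda>h. \<phi> (h + (s - t))) xs xs - ip T xs xs\<bar>
        \<le> e * ((\<Sum>x\<leftarrow>xs. \<bar>fst x\<bar>) * (\<Sum>x\<leftarrow>xs. \<bar>fst x\<bar>))"
    proof (rule ip_close)
      fix x y assume "x \<in> set xs" "y \<in> set xs"
      then have "snd x - snd y \<in> H" by (force simp: H_def)
      with st show "\<bar>\<phi> (snd x - snd y + (s - t)) - T (snd x - snd y)\<bar> \<le> e"
        by (intro less_imp_le) blast
    qed
    then show "\<bar>ip (\<lambda>h. \<phi> (h + (s - t))) xs xs - ip T xs xs\<bar> \<le> e * (\<Sum>x\<leftarrow>xs. \<bar>fst x\<bar>)\<^sup>2"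
      by (simp add: power2_eq_square)
  qed
  with ss(1) show ?thesis by blast
qed

lemma ip_shift_sym: "ip (\<lambda>h. \<phi> (h + (t - s))) xs xs = ip (\<lambda>h. \<phi> (h + (s - t))) xs xs"
proof (subst ip_swap)
  have "\<phi> (- h + (t - s)) = \<phi> (h + (s - t))" for h
    using pdef_even[OF pd, of "h + (s - t)"] by (simp add: algebra_simps)
  then show "ip (\<lambda>h. \<phi> (- h + (t - s))) xs xs = ip (\<lambda>h. \<phi> (h + (s - t))) xs xs" by simp
qed

text \<open>A sum of N translates of a vector has nonnegative squared norm; the off-diagonal part is
  about N^2 times the form of T, whereas the diagonal is of order N.\<close>

lemma shift_limit_pdef: "pdef T"
proof -
  have "0 \<le> ip T xs xs" for xs
  proof -
    define K where "K = (\<Sum>x\<leftarrow>xs. \<bar>fst x\<bar>)\<^sup>2"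
    define C where "C = ip \<phi> xs xs"
    define L where "L = ip T xs xs"
    have bd: "0 \<le> C / N + (L + K / N) * ((N - 1) / N)" if N: "0 < N" for N :: nat
    proof -
      obtain ss where ss: "length ss = N"
        "sorted_wrt (\<lambda>s t. \<bar>ip (\<lambda>h. \<phi> (h + (s - t))) xs xs - L\<bar> \<le> 1 / N * K) ss"
        using shift_limit_approx[of "1 / real N" N xs] N by (auto simp: K_def L_def)
      have "sorted_wrt (\<lambda>s t. ip (\<lambda>h. \<phi> (h + (s - t))) xs xs \<le> L + K / N \<and>
          ip (\<lambda>h. \<phi> (h + (t - s))) xs xs \<le> L + K / N) ss"
        using ss(2) by (rule sorted_wrt_mono_rel[rotated]) (auto simp: ip_shift_sym abs_le_iff)
      then have "(\<Sum>s\<leftarrow>ss. \<Sum>t\<leftarrow>ss. ip (\<lambda>h. \<phi> (h + (s - t))) xs xs)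
          \<le> length ss * C + length ss * (real (length ss) - 1) * (L + K / N)"
        by (rule double_sum_le[where f = "\<lambda>s t. ip (\<lambda>h. \<phi> (h + (s - t))) xs xs"]) (simp add: C_def)
      moreover have "0 \<le> (\<Sum>s\<leftarrow>ss. \<Sum>t\<leftarrow>ss. ip (\<lambda>h. \<phi> (h + (s - t))) xs xs)"
        unfolding ip_concat_shifts[symmetric] by (rule pdef_ip[OF pd])
      ultimately have "0 \<le> (N * C + N * (real N - 1) * (L + K / N)) / N\<^sup>2"
        using ss(1) by simp
      also have "\<dots> = C / N + (L + K / N) * ((N - 1) / N)"
        using N by (simp add: power2_eq_square field_simps of_nat_diff)
      finally show ?thesis .
    qed
    have "(\<lambda>N. C / N + (L + K / N) * (1 - 1 / N)) \<longlonglongrightarrow> 0 + (L + 0) * (1 - 0)"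
      by (intro tendsto_intros lim_const_over_n)
    moreover have "eventually (\<lambda>N. 0 \<le> C / N + (L + K / N) * (1 - 1 / real N)) sequentially"
      using eventually_gt_at_top[of 0]
    proof eventually_elim
      case (elim N)
      then have "real (N - 1) / N = 1 - 1 / real N"
        by (simp add: field_simps of_nat_diff)
      then show ?case using bd[OF elim] by metis
    qed
    ultimately show ?thesis
      using tendsto_lowerbound[of _ _ sequentially 0] by (fastforce simp: L_def)
  qed
  with shift_limit_even show ?thesis by (simp add: pdef_def)
qed

text \<open>Two shifts suffice: the squared norm of U^s x - U^t x is twice that of x minus twice the
  inner product of U^(s - t) x with x, and the latter is close to the form of T.\<close>

lemma shift_limit_le: "pdef (\<lambda>h. \<phi> h - T h)"
proof -
  have "ip T xs xs \<le> ip \<phi> xs xs" for xs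
  proof (rule field_le_epsilon)
    fix e :: real assume e: "0 < e"
    define K where "K = (\<Sum>x\<leftarrow>xs. \<bar>fst x\<bar>)\<^sup>2"
    have K: "0 \<le> K" by (simp add: K_def)
    obtain ss where ss: "length ss = 2"
      "sorted_wrt (\<lambda>s t. \<bar>ip (\<lambda>h. \<phi> (h + (s - t))) xs xs - ip T xs xs\<bar> \<le> e / (K + 1) * K) ss"
      using shift_limit_approx[of "e / (K + 1)" 2 xs] divide_pos_pos[OF e, of "K + 1"] K
      unfolding K_def by fastforce
    obtain s t where "ss = [s, t]"
      using ss(1) by (auto simp: length_Suc_conv numeral_2_eq_2)
    with ss(2) have st: "\<bar>ip (\<lambda>h. \<phi> (h + (s - t))) xs xs - ip T xs xs\<bar> \<le> e / (K + 1) * K"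
      by simp
    define W where "W = map (\<lambda>x. (fst x, snd x + s)) xs @
      map (\<lambda>x. (- 1 * fst x, snd x)) (map (\<lambda>x. (fst x, snd x + t)) xs)"
    have "0 \<le> ip \<phi> W W" by (rule pdef_ip[OF pd])
    also have "\<dots> = 2 * ip \<phi> xs xs - 2 * ip (\<lambda>h. \<phi> (h + (s - t))) xs xs"
      unfolding W_def ip_append_left ip_append_right ip_scale_left ip_scale_right ip_shift
      using ip_shift_sym[of t s xs] by simp
    finally have "ip (\<lambda>h. \<phi> (h + (s - t))) xs xs \<le> ip \<phi> xs xs" by simp
    moreover have "e / (K + 1) * K \<le> e"
      using e K by (simp add: field_simps)
    ultimately show "ip T xs xs \<le> ip \<phi> xs xs + e" using st by linarith
  qed
  with shift_limit_even pd show ?thesis by (simp add: pdef_def ip_diff_fun)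
qed

end

text \<open>Van der Corput's trick: many nearly orthogonal translates cannot all correlate with one
  vector. Bessel's inequality for N of them gives about (N x)^2 on the left and \<phi> 0 (N \<phi> 0
  + N^2 B) on the right.\<close>

lemma pdef_van_der_Corput:
  assumes "pdef \<phi>"
    and "\<And>e N. 0 < e \<Longrightarrow> \<exists>ss. length ss = N \<and> (\<forall>s\<in>set ss. \<bar>\<phi> (g + s) - x\<bar> < e) \<and>
      sorted_wrt (\<lambda>s t. \<phi> (s - t) < B + e) ss"
  shows "x\<^sup>2 \<le> \<phi> 0 * B"
proof -
  \<comment> \<open>Squaring needs a nonnegative lower bound, hence the maximum with 0.\<close>
  have bd: "(max 0 (\<bar>x\<bar> - 1 / N))\<^sup>2 \<le> \<phi> 0 * (\<phi> 0 / N + (B + 1 / N) * (1 - 1 / N))" if N: "0 < N" for N :: nat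
  proof -
    define e where "e = 1 / real N"
    have e: "0 < e" using N by (simp add: e_def)
    obtain ss where ss: "length ss = N" "\<forall>s\<in>set ss. \<bar>\<phi> (g + s) - x\<bar> < e"
      "sorted_wrt (\<lambda>s t. \<phi> (s - t) < B + e) ss"
      using assms(2)[OF e] by blast
    have sym: "\<phi> (t - s) = \<phi> (s - t)" for s t
      using pdef_even[OF assms(1), of "s - t"] by simp
    have "sorted_wrt (\<lambda>s t. \<phi> (s - t) \<le> B + e \<and> \<phi> (t - s) \<le> B + e) ss"
      using ss(3) by (rule sorted_wrt_mono_rel[rotated]) (use sym in auto)
    from double_sum_le[where f = "\<lambda>s t. \<phi> (s - t)", OF this, of "\<phi> 0"]
    have "(\<Sum>s\<leftarrow>ss. \<Sum>t\<leftarrow>ss. \<phi> (s - t)) \<le> N * \<phi> 0 + N * (real N - 1) * (B + e)"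
      using ss(1) by simp
    then have "\<phi> 0 * (\<Sum>s\<leftarrow>ss. \<Sum>t\<leftarrow>ss. \<phi> (s - t)) \<le> \<phi> 0 * (N * \<phi> 0 + N * (real N - 1) * (B + e))"
      using pdef_zero_nonneg[OF assms(1)] by (rule mult_left_mono)
    with pdef_Bessel[OF assms(1), where g = g and ss = ss]
    have 1: "(\<Sum>s\<leftarrow>ss. \<phi> (g + s))\<^sup>2 \<le> \<phi> 0 * (N * \<phi> 0 + N * (real N - 1) * (B + e))"
      by linarith
    have "(\<Sum>s\<leftarrow>ss. \<phi> (g + s)) \<le> (\<Sum>s\<leftarrow>ss. x + e)" "(\<Sum>s\<leftarrow>ss. x - e) \<le> (\<Sum>s\<leftarrow>ss. \<phi> (g + s))"
      using ss(2) by (intro sum_list_mono; fastforce)+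
    then have "N * \<bar>x\<bar> \<le> N * e + \<bar>\<Sum>s\<leftarrow>ss. \<phi> (g + s)\<bar>"
      unfolding sum_list_triv ss(1) using abs_mult[of "real N" x] by (simp add: algebra_simps)
    then have "N * max 0 (\<bar>x\<bar> - e) \<le> \<bar>\<Sum>s\<leftarrow>ss. \<phi> (g + s)\<bar>"
      by (simp add: max_def algebra_simps)
    then have "(N * max 0 (\<bar>x\<bar> - e))\<^sup>2 \<le> (\<Sum>s\<leftarrow>ss. \<phi> (g + s))\<^sup>2"
      using power_mono[of "N * max 0 (\<bar>x\<bar> - e)" _ 2] by fastforce
    with 1 have "(N * max 0 (\<bar>x\<bar> - e))\<^sup>2 / N\<^sup>2 \<le> \<phi> 0 * (N * \<phi> 0 + N * (real N - 1) * (B + e)) / N\<^sup>2"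
      by (intro divide_right_mono) auto
    also have "(N * max 0 (\<bar>x\<bar> - e))\<^sup>2 / N\<^sup>2 = (max 0 (\<bar>x\<bar> - e))\<^sup>2"
      using N by (simp add: power_mult_distrib)
    also have "\<phi> 0 * (N * \<phi> 0 + N * (real N - 1) * (B + e)) / N\<^sup>2
        = \<phi> 0 * (\<phi> 0 / N + (B + e) * (1 - 1 / N))"
      using N by (simp add: power2_eq_square field_simps)
    finally show ?thesis by (simp add: e_def)
  qed
  have "(\<lambda>N. (max 0 (\<bar>x\<bar> - 1 / real N))\<^sup>2) \<longlonglongrightarrow> (max 0 (\<bar>x\<bar> - 0))\<^sup>2"
    by (intro tendsto_intros lim_const_over_n)
  moreover have "(\<lambda>N. \<phi> 0 * (\<phi> 0 / N + (B + 1 / N) * (1 - 1 / real N))) \<longlonglongrightarrow> \<phi> 0 * (0 + (B + 0) * (1 - 0))"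
    by (intro tendsto_intros lim_const_over_n)
  moreover have "eventually (\<lambda>N. (max 0 (\<bar>x\<bar> - 1 / N))\<^sup>2 \<le>
      \<phi> 0 * (\<phi> 0 / N + (B + 1 / N) * (1 - 1 / real N))) sequentially"
    using eventually_gt_at_top[of 0] by eventually_elim (rule bd)
  ultimately have "(max 0 (\<bar>x\<bar> - 0))\<^sup>2 \<le> \<phi> 0 * (0 + (B + 0) * (1 - 0))"
    using tendsto_le[OF sequentially_bot] by blast
  then show ?thesis by simp
qed

section \<open>Limits of positive definite functions along polynomials\<close>

text \<open>The discrete derivative of Q is divisible by its step m. The second clause ranges over
  all bounds d on the degree, so that it can be used in the induction without knowing whether the
  degree drops.\<close>

lemma shift_poly_quotient:
  fixes Q :: "int poly"
  shows "\<exists>S. (\<forall>x. poly Q (m + x) - poly Q x = m * poly S x) \<and>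
    (\<forall>d. degree Q \<le> Suc d \<longrightarrow> degree S \<le> d \<and> coeff S d = (int d + 1) * coeff Q (Suc d))"
proof (induction Q)
  case 0
  show ?case by (intro exI[of _ 0]) simp
next
  case (pCons a Q)
  then obtain S where S: "\<And>x. poly Q (m + x) - poly Q x = m * poly S x"
    "\<And>d. degree Q \<le> Suc d \<Longrightarrow> degree S \<le> d \<and> coeff S d = (int d + 1) * coeff Q (Suc d)"
    by blast
  \<comment> \<open>The product rule: (m + x) Q (m + x) - x Q x = m (Q x + (m + x) S x).\<close>
  define S' where "S' = Q + smult m S + pCons 0 S"
  have "poly (pCons a Q) (m + x) - poly (pCons a Q) x = m * poly S' x" for x
  proof -
    have "poly Q (m + x) = poly Q x + m * poly S x"
      using S(1)[of x] by simp
    then show ?thesis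
      by (simp add: S'_def algebra_simps)
  qed
  moreover have "degree S' \<le> d \<and> coeff S' d = (int d + 1) * coeff (pCons a Q) (Suc d)"
    if d: "degree (pCons a Q) \<le> Suc d" for d
  proof -
    have dQ: "degree Q \<le> d"
      using d by (cases "Q = 0") auto
    show ?thesis
    proof (cases d)
      case 0
      with dQ S(2)[of 0] have "degree S = 0" "coeff S 0 = 0"
        by (auto simp: coeff_eq_0)
      then have "S = 0"
        by (metis leading_coeff_0_iff)
      with 0 dQ show ?thesis by (simp add: S'_def)
    next
      case (Suc d')
      with dQ S(2)[of d'] have *: "degree S \<le> d'" "coeff S d' = (int d' + 1) * coeff Q (Suc d')"
        by auto
      have "degree (pCons 0 S) \<le> d"
        using *(1) Suc degree_pCons_le[of 0 S] by linarith
      moreover have "degree (smult m S) \<le> d"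
        using *(1) Suc degree_smult_le[of m S] by linarith
      ultimately have "degree S' \<le> d"
        unfolding S'_def using dQ by (intro degree_add_le)
      moreover have "coeff S d = 0"
        using *(1) Suc by (intro coeff_eq_0) simp
      ultimately show ?thesis
        using * Suc by (simp add: S'_def algebra_simps)
    qed
  qed
  ultimately show ?case by blast
qed

text \<open>R measures the failure of Q to be additive. Divisibility by \<open>m\<close> makes R
  harmless for rigid parts as soon as the multiplier divides \<open>m\<close>; the drop in degree
  drives van der Corput's trick.\<close>

lemma poly_difference:
  fixes Q :: "int poly"
  assumes "coeff Q 0 = 0"
  obtains R where "\<And>x. poly R x = poly Q (m + x) - poly Q m - poly Q x" "coeff R 0 = 0"
    "\<And>j. m dvd coeff R j" "\<And>d. degree Q \<le> Suc d \<Longrightarrow> degree R \<le> d"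
    "\<And>d. degree Q = Suc d \<Longrightarrow> m \<noteq> 0 \<Longrightarrow> 0 < d \<Longrightarrow> degree R = d"
proof -
  obtain S where S: "\<And>x. poly Q (m + x) - poly Q x = m * poly S x"
    "\<And>d. degree Q \<le> Suc d \<Longrightarrow> degree S \<le> d \<and> coeff S d = (int d + 1) * coeff Q (Suc d)"
    using shift_poly_quotient[of Q m] by blast
  define R where "R = smult m (S - [:coeff S 0:])"
  have S0: "m * coeff S 0 = poly Q m"
    using S(1)[of 0] assms by (simp add: poly_0_coeff_0)
  show thesis
  proof
    show "poly R x = poly Q (m + x) - poly Q m - poly Q x" for x
      using S(1)[of x] S0 by (simp add: R_def algebra_simps)
    show "coeff R 0 = 0" "m dvd coeff R j" for j
      by (simp_all add: R_def)
    show le: "degree R \<le> d" if "degree Q \<le> Suc d" for d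
      using S(2)[OF that] degree_smult_le[of m "S - [:coeff S 0:]"] degree_diff_le[of S d "[:coeff S 0:]"]
      unfolding R_def by (simp add: order_trans)
    show "degree R = d" if "degree Q = Suc d" "m \<noteq> 0" "0 < d" for d
    proof (rule antisym)
      show "degree R \<le> d" using le that by simp
      have "coeff [:coeff S 0:] d = 0" using that(3) by (intro coeff_eq_0) simp
      then have "coeff R d = m * ((int d + 1) * coeff Q (Suc d))"
        using S(2)[of d] that(1) by (simp add: R_def)
      moreover have "coeff Q (Suc d) \<noteq> 0"
        using that(1) by (metis leading_coeff_0_iff degree_0 nat.distinct(1))
      ultimately show "d \<le> degree R"
        using that(2) by (intro le_degree) auto
    qed
  qed
qed

text \<open>Polynomial functions of \<open>k\<close> variables without constant term, as needed to eliminate the last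
  variable: modulo \<open>a\<close> the coefficients \<open>C ys\<close> do not depend on multiples \<open>ys\<close> of \<open>a\<close>.\<close>

primrec zpoly :: "nat \<Rightarrow> nat \<Rightarrow> (nat list \<Rightarrow> int) \<Rightarrow> bool" where
  "zpoly D 0 P \<longleftrightarrow> P [] = 0"
| "zpoly D (Suc k) P \<longleftrightarrow> (\<exists>P0 C. zpoly D k P0 \<and>
     (\<forall>ys y. length ys = k \<longrightarrow> P (ys @ [y]) = P0 ys + poly (C ys) (int y)) \<and>
     (\<forall>ys. length ys = k \<longrightarrow> coeff (C ys) 0 = 0 \<and> degree (C ys) \<le> D) \<and>
     (\<forall>a ys zs j. length ys = k \<and> length zs = k \<and> (\<forall>y\<in>set ys. a dvd y) \<and> (\<forall>z\<in>set zs. a dvd z)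
        \<longrightarrow> int a dvd coeff (C ys) j - coeff (C zs) j))"

lemma pdef_diff_le: "pdef (\<lambda>h. \<nu> h - \<rho> h) \<Longrightarrow> \<nu> s - \<rho> s \<le> \<nu> 0 - \<rho> 0"
  using pdef_abs_le[of "\<lambda>h. \<nu> h - \<rho> h" s] by linarith

lemma sorted_wrt_two:
  "sorted_wrt P xs \<Longrightarrow> 2 \<le> length xs \<Longrightarrow> (\<And>a b. P a b \<Longrightarrow> X a \<and> X b) \<Longrightarrow> x \<in> set xs \<Longrightarrow> X x"
  by (cases xs; cases "tl xs") auto

section \<open>Weak limits along an idempotent ultrafilter\<close>

context idem_uf
begin

text \<open>The correlation function of T f with f, where T is the weak limit of U^(Q n) along
  p.\<close>

definition shift_lim :: "(int \<Rightarrow> real) \<Rightarrow> (nat \<Rightarrow> int) \<Rightarrow> int \<Rightarrow> real" where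
  "shift_lim \<phi> Q h = Lim p (\<lambda>n. \<phi> (h + Q n))"

lemma shift_lim: "pdef \<phi> \<Longrightarrow> ((\<lambda>n. \<phi> (h + Q n)) \<longlongrightarrow> shift_lim \<phi> Q h) p"
  unfolding shift_lim_def by (rule ultra_tendsto_Lim[OF ultra pdef_bounded])

lemma shift_lim_eqI: "((\<lambda>n. \<phi> (h + Q n)) \<longlongrightarrow> l) p \<Longrightarrow> shift_lim \<phi> Q h = l"
  unfolding shift_lim_def by (rule tendsto_Lim[OF not_bot])

text \<open>This is norm convergence of U^(s n) f to f, the squared distance being 2 (\<phi> 0 -
  \<phi> (s n)).\<close>

definition null :: "(int \<Rightarrow> real) \<Rightarrow> (nat \<Rightarrow> int) \<Rightarrow> bool" where
  "null \<phi> s \<longleftrightarrow> ((\<lambda>n. \<phi> (s n)) \<longlongrightarrow> \<phi> 0) p"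

text \<open>Krein's inequality is uniform in the base point, so \<open>h\<close> may vary with
  \<open>n\<close>.\<close>

lemma null_shift:
  assumes "pdef \<phi>" "null \<phi> s"
  shows "((\<lambda>n. \<phi> (h n + s n) - \<phi> (h n)) \<longlongrightarrow> 0) p"
proof (rule Lim_null_comparison)
  show "eventually (\<lambda>n. norm (\<phi> (h n + s n) - \<phi> (h n)) \<le> sqrt (2 * \<phi> 0 * (\<phi> 0 - \<phi> (s n)))) p"
    using pdef_Krein[OF assms(1)] by (intro always_eventually allI) (simp add: real_le_rsqrt)
  have "((\<lambda>n. sqrt (2 * \<phi> 0 * (\<phi> 0 - \<phi> (s n)))) \<longlongrightarrow> sqrt (2 * \<phi> 0 * (\<phi> 0 - \<phi> 0))) p"
    using assms(2) unfolding null_def by (intro tendsto_intros)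
  then show "((\<lambda>n. sqrt (2 * \<phi> 0 * (\<phi> 0 - \<phi> (s n)))) \<longlongrightarrow> 0) p" by simp
qed

lemma null_shift_tendsto:
  assumes "pdef \<phi>" "null \<phi> s" "((\<lambda>n. \<phi> (h n)) \<longlongrightarrow> l) p"
  shows "((\<lambda>n. \<phi> (h n + s n)) \<longlongrightarrow> l) p"
  using tendsto_add[OF null_shift[OF assms(1,2), of h] assms(3)] by simp

lemma null_add:
  assumes "pdef \<phi>" "null \<phi> s" "null \<phi> t"
  shows "null \<phi> (\<lambda>n. s n + t n)"
  using null_shift_tendsto[OF assms(1,3), of s "\<phi> 0"] assms(2) by (simp add: null_def)

lemma null_zero: "null \<phi> (\<lambda>n. 0)"
  by (simp add: null_def)

lemma null_minus: "pdef \<phi> \<Longrightarrow> null \<phi> s \<Longrightarrow> null \<phi> (\<lambda>n. - s n)"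
  by (simp add: null_def pdef_even)

lemma null_diff: "pdef \<phi> \<Longrightarrow> null \<phi> s \<Longrightarrow> null \<phi> t \<Longrightarrow> null \<phi> (\<lambda>n. s n - t n)"
  using null_add[of \<phi> s "\<lambda>n. - t n"] null_minus by simp

lemma null_mult:
  assumes "pdef \<phi>" "null \<phi> s"
  shows "null \<phi> (\<lambda>n. c * s n)"
proof -
  have nat: "null \<phi> (\<lambda>n. int k * s n)" for k
  proof (induction k)
    case (Suc k)
    then show ?case
      using null_add[OF assms(1,2) Suc] by (simp add: algebra_simps)
  qed (simp add: null_zero)
  show ?thesis
  proof (cases "0 \<le> c")
    case True
    then show ?thesis using nat[of "nat c"] by simp
  next
    case False
    then show ?thesis using null_minus[OF assms(1) nat[of "nat (- c)"]] by simp
  qed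
qed

lemma null_sum:
  assumes "pdef \<phi>" "\<And>j. j \<in> S \<Longrightarrow> null \<phi> (s j)"
  shows "null \<phi> (\<lambda>n. \<Sum>j\<in>S. s j n)"
  using assms(2)
  by (induction S rule: infinite_finite_induct) (auto simp: null_zero intro: null_add[OF assms(1)])

text \<open>The difference \<nu> - \<rho> is largest at 0, so the loss \<rho> 0 - \<rho> (s n) of
  the part is at most the loss \<nu> 0 - \<nu> (s n) of the whole.\<close>

lemma null_mono:
  assumes "pdef \<rho>" "pdef (\<lambda>h. \<nu> h - \<rho> h)" "null \<nu> s"
  shows "null \<rho> s"
proof -
  have "((\<lambda>n. \<rho> (s n) - \<rho> 0) \<longlongrightarrow> 0) p"
  proof (rule Lim_null_comparison)
    have "norm (\<rho> (s n) - \<rho> 0) \<le> \<nu> 0 - \<nu> (s n)" for n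
      using pdef_diff_le[OF assms(2), of "s n"] pdef_abs_le[OF assms(1), of "s n"] by auto
    then show "eventually (\<lambda>n. norm (\<rho> (s n) - \<rho> 0) \<le> \<nu> 0 - \<nu> (s n)) p" by simp
    have "((\<lambda>n. \<nu> 0 - \<nu> (s n)) \<longlongrightarrow> \<nu> 0 - \<nu> 0) p"
      using assms(3) unfolding null_def by (intro tendsto_intros)
    then show "((\<lambda>n. \<nu> 0 - \<nu> (s n)) \<longlongrightarrow> 0) p" by simp
  qed
  then show ?thesis unfolding null_def by (simp add: LIM_zero_iff)
qed

lemma null_add_fun: "null \<phi> s \<Longrightarrow> null \<psi> s \<Longrightarrow> null (\<lambda>h. \<phi> h + \<psi> h) s"
  unfolding null_def by (rule tendsto_add)

text \<open>Along an idempotent ultrafilter, \<open>U\<^bsup>Q n\<^esup>\<close> converges weakly to an orthogonal projection if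
  \<open>U\<^bsup>Q (m + n) - Q m - Q n\<^esup>\<close> converges to the identity.\<close>

context
  fixes \<phi> :: "int \<Rightarrow> real" and Q :: "nat \<Rightarrow> int"
  assumes pd: "pdef \<phi>"
    and additive: "eventually (\<lambda>m. null \<phi> (\<lambda>n. Q (m + n) - Q m - Q n)) p"
begin

text \<open>For suffix sums t = h + t', additivity lets Q t - Q t' act like Q h, and U^(Q h) is
  close to its weak limit for most h.\<close>

lemma shift_lim_approx:
  assumes "finite H" "0 < e"
  shows "\<exists>ss. length ss = N \<and> sorted_wrt (\<lambda>s t. \<forall>h\<in>H. \<bar>\<phi> (h + (s - t)) - shift_lim \<phi> Q h\<bar> < e) ss"
proof -
  define R where "R m n \<longleftrightarrow> (\<forall>h\<in>H. \<bar>\<phi> (h + (Q (m + n) - Q n)) - shift_lim \<phi> Q h\<bar> < e)" for m n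
  have "eventually (\<lambda>m. eventually (\<lambda>n. R m n) p) p"
  proof -
    have "eventually (\<lambda>m. \<forall>h\<in>H. \<bar>\<phi> (h + Q m) - shift_lim \<phi> Q h\<bar> < e / 2) p"
    proof (rule eventually_ball_finite[OF assms(1)], rule ballI)
      fix h
      show "eventually (\<lambda>m. \<bar>\<phi> (h + Q m) - shift_lim \<phi> Q h\<bar> < e / 2) p"
        using tendstoD[OF shift_lim[OF pd], of "e / 2" h Q] assms(2) by (simp add: dist_real_def)
    qed
    with additive show ?thesis
    proof eventually_elim
      case (elim m)
      show ?case unfolding R_def
      proof (rule eventually_ball_finite[OF assms(1)], rule ballI)
        fix h assume h: "h \<in> H"
        from tendstoD[OF null_shift[OF pd elim(1), of "\<lambda>_. h + Q m"], of "e / 2"] assms(2)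
        have "eventually (\<lambda>n. \<bar>\<phi> (h + Q m + (Q (m + n) - Q m - Q n)) - \<phi> (h + Q m)\<bar> < e / 2) p"
          by (simp add: dist_real_def)
        then show "eventually (\<lambda>n. \<bar>\<phi> (h + (Q (m + n) - Q n)) - shift_lim \<phi> Q h\<bar> < e) p"
        proof eventually_elim
          case (elim n)
          have "h + Q m + (Q (m + n) - Q m - Q n) = h + (Q (m + n) - Q n)" by simp
          with elim h \<open>\<forall>h\<in>H. \<bar>\<phi> (h + Q m) - shift_lim \<phi> Q h\<bar> < e / 2\<close>
          have "\<bar>\<phi> (h + (Q (m + n) - Q n)) - \<phi> (h + Q m)\<bar> < e / 2"
            "\<bar>\<phi> (h + Q m) - shift_lim \<phi> Q h\<bar> < e / 2" by simp_all
          then show ?case by linarith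
        qed
      qed
    qed
  qed
  from suffix_sums[OF this, of N] obtain ts where ts: "length ts = N"
    "sorted_wrt (\<lambda>t t'. \<exists>h. t = h + t' \<and> R h t') ts" by blast
  have "sorted_wrt (\<lambda>t t'. \<forall>h\<in>H. \<bar>\<phi> (h + (Q t - Q t')) - shift_lim \<phi> Q h\<bar> < e) ts"
    using ts(2) by (rule sorted_wrt_mono_rel[rotated]) (auto simp: R_def)
  with ts(1) show ?thesis
    by (intro exI[of _ "map Q ts"]) (simp add: sorted_wrt_map)
qed

lemma shift_lim_pdef: "pdef (shift_lim \<phi> Q)"
  using pd shift_lim_approx by (rule shift_limit_pdef)

lemma shift_lim_le: "pdef (\<lambda>h. \<phi> h - shift_lim \<phi> Q h)"
  using pd shift_lim_approx by (rule shift_limit_le)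

text \<open>The value of T at Q m is the limit in n of \<phi> (Q m + Q n). Additivity replaces this
  by \<phi> (Q (m + n)), which is close to T 0 for most m and most n by idempotence.\<close>

lemma shift_lim_null: "null (shift_lim \<phi> Q) Q"
  unfolding null_def
proof (rule tendstoI)
  fix e :: real assume e: "0 < e"
  let ?T = "shift_lim \<phi> Q"
  have "eventually (\<lambda>n. \<bar>\<phi> (Q n) - ?T 0\<bar> < e / 3) p"
    using tendstoD[OF shift_lim[OF pd], of "e / 3" 0 Q] e by (simp add: dist_real_def)
  then have "eventually (\<lambda>m. eventually (\<lambda>n. \<bar>\<phi> (Q (m + n)) - ?T 0\<bar> < e / 3) p) p"
    using idem[of "\<lambda>n. \<bar>\<phi> (Q n) - ?T 0\<bar> < e / 3"] by simp
  with additive show "eventually (\<lambda>m. dist (?T (Q m)) (?T 0) < e) p"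
  proof eventually_elim
    case (elim m)
    have "((\<lambda>n. \<phi> (Q m + Q n + (Q (m + n) - Q m - Q n)) - \<phi> (Q m + Q n)) \<longlongrightarrow> 0) p"
      by (rule null_shift[OF pd elim(1)])
    from tendstoD[OF this, of "e / 3"] e
    have "eventually (\<lambda>n. \<bar>\<phi> (Q (m + n)) - \<phi> (Q m + Q n)\<bar> < e / 3) p"
      by (simp add: dist_real_def)
    with elim(2) have "eventually (\<lambda>n. \<bar>\<phi> (Q m + Q n) - ?T 0\<bar> \<le> 2 * e / 3) p"
      by eventually_elim linarith
    moreover have "((\<lambda>n. \<bar>\<phi> (Q m + Q n) - ?T 0\<bar>) \<longlongrightarrow> \<bar>?T (Q m) - ?T 0\<bar>) p"
      using shift_lim[OF pd, of "Q m" Q] by (intro tendsto_intros)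
    ultimately have "\<bar>?T (Q m) - ?T 0\<bar> \<le> 2 * e / 3"
      using tendsto_upperbound[OF _ _ not_bot] by blast
    with e show ?case by (simp add: dist_real_def)
  qed
qed

end

lemma shift_lim_van_der_Corput:
  assumes "pdef \<phi>" "eventually (\<lambda>m. Lim p (\<lambda>n. \<phi> (Q (m + n) - Q n)) \<le> B) p"
  shows "(shift_lim \<phi> Q g)\<^sup>2 \<le> \<phi> 0 * B"
proof (rule pdef_van_der_Corput[OF assms(1)])
  fix e :: real and N :: nat assume e: "0 < e"
  let ?x = "shift_lim \<phi> Q g"
  define X where "X = (\<lambda>n. \<bar>\<phi> (g + Q n) - ?x\<bar> < e)"
  define R where "R m n \<longleftrightarrow> X (m + n) \<and> X n \<and> \<phi> (Q (m + n) - Q n) < B + e" for m n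
  have X: "eventually X p"
    using tendstoD[OF shift_lim[OF assms(1)], of e g Q] e by (simp add: dist_real_def X_def)
  then have "eventually (\<lambda>m. eventually (\<lambda>n. X (m + n)) p) p"
    using idem[of X] by simp
  with assms(2) have "eventually (\<lambda>m. eventually (\<lambda>n. R m n) p) p"
  proof eventually_elim
    case (elim m)
    have "((\<lambda>n. \<phi> (Q (m + n) - Q n)) \<longlongrightarrow> Lim p (\<lambda>n. \<phi> (Q (m + n) - Q n))) p"
      by (rule ultra_tendsto_Lim[OF ultra pdef_bounded[OF assms(1)]])
    from order_tendstoD(2)[OF this, of "B + e"] elim(1) e
    have "eventually (\<lambda>n. \<phi> (Q (m + n) - Q n) < B + e) p" by simp
    with X elim(2) show ?case unfolding R_def by eventually_elim simp
  qed
  \<comment> \<open>The property X of an entry is read off a pair containing it; the two extra terms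
    ensure that there is a pair even for N = 0.\<close>
  from suffix_sums[OF this, of "N + 2"] obtain ts where ts: "length ts = N + 2"
    "sorted_wrt (\<lambda>t t'. \<exists>h. t = h + t' \<and> R h t') ts" by blast
  have "X t" if "t \<in> set ts" for t
    using ts(2) _ _ that by (rule sorted_wrt_two) (use ts(1) in \<open>auto simp: R_def\<close>)
  moreover have "sorted_wrt (\<lambda>t t'. \<phi> (Q t - Q t') < B + e) ts"
    using ts(2) by (rule sorted_wrt_mono_rel[rotated]) (auto simp: R_def)
  ultimately show "\<exists>ss. length ss = N \<and> (\<forall>s\<in>set ss. \<bar>\<phi> (g + s) - ?x\<bar> < e) \<and>
      sorted_wrt (\<lambda>s t. \<phi> (s - t) < B + e) ss"
    using ts(1) unfolding X_def
    by (intro exI[of _ "map Q (take N ts)"])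
      (auto simp: sorted_wrt_map sorted_wrt_take dest: in_set_takeD)
qed

section \<open>Rigid parts, and parts negligible along higher degrees\<close>

abbreviation pol :: "int poly \<Rightarrow> nat \<Rightarrow> int" where
  "pol Q n \<equiv> poly Q (int n)"

definition rigid :: "nat \<Rightarrow> nat \<Rightarrow> (int \<Rightarrow> real) \<Rightarrow> bool" where
  "rigid a i \<phi> \<longleftrightarrow> (\<forall>j\<in>{1..i}. null \<phi> (\<lambda>n. int a * int n ^ j))"

text \<open>For a part that is rigid up to degree i, the limit at 0 is the squared norm of the
  projection belonging to Q, so every such projection almost kills the part.\<close>

definition small :: "(int \<Rightarrow> real) \<Rightarrow> nat \<Rightarrow> real \<Rightarrow> bool" where
  "small \<phi> i e \<longleftrightarrow> (\<forall>Q. coeff Q 0 = 0 \<longrightarrow> degree Q = Suc i \<longrightarrow> shift_lim \<phi> (pol Q) 0 \<le> e)"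

lemma rigid_mono: "pdef \<rho> \<Longrightarrow> pdef (\<lambda>h. \<nu> h - \<rho> h) \<Longrightarrow> rigid a i \<nu> \<Longrightarrow> rigid a i \<rho>"
  unfolding rigid_def using null_mono by blast

lemma rigid_mult: "pdef \<phi> \<Longrightarrow> rigid a i \<phi> \<Longrightarrow> rigid (b * a) i \<phi>"
  unfolding rigid_def using null_mult[of \<phi> _ "int b"] by (simp add: mult.assoc)

lemma rigid_null_poly:
  assumes "pdef \<phi>" "rigid a i \<phi>" "coeff R 0 = 0" "degree R \<le> i" "\<And>j. int a dvd coeff R j"
  shows "null \<phi> (pol R)"
proof -
  have "null \<phi> (\<lambda>n. \<Sum>j\<le>degree R. coeff R j * int n ^ j)"
  proof (rule null_sum[OF assms(1)])
    fix j assume j: "j \<in> {..degree R}"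
    obtain c where c: "coeff R j = int a * c" using assms(5)[of j] by blast
    show "null \<phi> (\<lambda>n. coeff R j * int n ^ j)"
    proof (cases "j = 0")
      case True
      with assms(3) show ?thesis by (simp add: null_zero)
    next
      case False
      with j assms(2,4) have "null \<phi> (\<lambda>n. int a * int n ^ j)" by (auto simp: rigid_def)
      from null_mult[OF assms(1) this, of c] show ?thesis by (simp add: c mult_ac)
    qed
  qed
  then show ?thesis by (simp add: poly_altdef)
qed

text \<open>The additivity defect of Q has degree at most i and coefficients divisible by
  \<open>m\<close>, and \<open>a\<close> divides \<open>m\<close> for most \<open>m\<close>.\<close>

lemma rigid_additive:
  assumes "pdef \<phi>" "0 < a" "rigid a i \<phi>" "coeff Q 0 = 0" "degree Q \<le> Suc i"
  shows "eventually (\<lambda>m. null \<phi> (\<lambda>n. pol Q (m + n) - pol Q m - pol Q n)) p"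
  using eventually_dvd[OF assms(2)]
proof eventually_elim
  case (elim m)
  obtain R where R: "\<And>x. poly R x = poly Q (int m + x) - poly Q (int m) - poly Q x" "coeff R 0 = 0"
    "\<And>j. int m dvd coeff R j" "\<And>d. degree Q \<le> Suc d \<Longrightarrow> degree R \<le> d"
    using poly_difference[OF assms(4), of "int m"] by metis
  have "null \<phi> (pol R)"
    using R(2,4) assms(5) dvd_trans[OF _ R(3), of "int a"] elim
    by (intro rigid_null_poly[OF assms(1,3)]) simp_all
  then show ?case by (simp add: R(1))
qed

text \<open>The projected squared norms of \<rho> and \<nu> - \<rho> add up to that of \<nu>, and
  the one of \<nu> - \<rho> is nonnegative because \<nu> - \<rho> is rigid too.\<close>

lemma small_mono:
  assumes "pdef \<rho>" "pdef (\<lambda>h. \<nu> h - \<rho> h)" "pdef \<nu>" "0 < a" "rigid a i \<nu>" "small \<nu> i e"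
  shows "small \<rho> i e"
  unfolding small_def
proof (intro allI impI)
  fix Q :: "int poly" assume Q: "coeff Q 0 = 0" "degree Q = Suc i"
  let ?d = "\<lambda>h. \<nu> h - \<rho> h"
  have "pdef (\<lambda>h. \<nu> h - ?d h)" using assms(1) by simp
  then have "rigid a i ?d"
    by (rule rigid_mono[OF assms(2) _ assms(5)])
  then have "pdef (shift_lim ?d (pol Q))"
    using Q assms(2,4) by (intro shift_lim_pdef rigid_additive[of _ a i]) auto
  then have "0 \<le> shift_lim ?d (pol Q) 0" by (rule pdef_zero_nonneg)
  also have "\<dots> = shift_lim \<nu> (pol Q) 0 - shift_lim \<rho> (pol Q) 0"
    by (intro shift_lim_eqI tendsto_diff shift_lim assms)
  finally show "shift_lim \<rho> (pol Q) 0 \<le> e"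
    using assms(6) Q by (fastforce simp: small_def)
qed

text \<open>Van der Corput's trick lowers the degree down to \<open>Suc i\<close>, where the limit
  is positive definite and hence bounded by its value at 0. That e precedes \<phi>, a and Q in the
  quantifiers is essential for the decomposition.\<close>

lemma small_imp_bound:
  assumes "0 < \<eta>"
  shows "\<exists>e>0. \<forall>\<phi> a Q g. pdef \<phi> \<longrightarrow> \<phi> 0 \<le> 1 \<longrightarrow> 0 < a \<longrightarrow> rigid a i \<phi> \<longrightarrow> small \<phi> i e \<longrightarrow>
    coeff Q 0 = 0 \<longrightarrow> i < degree Q \<longrightarrow> degree Q \<le> D \<longrightarrow> \<bar>shift_lim \<phi> (pol Q) g\<bar> \<le> \<eta>"
  using assms
proof (induction D arbitrary: \<eta>)
  case 0
  then show ?case by (intro exI[of _ 1]) auto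
next
  case (Suc D)
  \<comment> \<open>The trick controls the square of the limit, so the lower degree is needed with
    accuracy \<eta>^2.\<close>
  have "0 < min \<eta> (\<eta>\<^sup>2)" using Suc.prems by simp
  from Suc.IH[OF this] obtain e where e: "0 < e"
    "\<And>\<phi> a Q g. pdef \<phi> \<Longrightarrow> \<phi> 0 \<le> 1 \<Longrightarrow> 0 < a \<Longrightarrow> rigid a i \<phi> \<Longrightarrow> small \<phi> i e \<Longrightarrow>
      coeff Q 0 = 0 \<Longrightarrow> i < degree Q \<Longrightarrow> degree Q \<le> D \<Longrightarrow> \<bar>shift_lim \<phi> (pol Q) g\<bar> \<le> min \<eta> (\<eta>\<^sup>2)"
    by blast
  show ?case
  proof (intro exI[of _ "min e \<eta>"] conjI allI impI)
    show "0 < min e \<eta>" using e(1) Suc.prems by simp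
    fix \<phi> and a :: nat and Q :: "int poly" and g
    assume pd: "pdef \<phi>" and le1: "\<phi> 0 \<le> 1" and a: "0 < a" and rig: "rigid a i \<phi>"
      and small: "small \<phi> i (min e \<eta>)" and Q0: "coeff Q 0 = 0" and deg: "i < degree Q" "degree Q \<le> Suc D"
    have small': "small \<phi> i e" using small by (auto simp: small_def)
    note IH = e(2)[OF pd le1 a rig small']
    consider "degree Q \<le> D" | "degree Q = Suc D" "i = D" | "degree Q = Suc D" "i < D"
      using deg by linarith
    then show "\<bar>shift_lim \<phi> (pol Q) g\<bar> \<le> \<eta>"
    proof cases
      case 1
      with IH[OF Q0 deg(1), of g] show ?thesis by simp
    next
      case 2
      then have "pdef (shift_lim \<phi> (pol Q))"
        by (intro shift_lim_pdef[OF pd] rigid_additive[OF pd a rig] Q0) simp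
      then have "\<bar>shift_lim \<phi> (pol Q) g\<bar> \<le> shift_lim \<phi> (pol Q) 0" by (rule pdef_abs_le)
      also have "\<dots> \<le> \<eta>" using small Q0 2 by (auto simp: small_def)
      finally show ?thesis .
    next
      case 3
      have "eventually (\<lambda>m. Lim p (\<lambda>n. \<phi> (pol Q (m + n) - pol Q n)) \<le> \<eta>\<^sup>2) p"
        using pos
      proof eventually_elim
        case (elim m)
        obtain R where R: "\<And>x. poly R x = poly Q (int m + x) - poly Q (int m) - poly Q x" "coeff R 0 = 0"
          "\<And>d. degree Q = Suc d \<Longrightarrow> int m \<noteq> 0 \<Longrightarrow> 0 < d \<Longrightarrow> degree R = d"
          using poly_difference[OF Q0, of "int m"] by metis
        have "degree R = D" using R(3) 3 elim by simp
        then have "\<bar>shift_lim \<phi> (pol R) (pol Q m)\<bar> \<le> min \<eta> (\<eta>\<^sup>2)"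
          using 3 by (intro IH R(2)) simp_all
        then have "shift_lim \<phi> (pol R) (pol Q m) \<le> \<eta>\<^sup>2" by linarith
        then show ?case by (simp add: shift_lim_def R(1))
      qed
      from shift_lim_van_der_Corput[OF pd this, of g]
      have "(shift_lim \<phi> (pol Q) g)\<^sup>2 \<le> \<phi> 0 * \<eta>\<^sup>2" .
      also have "\<dots> \<le> \<eta>\<^sup>2" using le1 by (simp add: mult_left_le_one_le pdef_zero_nonneg[OF pd])
      finally show ?thesis using Suc.prems by (simp add: abs_le_square_iff[of _ \<eta>, symmetric])
    qed
  qed
qed

text \<open>Let \<nu>' have nearly the largest value at 0 among the rigid parts of \<nu>. If the
  remainder had a projection T with T 0 above e for some Q of degree \<open>Suc i\<close>, then
  \<nu>' + T would be a rigid part beyond the supremum.\<close>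

lemma rigid_decompose:
  assumes "pdef \<nu>" "0 < a" "rigid a i \<nu>" "0 < e"
  obtains \<nu>' a' where "pdef \<nu>'" "pdef (\<lambda>h. \<nu> h - \<nu>' h)" "0 < a'" "rigid a' (Suc i) \<nu>'"
    "small (\<lambda>h. \<nu> h - \<nu>' h) i e"
proof -
  define G where "G \<nu>' \<longleftrightarrow> pdef \<nu>' \<and> pdef (\<lambda>h. \<nu> h - \<nu>' h) \<and> (\<exists>a'>0. rigid a' (Suc i) \<nu>')" for \<nu>'
  define S where "S = {\<nu>' 0 | \<nu>'. G \<nu>'}"
  have "G (\<lambda>_. 0)"
    using assms(1) by (auto simp: G_def pdef_0 rigid_def null_def intro: exI[of _ 1])
  then have ne: "S \<noteq> {}" by (auto simp: S_def)
  have bdd: "bdd_above S"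
    unfolding S_def G_def using pdef_zero_nonneg by (intro bdd_aboveI[of _ "\<nu> 0"]) fastforce
  have "Sup S - e < Sup S" using assms(4) by simp
  then obtain x where "x \<in> S" "Sup S - e < x"
    using less_cSup_iff[OF ne bdd] by blast
  then obtain \<nu>' where \<nu>': "G \<nu>'" "Sup S - e < \<nu>' 0"
    unfolding S_def by blast
  from \<nu>'(1) obtain a' where pd': "pdef \<nu>'" and pdd: "pdef (\<lambda>h. \<nu> h - \<nu>' h)" and a': "0 < a'"
    and rig': "rigid a' (Suc i) \<nu>'"
    by (auto simp: G_def)
  define \<rho> where "\<rho> = (\<lambda>h. \<nu> h - \<nu>' h)"
  have pd\<rho>: "pdef \<rho>" using pdd by (simp add: \<rho>_def)
  have rig\<rho>: "rigid a i \<rho>"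
    by (rule rigid_mono[OF pd\<rho> _ assms(3)]) (simp add: \<rho>_def pd')
  have "small \<rho> i e"
    unfolding small_def
  proof (intro allI impI)
    fix Q :: "int poly" assume Q: "coeff Q 0 = 0" "degree Q = Suc i"
    define T where "T = shift_lim \<rho> (pol Q)"
    have add: "eventually (\<lambda>m. null \<rho> (\<lambda>n. pol Q (m + n) - pol Q m - pol Q n)) p"
      using Q by (intro rigid_additive[OF pd\<rho> assms(2) rig\<rho>]) simp_all
    have pdT: "pdef T" and pd\<rho>T: "pdef (\<lambda>h. \<rho> h - T h)" and nT: "null T (pol Q)"
      unfolding T_def using pd\<rho> add by (rule shift_lim_pdef shift_lim_le shift_lim_null)+
    have rigT: "rigid a i T" by (rule rigid_mono[OF pdT pd\<rho>T rig\<rho>])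
    define b where "b = coeff Q (Suc i)"
    have b: "b \<noteq> 0" using Q(2) unfolding b_def by (metis leading_coeff_0_iff degree_0 nat.distinct(1))
    \<comment> \<open>T is rigid along Q itself and, with multiplier a, along the powers up to i.
      Subtracting a times the lower terms from a Q leaves a b n^(i + 1).\<close>
    have "rigid (nat \<bar>b\<bar> * a) (Suc i) T"
      unfolding rigid_def
    proof
      fix j assume j: "j \<in> {1..Suc i}"
      show "null T (\<lambda>n. int (nat \<bar>b\<bar> * a) * int n ^ j)"
      proof (cases "j \<le> i")
        case True
        with j rigid_mult[OF pdT rigT, of "nat \<bar>b\<bar>"] show ?thesis by (simp add: rigid_def)
      next
        case False
        with j have j: "j = Suc i" by simp
        define R where "R = smult (int a) (Q - monom b (Suc i))"
        have "degree (Q - monom b (Suc i)) \<le> i"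
        proof (rule degree_le, intro allI impI)
          fix k assume "i < k"
          then show "coeff (Q - monom b (Suc i)) k = 0"
            using Q(2) by (cases "k = Suc i") (auto simp: b_def intro: coeff_eq_0)
        qed
        then have "degree R \<le> i" using degree_smult_le[of "int a"] order_trans unfolding R_def by blast
        then have "null T (pol R)"
          by (intro rigid_null_poly[OF pdT rigT]) (simp_all add: R_def Q(1))
        from null_diff[OF pdT null_mult[OF pdT nT, of "int a"] this]
        have "null T (\<lambda>n. int a * b * int n ^ j)"
          by (simp add: R_def j poly_monom algebra_simps)
        from null_mult[OF pdT this, of "sgn b"]
        have "null T (\<lambda>n. \<bar>b\<bar> * (int a * int n ^ j))"
          by (simp only: abs_sgn mult_ac)
        then show ?thesis by (simp add: mult.assoc)
      qed
    qed
    \<comment> \<open>A common multiple of both multipliers serves the sum \<nu>' + T.\<close>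
    then have "rigid (a' * (nat \<bar>b\<bar> * a)) (Suc i) T" by (rule rigid_mult[OF pdT])
    moreover have "rigid ((nat \<bar>b\<bar> * a) * a') (Suc i) \<nu>'" by (rule rigid_mult[OF pd' rig'])
    ultimately have "rigid (a' * (nat \<bar>b\<bar> * a)) (Suc i) (\<lambda>h. \<nu>' h + T h)"
      unfolding rigid_def by (auto simp: mult_ac intro: null_add_fun)
    moreover have "0 < a' * (nat \<bar>b\<bar> * a)" using a' b assms(2) by simp
    moreover have "pdef (\<lambda>h. \<nu> h - (\<nu>' h + T h))"
      using pd\<rho>T by (simp add: \<rho>_def algebra_simps)
    ultimately have "G (\<lambda>h. \<nu>' h + T h)"
      unfolding G_def using pdef_add[OF pd' pdT] by blast
    then have "\<nu>' 0 + T 0 \<in> S" by (auto simp: S_def)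
    then have "\<nu>' 0 + T 0 \<le> Sup S" by (rule cSup_upper[OF _ bdd])
    with \<nu>'(2) show "shift_lim \<rho> (pol Q) 0 \<le> e" by (simp add: T_def)
  qed
  with that[OF pd' pdd a' rig'] show thesis by (simp add: \<rho>_def)
qed

text \<open>Induction on the number of variables, eliminating the last one. If its degree typically
  exceeds i, the limit in it is at most \<eta> in absolute value. Otherwise all \<open>C ys\<close>
  act like one polynomial Q, because for multiples of \<open>a\<close> they differ by a polynomial
  of degree at most i with coefficients divisible by \<open>a\<close>; the limit then replaces
  \<rho> by its part \<open>shift_lim \<rho> (pol Q)\<close> at \<open>P0 ys\<close>. The gap
  between \<eta> and \<eta>' turns a bound on a limit into one for most arguments.\<close>

lemma evk_small_lower_bound:
  assumes "0 < a" "\<eta> < \<eta>'" "0 \<le> \<eta>"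
    and bound: "\<And>\<phi> Q g. pdef \<phi> \<Longrightarrow> \<phi> 0 \<le> 1 \<Longrightarrow> rigid a i \<phi> \<Longrightarrow> small \<phi> i e \<Longrightarrow>
      coeff Q 0 = 0 \<Longrightarrow> i < degree Q \<Longrightarrow> degree Q \<le> D \<Longrightarrow> \<bar>shift_lim \<phi> (pol Q) g\<bar> \<le> \<eta>"
    and "zpoly D k P" "pdef \<rho>" "\<rho> 0 \<le> 1" "rigid a i \<rho>" "small \<rho> i e"
  shows "evk p k (\<lambda>ys. - \<eta>' < \<rho> (P ys))"
  using assms(5-)
proof (induction k arbitrary: P \<rho>)
  case 0
  then show ?case using assms(2,3) pdef_zero_nonneg[of \<rho>] by simp
next
  case (Suc k)
  from Suc.prems(1) obtain P0 C where P0: "zpoly D k P0"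
    and P: "\<And>ys y. length ys = k \<Longrightarrow> P (ys @ [y]) = P0 ys + pol (C ys) y"
    and C: "\<And>ys. length ys = k \<Longrightarrow> coeff (C ys) 0 = 0 \<and> degree (C ys) \<le> D"
    and cong: "\<And>a ys zs j. length ys = k \<Longrightarrow> length zs = k \<Longrightarrow> \<forall>y\<in>set ys. a dvd y \<Longrightarrow>
      \<forall>z\<in>set zs. a dvd z \<Longrightarrow> int a dvd coeff (C ys) j - coeff (C zs) j"
    by auto
  note pd = Suc.prems(2) and le1 = Suc.prems(3) and rig = Suc.prems(4) and sm = Suc.prems(5)
  have "evk p k (\<lambda>ys. eventually (\<lambda>y. - \<eta>' < \<rho> (P (ys @ [y]))) p)"
  proof (rule disjE[OF evk_disj_not[OF ultra, of k "\<lambda>ys. i < degree (C ys)"]])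
    assume "evk p k (\<lambda>ys. i < degree (C ys))"
    then show ?thesis
    proof (rule evk_mono)
      fix ys :: "nat list" assume ys: "length ys = k" "i < degree (C ys)"
      have "\<bar>shift_lim \<rho> (pol (C ys)) (P0 ys)\<bar> \<le> \<eta>"
        using bound[OF pd le1 rig sm] C[OF ys(1)] ys(2) by blast
      then have "- \<eta>' < shift_lim \<rho> (pol (C ys)) (P0 ys)" using assms(2) by simp
      from order_tendstoD(1)[OF shift_lim[OF pd] this]
      show "eventually (\<lambda>y. - \<eta>' < \<rho> (P (ys @ [y]))) p" by (simp add: P[OF ys(1)])
    qed
  next
    assume "evk p k (\<lambda>ys. \<not> i < degree (C ys))"
    with evk_set[OF eventually_dvd[OF assms(1)]]
    have ev: "evk p k (\<lambda>ys. (\<forall>y\<in>set ys. a dvd y) \<and> \<not> i < degree (C ys))"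
      by (rule evk_conj)
    from evk_ex[OF ultra this] obtain zs where zs: "length zs = k" "\<forall>z\<in>set zs. a dvd z"
      "degree (C zs) \<le> i" by auto
    define Q where "Q = C zs"
    have add: "eventually (\<lambda>m. null \<rho> (\<lambda>n. pol Q (m + n) - pol Q m - pol Q n)) p"
      using zs C[OF zs(1)] unfolding Q_def by (intro rigid_additive[OF pd assms(1) rig]) simp_all
    define \<rho>' where "\<rho>' = shift_lim \<rho> (pol Q)"
    have pd': "pdef \<rho>'" and pdd: "pdef (\<lambda>h. \<rho> h - \<rho>' h)"
      unfolding \<rho>'_def using pd add by (rule shift_lim_pdef shift_lim_le)+
    have "\<rho>' 0 \<le> 1" using pdef_zero_nonneg[OF pdd] le1 by simp
    moreover have "rigid a i \<rho>'" by (rule rigid_mono[OF pd' pdd rig])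
    moreover have "small \<rho>' i e" by (rule small_mono[OF pd' pdd pd assms(1) rig sm])
    ultimately have "evk p k (\<lambda>ys. - \<eta>' < \<rho>' (P0 ys))"
      using P0 pd' by (intro Suc.IH)
    with ev have "evk p k (\<lambda>ys. ((\<forall>y\<in>set ys. a dvd y) \<and> \<not> i < degree (C ys)) \<and> - \<eta>' < \<rho>' (P0 ys))"
      by (rule evk_conj)
    then show ?thesis
    proof (rule evk_mono)
      fix ys :: "nat list"
      assume ys: "length ys = k" "((\<forall>y\<in>set ys. a dvd y) \<and> \<not> i < degree (C ys)) \<and> - \<eta>' < \<rho>' (P0 ys)"
      have "degree (C ys - Q) \<le> i"
        using ys zs(3) by (intro degree_diff_le) (auto simp: Q_def)
      then have "null \<rho> (pol (C ys - Q))"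
        using C[OF ys(1)] C[OF zs(1)] cong[OF ys(1) zs(1)] ys(2) zs(2)
        by (intro rigid_null_poly[OF pd rig]) (auto simp: Q_def)
      from null_shift_tendsto[OF pd this shift_lim[OF pd, of "P0 ys" "pol Q"]]
      have "((\<lambda>y. \<rho> (P0 ys + pol (C ys) y)) \<longlongrightarrow> \<rho>' (P0 ys)) p"
        by (simp add: \<rho>'_def)
      from order_tendstoD(1)[OF this] ys(2)
      show "eventually (\<lambda>y. - \<eta>' < \<rho> (P (ys @ [y]))) p" by (simp add: P[OF ys(1)])
    qed
  qed
  then show ?case unfolding evk_snoc .
qed

text \<open>Induction on \<open>D - i\<close>. Once i reaches D, no degree exceeds i and the bound 0
  on limits holds vacuously. Before that, \<nu> splits into a part rigid up to \<open>Suc i\<close>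
  and a small remainder, each of which receives half of \<eta>.\<close>

lemma evk_rigid_lower_bound:
  assumes "zpoly D k P" "pdef \<nu>" "\<nu> 0 \<le> 1" "0 < a" "rigid a i \<nu>" "0 < \<eta>"
  shows "evk p k (\<lambda>ys. - \<eta> < \<nu> (P ys))"
  using assms(2-)
proof (induction "D - i" arbitrary: i \<nu> a \<eta>)
  case 0
  have "small \<nu> i 1"
    unfolding small_def
  proof (intro allI impI)
    fix Q :: "int poly"
    have "eventually (\<lambda>n. \<nu> (0 + pol Q n) \<le> 1) p"
      using pdef_abs_le[OF 0(2)] 0(3) by (intro always_eventually allI) (smt (verit))
    then show "shift_lim \<nu> (pol Q) 0 \<le> 1"
      using shift_lim[OF 0(2)] tendsto_upperbound[OF _ _ not_bot] by blast
  qed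
  then show ?case
    using 0 assms(1) by (intro evk_small_lower_bound[of a 0 \<eta> i 1 D k P]) auto
next
  case (Suc l)
  obtain e where e: "0 < e" and bound: "\<And>\<phi> a Q g. pdef \<phi> \<Longrightarrow> \<phi> 0 \<le> 1 \<Longrightarrow> 0 < a \<Longrightarrow> rigid a i \<phi> \<Longrightarrow>
      small \<phi> i e \<Longrightarrow> coeff Q 0 = 0 \<Longrightarrow> i < degree Q \<Longrightarrow> degree Q \<le> D \<Longrightarrow> \<bar>shift_lim \<phi> (pol Q) g\<bar> \<le> \<eta> / 4"
    using small_imp_bound[of "\<eta> / 4" i D] Suc.prems(5) by auto
  obtain \<nu>' a' where *: "pdef \<nu>'" "pdef (\<lambda>h. \<nu> h - \<nu>' h)" "0 < a'" "rigid a' (Suc i) \<nu>'"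
    "small (\<lambda>h. \<nu> h - \<nu>' h) i e"
    by (rule rigid_decompose[OF Suc.prems(1,3,4) e])
  have "\<nu>' 0 \<le> 1" using pdef_zero_nonneg[OF *(2)] Suc.prems(2) by simp
  then have 1: "evk p k (\<lambda>ys. - (\<eta> / 2) < \<nu>' (P ys))"
    using Suc.hyps * Suc.prems(5) by (intro Suc.hyps(1)[of "Suc i" _ a']) auto
  have "rigid a i (\<lambda>h. \<nu> h - \<nu>' h)"
    by (rule rigid_mono[OF *(2) _ Suc.prems(4)]) (simp add: *(1))
  moreover have "\<nu> 0 - \<nu>' 0 \<le> 1" using pdef_zero_nonneg[OF *(1)] Suc.prems(2) by simp
  ultimately have 2: "evk p k (\<lambda>ys. - (\<eta> / 2) < \<nu> (P ys) - \<nu>' (P ys))"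
    using Suc.prems assms(1) * bound
    by (intro evk_small_lower_bound[of a "\<eta> / 4" "\<eta> / 2" i e D k P "\<lambda>h. \<nu> h - \<nu>' h"]) auto
  from evk_conj[OF 1 2] show ?case
    by (rule evk_mono) auto
qed

text \<open>Rigidity up to degree 0 is an empty condition, so the induction can start at any
  \<nu>.\<close>

lemma evk_pdef_lower_bound:
  assumes "zpoly D k P" "pdef \<nu>" "\<nu> 0 \<le> 1" "0 < \<eta>"
  shows "evk p k (\<lambda>ys. - \<eta> < \<nu> (P ys))"
  using assms by (intro evk_rigid_lower_bound[of D k P \<nu> 1 0]) (auto simp: rigid_def)

end

section \<open>Positive Banach density and polynomial recurrence\<close>

text \<open>Positive upper Banach density, with the limit superior unfolded.\<close>

definition posdens :: "int set \<Rightarrow> bool" where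
  "posdens E \<longleftrightarrow> (\<exists>d>0. \<forall>L::int. \<exists>a b. L \<le> b - a \<and>
     d * real_of_int (b - a + 1) \<le> real (card (E \<inter> {a..b})))"

lemma posdensI:
  assumes "0 < d" "\<And>L::int. 0 \<le> L \<Longrightarrow> \<exists>a b. L \<le> b - a \<and> d * real_of_int (b - a + 1) \<le> real (card (E \<inter> {a..b}))"
  shows "posdens E"
  unfolding posdens_def
proof (intro exI[of _ d] conjI allI assms(1))
  fix L :: int
  obtain a b where "max L 0 \<le> b - a" "d * real_of_int (b - a + 1) \<le> real (card (E \<inter> {a..b}))"
    using assms(2)[of "max L 0"] by auto
  then show "\<exists>a b. L \<le> b - a \<and> d * real_of_int (b - a + 1) \<le> real (card (E \<inter> {a..b}))"
    by (intro exI[of _ a] exI[of _ b]) auto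
qed

lemma banach_density_posdens:
  assumes "0 < banach_density E"
  shows "posdens E"
proof -
  obtain a b :: "nat \<Rightarrow> int" where ab: "filterlim (\<lambda>n. b n - a n) at_top sequentially"
    "0 < limsup (\<lambda>n. ereal (real (card (E \<inter> {a n..b n})) / real_of_int (b n - a n + 1)))"
    using assms unfolding banach_density_def less_SUP_iff by auto
  obtain d where d: "0 < ereal d"
    "ereal d < limsup (\<lambda>n. ereal (real (card (E \<inter> {a n..b n})) / real_of_int (b n - a n + 1)))"
    using ereal_dense2[OF ab(2)] by blast
  show ?thesis
  proof (rule posdensI)
    show "0 < d" using d(1) by simp
    fix L :: int assume L: "0 \<le> L"
    have "eventually (\<lambda>n. L \<le> b n - a n) sequentially"
      using ab(1) by (simp add: filterlim_at_top)
    moreover have "\<not> eventually (\<lambda>n. ereal (real (card (E \<inter> {a n..b n})) / real_of_int (b n - a n + 1)) \<le> ereal d) sequentially"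
    proof
      assume "eventually (\<lambda>n. ereal (real (card (E \<inter> {a n..b n})) / real_of_int (b n - a n + 1)) \<le> ereal d) sequentially"
      from Limsup_bounded[OF this] d(2) show False by simp
    qed
    ultimately obtain n where n: "L \<le> b n - a n"
      "d < real (card (E \<inter> {a n..b n})) / real_of_int (b n - a n + 1)"
      by (metis (mono_tags, lifting) eventually_mono ereal_less_eq(3) not_less)
    then have "d * real_of_int (b n - a n + 1) \<le> real (card (E \<inter> {a n..b n}))"
      using L by (simp add: field_simps)
    with n(1) show "\<exists>a b. L \<le> b - a \<and> d * real_of_int (b - a + 1) \<le> real (card (E \<inter> {a..b}))"
      by blast
  qed
qed

lemma posdens_mono: "posdens E \<Longrightarrow> E \<subseteq> F \<Longrightarrow> posdens F"
proof -
  assume "posdens E" "E \<subseteq> F"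
  then obtain d where d: "0 < d" "\<And>L::int. \<exists>a b. L \<le> b - a \<and> d * real_of_int (b - a + 1) \<le> real (card (E \<inter> {a..b}))"
    by (auto simp: posdens_def)
  show "posdens F"
  proof (rule posdensI[OF d(1)])
    fix L :: int
    obtain a b where ab: "L \<le> b - a" "d * real_of_int (b - a + 1) \<le> real (card (E \<inter> {a..b}))"
      using d(2) by blast
    have "card (E \<inter> {a..b}) \<le> card (F \<inter> {a..b})"
      using \<open>E \<subseteq> F\<close> by (intro card_mono) auto
    with ab show "\<exists>a b. L \<le> b - a \<and> d * real_of_int (b - a + 1) \<le> real (card (F \<inter> {a..b}))"
      by (intro exI[of _ a] exI[of _ b]) auto
  qed
qed

lemma posdens_infinite:
  assumes "posdens E"
  shows "infinite E"
proof
  assume fin: "finite E"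
  obtain d where d: "0 < d" "\<And>L::int. \<exists>a b. L \<le> b - a \<and> d * real_of_int (b - a + 1) \<le> real (card (E \<inter> {a..b}))"
    using assms by (auto simp: posdens_def)
  obtain a b where ab: "\<lceil>card E / d\<rceil> \<le> b - a" "d * real_of_int (b - a + 1) \<le> real (card (E \<inter> {a..b}))"
    using d(2) by blast
  have "card E / d < real_of_int (b - a + 1)" using ab(1) by linarith
  then have "card E < d * real_of_int (b - a + 1)" using d(1) by (simp add: field_simps)
  also have "\<dots> \<le> real (card (E \<inter> {a..b}))" by (rule ab(2))
  also have "\<dots> \<le> card E" using fin by (simp add: card_mono)
  finally show False by simp
qed

lemma posdens_uminus:
  assumes "posdens E"
  shows "posdens (uminus ` E)"
proof -
  obtain d where d: "0 < d" "\<And>L::int. \<exists>a b. L \<le> b - a \<and> d * real_of_int (b - a + 1) \<le> real (card (E \<inter> {a..b}))"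
    using assms by (auto simp: posdens_def)
  show ?thesis
  proof (rule posdensI[OF d(1)])
    fix L :: int
    obtain a b where ab: "L \<le> b - a" "d * real_of_int (b - a + 1) \<le> real (card (E \<inter> {a..b}))"
      using d(2) by blast
    have "uminus ` E \<inter> {-b..-a} = uminus ` (E \<inter> {a..b})" by auto
    then have "card (uminus ` E \<inter> {-b..-a}) = card (E \<inter> {a..b})" by (simp add: card_image)
    with ab show "\<exists>a b. L \<le> b - a \<and> d * real_of_int (b - a + 1) \<le> real (card (uminus ` E \<inter> {a..b}))"
      by (intro exI[of _ "-b"] exI[of _ "-a"]) simp
  qed
qed

lemma posdens_dilate_pos:
  assumes "posdens E" "0 < c"
  shows "posdens ((*) c ` E)"
proof -
  obtain d where d: "0 < d" "\<And>L::int. \<exists>a b. L \<le> b - a \<and> d * real_of_int (b - a + 1) \<le> real (card (E \<inter> {a..b}))"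
    using assms by (auto simp: posdens_def)
  show ?thesis
  proof (rule posdensI[of "d / c"])
    show "0 < d / c" using d(1) assms(2) by simp
    fix L :: int assume L: "0 \<le> L"
    obtain a b where ab: "L \<le> b - a" "d * real_of_int (b - a + 1) \<le> real (card (E \<inter> {a..b}))"
      using d(2) by blast
    have "1 * (b - a) \<le> c * (b - a)"
      using assms(2) L ab(1) by (intro mult_right_mono) auto
    then have len: "L \<le> c * b - c * a" using ab(1) by (simp add: algebra_simps)
    have "real_of_int (c * b - c * a + 1) \<le> c * real_of_int (b - a + 1)"
      using assms(2) by (simp add: algebra_simps)
    then have "d / c * real_of_int (c * b - c * a + 1) \<le> d / c * (c * real_of_int (b - a + 1))"
      using d(1) assms(2) by (intro mult_left_mono) auto
    also have "\<dots> = d * real_of_int (b - a + 1)" using assms(2) by simp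
    also have "\<dots> \<le> real (card (E \<inter> {a..b}))" by (rule ab(2))
    also have "card (E \<inter> {a..b}) = card ((*) c ` (E \<inter> {a..b}))"
      using assms(2) by (simp add: card_image inj_on_def)
    also have "\<dots> \<le> card ((*) c ` E \<inter> {c * a..c * b})"
      using assms(2) by (intro card_mono) auto
    finally show "\<exists>a b. L \<le> b - a \<and> d / c * real_of_int (b - a + 1) \<le> real (card ((*) c ` E \<inter> {a..b}))"
      using len by (intro exI[of _ "c * a"] exI[of _ "c * b"]) simp
  qed
qed

lemma posdens_dilate:
  assumes "posdens E" "c \<noteq> 0"
  shows "posdens ((*) c ` E)"
proof (cases "0 < c")
  case True
  then show ?thesis using posdens_dilate_pos assms(1) by blast
next
  case False
  then have "posdens (uminus ` ((*) (- c) ` E))"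
    using assms by (intro posdens_uminus posdens_dilate_pos) auto
  then show ?thesis by (simp add: image_image)
qed

section \<open>Invariant means on the integers\<close>

lemma sum_sum_list_swap:
  fixes f :: "'a \<Rightarrow> 'b \<Rightarrow> real"
  shows "(\<Sum>x\<in>I. \<Sum>u\<leftarrow>xs. f x u) = (\<Sum>u\<leftarrow>xs. \<Sum>x\<in>I. f x u)"
  by (induction xs) (simp_all add: sum.distrib)

lemma sum_indicator_real_card:
  "finite I \<Longrightarrow> (\<Sum>x\<in>I. indicator G x :: real) = card (G \<inter> I)"
  by (simp add: indicator_def sum.If_cases Int_commute Collect_mem_eq)

lemma tendsto_sum_list:
  fixes f :: "'a \<Rightarrow> 'b \<Rightarrow> real"
  shows "(\<And>x. x \<in> set xs \<Longrightarrow> (f x \<longlongrightarrow> l x) F) \<Longrightarrow> ((\<lambda>n. \<Sum>x\<leftarrow>xs. f x n) \<longlongrightarrow> (\<Sum>x\<leftarrow>xs. l x)) F"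
  by (induction xs) (auto intro!: tendsto_add)

text \<open>The last clause is the variance inequality for combinations of translates of \<open>E\<close>.\<close>

definition inv_mean :: "(int set \<Rightarrow> real) \<Rightarrow> bool" where
  "inv_mean m \<longleftrightarrow> (\<forall>E. 0 \<le> m E \<and> m E \<le> 1) \<and> m UNIV = 1 \<and>
     (\<forall>E F. E \<inter> F = {} \<longrightarrow> m (E \<union> F) = m E + m F) \<and> (\<forall>E g. m {x. x + g \<in> E} = m E) \<and>
     (\<forall>E. 0 < m E \<longrightarrow> posdens E) \<and> (\<forall>E. pdef (\<lambda>h. m {x \<in> E. x + h \<in> E} - (m E)\<^sup>2))"

lemma posdens_inv_mean:
  assumes "posdens B"
  shows "\<exists>m. inv_mean m \<and> 0 < m B"
proof -
  obtain d where d: "0 < d" "\<And>L::int. \<exists>a b. L \<le> b - a \<and> d * real_of_int (b - a + 1) \<le> real (card (B \<inter> {a..b}))"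
    using assms by (auto simp: posdens_def)
  have "\<forall>N::nat. \<exists>ab. int N \<le> snd ab - fst ab \<and>
      d * real_of_int (snd ab - fst ab + 1) \<le> real (card (B \<inter> {fst ab..snd ab}))"
    using d(2) by (metis fst_conv snd_conv)
  then obtain ab :: "nat \<Rightarrow> int \<times> int" where ab: "\<And>N. int N \<le> snd (ab N) - fst (ab N)"
    "\<And>N. d * real_of_int (snd (ab N) - fst (ab N) + 1) \<le> real (card (B \<inter> {fst (ab N)..snd (ab N)}))"
    by metis
  define I where "I N = {fst (ab N)..snd (ab N)}" for N
  define len where "len N = real_of_int (snd (ab N) - fst (ab N) + 1)" for N
  have len: "real N < len N" for N using ab(1)[of N] unfolding len_def by linarith
  have len0: "0 < len N" for N using len[of N] by linarith
  have cardI: "real (card (I N)) = len N" for N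
    using ab(1)[of N] by (simp add: I_def len_def)
  have finI: "finite (I N)" for N by (simp add: I_def)
  \<comment> \<open>An ultrafilter on the indices makes the averages of all sets over the chosen
    intervals converge at once.\<close>
  obtain w :: "nat filter" where w: "w \<le> sequentially" "ultra w"
    using ultra_exists[OF sequentially_bot] by blast
  note nb = ultra_not_bot[OF w(2)]
  define avg where "avg E N = real (card (E \<inter> I N)) / len N" for E N
  define m where "m E = Lim w (avg E)" for E
  have avg01: "0 \<le> avg E N" "avg E N \<le> 1" for E N
    using len0[of N] card_mono[OF finI[of N], of "E \<inter> I N"]
    by (auto simp: avg_def cardI[symmetric] divide_le_eq_1)
  have lim: "(avg E \<longlongrightarrow> m E) w" for E
    unfolding m_def using avg01 by (intro ultra_tendsto_Lim[OF w(2)]) (auto simp: bounded_iff intro!: exI[of _ 1])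
  have m01: "0 \<le> m E" "m E \<le> 1" for E
    using tendsto_lowerbound[OF lim _ nb, of 0 E] tendsto_upperbound[OF lim _ nb, of E 1] avg01 by auto
  have mU: "m UNIV = 1"
  proof -
    have "avg UNIV = (\<lambda>N. 1)" using len0 by (auto simp: avg_def cardI less_imp_neq[symmetric])
    then show ?thesis using tendsto_unique[OF nb lim[of UNIV]] by simp
  qed
  have mUn: "m (E \<union> F) = m E + m F" if "E \<inter> F = {}" for E F
  proof -
    have "avg (E \<union> F) N = avg E N + avg F N" for N
    proof -
      have "card ((E \<union> F) \<inter> I N) = card (E \<inter> I N) + card (F \<inter> I N)"
        unfolding Int_Un_distrib2 using that by (intro card_Un_disjoint finite_Int disjI2 finI) blast
      then show ?thesis by (simp add: avg_def add_divide_distrib)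
    qed
    then have "avg (E \<union> F) = (\<lambda>N. avg E N + avg F N)" by auto
    then show ?thesis using tendsto_unique[OF nb lim[of "E \<union> F"]] tendsto_add[OF lim lim, of E F] by simp
  qed
  \<comment> \<open>Translation by 1 only affects the two ends of an interval, a contribution that
    vanishes with growing length.\<close>
  have shift1: "m {x. x + 1 \<in> E} = m E" for E
  proof -
    have bd: "\<bar>avg {x. x + 1 \<in> E} N - avg E N\<bar> \<le> 1 / len N" for N
    proof -
      let ?a = "fst (ab N)" and ?b = "snd (ab N)"
      have eq: "card ({x. x + 1 \<in> E} \<inter> I N) = card (E \<inter> {?a + 1..?b + 1})"
      proof (rule bij_betw_same_card[of "\<lambda>x. x + 1"])
        show "bij_betw (\<lambda>x. x + 1) ({x. x + 1 \<in> E} \<inter> I N) (E \<inter> {?a + 1..?b + 1})"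
          by (rule bij_betwI[of _ _ _ "\<lambda>x. x - 1"]) (auto simp: I_def)
      qed
      have "card (E \<inter> {?a + 1..?b + 1}) \<le> card (insert (?b + 1) (E \<inter> I N))"
        by (intro card_mono) (auto simp: I_def)
      also have "\<dots> \<le> Suc (card (E \<inter> I N))" by (simp add: card_insert_le_m1 card_insert_if finI)
      finally have 1: "card (E \<inter> {?a + 1..?b + 1}) \<le> Suc (card (E \<inter> I N))" .
      have "card (E \<inter> I N) \<le> card (insert ?a (E \<inter> {?a + 1..?b + 1}))"
        by (intro card_mono) (auto simp: I_def)
      also have "\<dots> \<le> Suc (card (E \<inter> {?a + 1..?b + 1}))" by (simp add: card_insert_if)
      finally have 2: "card (E \<inter> I N) \<le> Suc (card (E \<inter> {?a + 1..?b + 1}))" .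
      have "\<bar>real (card ({x. x + 1 \<in> E} \<inter> I N)) - real (card (E \<inter> I N))\<bar> \<le> 1"
        using 1 2 unfolding eq by linarith
      then show ?thesis
        using len0[of N] unfolding avg_def
        by (simp add: diff_divide_distrib[symmetric] abs_divide divide_right_mono)
    qed
    have "((\<lambda>N. avg {x. x + 1 \<in> E} N - avg E N) \<longlongrightarrow> 0) w"
    proof (rule Lim_null_comparison)
      have "norm (avg {x. x + 1 \<in> E} N - avg E N) \<le> 1 / real N" if "0 < N" for N
        using order_trans[OF bd[of N], of "1 / real N"] len[of N] that
        by (simp add: frac_le)
      then show "eventually (\<lambda>N. norm (avg {x. x + 1 \<in> E} N - avg E N) \<le> 1 / real N) w"
        using filter_leD[OF w(1) eventually_gt_at_top[of 0]] by (auto elim: eventually_mono)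
      show "((\<lambda>N. 1 / real N) \<longlongrightarrow> 0) w"
        using tendsto_mono[OF w(1) lim_const_over_n[of 1]] by simp
    qed
    from tendsto_unique[OF nb this tendsto_diff[OF lim lim]] show ?thesis by simp
  qed
  have shift: "m {x. x + g \<in> E} = m E" for E g
  proof (induction g rule: int_induct[of _ 0])
    case base
    show ?case by simp
  next
    case (step1 i)
    have "{x. x + (i + 1) \<in> E} = {x. x + 1 \<in> {x. x + i \<in> E}}" by (auto simp: algebra_simps)
    with step1 shift1 show ?case by metis
  next
    case (step2 i)
    have "{x. x + i \<in> E} = {x. x + 1 \<in> {x. x + (i - 1) \<in> E}}" by (auto simp: algebra_simps)
    with step2 shift1 show ?case by metis
  qed
  have mpos: "posdens E" if "0 < m E" for E
  proof (rule posdensI[of "m E / 2"])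
    show "0 < m E / 2" using that by simp
    fix L :: int
    have "eventually (\<lambda>N. m E / 2 < avg E N) w"
      using order_tendstoD(1)[OF lim, of "m E / 2" E] that by simp
    moreover have "eventually (\<lambda>N. nat L \<le> N) w"
      using filter_leD[OF w(1) eventually_ge_at_top] .
    ultimately have "eventually (\<lambda>N. m E / 2 < avg E N \<and> nat L \<le> N) w" by (rule eventually_conj)
    then obtain N where N: "m E / 2 < avg E N" "nat L \<le> N"
      using eventually_happens'[OF nb] by blast
    have "m E / 2 * len N \<le> real (card (E \<inter> I N))"
      using N(1) len0[of N] by (simp add: avg_def field_simps)
    moreover have "L \<le> snd (ab N) - fst (ab N)" using N(2) ab(1)[of N] by linarith
    ultimately show "\<exists>a b. L \<le> b - a \<and> m E / 2 * real_of_int (b - a + 1) \<le> real (card (E \<inter> {a..b}))"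
      unfolding len_def I_def by blast
  qed
  have pd: "pdef (\<lambda>h. m {x \<in> E. x + h \<in> E} - (m E)\<^sup>2)" for E
  proof -
    have even: "m {x \<in> E. x + - h \<in> E} = m {x \<in> E. x + h \<in> E}" for h
    proof -
      have "m {x \<in> E. x + h \<in> E} = m {x. x + h \<in> {x \<in> E. x + - h \<in> E}}"
        by (rule arg_cong[of _ _ m]) auto
      also have "\<dots> = m {x \<in> E. x + - h \<in> E}" by (rule shift)
      finally show ?thesis by simp
    qed
    have two: "m {x. x + g \<in> E \<and> x + h \<in> E} = m {x \<in> E. x + (g - h) \<in> E}" for g h
    proof -
      have "m {x. x + g \<in> E \<and> x + h \<in> E} = m {x. x + h \<in> {x \<in> E. x + (g - h) \<in> E}}"
        by (rule arg_cong[of _ _ m]) (auto simp: algebra_simps)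
      also have "\<dots> = m {x \<in> E. x + (g - h) \<in> E}" by (rule shift)
      finally show ?thesis .
    qed
    have "0 \<le> ip (\<lambda>h. m {x \<in> E. x + h \<in> E} - (m E)\<^sup>2) xs xs" for xs
    proof -
      \<comment> \<open>The variance inequality is Cauchy-Schwarz for the average of F over an
        interval. Both sides are expanded into averages of finitely many sets so that the limit can
        be taken.\<close>
      define F where "F x = (\<Sum>u\<leftarrow>xs. fst u * indicator E (x + snd u))" for x :: int
      have s1: "(\<Sum>x\<in>I N. F x) / len N = (\<Sum>u\<leftarrow>xs. fst u * avg {x. x + snd u \<in> E} N)" for N
      proof -
        have "(\<Sum>x\<in>I N. F x) = (\<Sum>u\<leftarrow>xs. \<Sum>x\<in>I N. fst u * indicator E (x + snd u))"
          unfolding F_def by (rule sum_sum_list_swap)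
        moreover have "(\<Sum>x\<in>I N. c * indicator E (x + g)) = c * card ({x. x + g \<in> E} \<inter> I N)" for c :: real and g
        proof -
          have "(\<Sum>x\<in>I N. indicator E (x + g)) = (\<Sum>x\<in>I N. indicator {x. x + g \<in> E} x :: real)"
            by (intro sum.cong) (auto simp: indicator_def)
          then show ?thesis by (simp add: sum_distrib_left[symmetric] sum_indicator_real_card finI)
        qed
        ultimately show ?thesis by (simp add: avg_def divide_inverse sum_list_mult_const[symmetric] mult.assoc)
      qed
      have s2: "(\<Sum>x\<in>I N. (F x)\<^sup>2) / len N
          = (\<Sum>u\<leftarrow>xs. \<Sum>v\<leftarrow>xs. fst u * fst v * avg {x. x + snd u \<in> E \<and> x + snd v \<in> E} N)" for N
      proof -
        have "(F x)\<^sup>2 = (\<Sum>u\<leftarrow>xs. \<Sum>v\<leftarrow>xs. fst u * fst v * indicator {x. x + snd u \<in> E \<and> x + snd v \<in> E} x)" for x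
        proof -
          have "(F x)\<^sup>2 = (\<Sum>u\<leftarrow>xs. \<Sum>v\<leftarrow>xs. fst u * indicator E (x + snd u) * (fst v * indicator E (x + snd v)))"
            unfolding F_def power2_eq_square by (simp add: sum_list_const_mult sum_list_mult_const)
          also have "\<dots> = (\<Sum>u\<leftarrow>xs. \<Sum>v\<leftarrow>xs. fst u * fst v * indicator {x. x + snd u \<in> E \<and> x + snd v \<in> E} x)"
            by (intro arg_cong[of _ _ sum_list] map_cong refl) (auto simp: indicator_def)
          finally show ?thesis .
        qed
        then have "(\<Sum>x\<in>I N. (F x)\<^sup>2) = (\<Sum>u\<leftarrow>xs. \<Sum>x\<in>I N. \<Sum>v\<leftarrow>xs. fst u * fst v * indicator {x. x + snd u \<in> E \<and> x + snd v \<in> E} x)"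
          by (simp only: sum_sum_list_swap)
        also have "\<dots> = (\<Sum>u\<leftarrow>xs. \<Sum>v\<leftarrow>xs. \<Sum>x\<in>I N. fst u * fst v * indicator {x. x + snd u \<in> E \<and> x + snd v \<in> E} x)"
          by (simp only: sum_sum_list_swap)
        finally have "(\<Sum>x\<in>I N. (F x)\<^sup>2) = (\<Sum>u\<leftarrow>xs. \<Sum>v\<leftarrow>xs. \<Sum>x\<in>I N.
            fst u * fst v * indicator {x. x + snd u \<in> E \<and> x + snd v \<in> E} x)" .
        moreover have "(\<Sum>x\<in>I N. c * indicator G x) = c * card (G \<inter> I N)" for c :: real and G
          by (simp add: sum_distrib_left[symmetric] sum_indicator_real_card finI)
        ultimately have "(\<Sum>x\<in>I N. (F x)\<^sup>2) = (\<Sum>u\<leftarrow>xs. \<Sum>v\<leftarrow>xs.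
            fst u * fst v * real (card ({x. x + snd u \<in> E \<and> x + snd v \<in> E} \<inter> I N)))"
          by (simp only:)
        then show ?thesis by (simp add: avg_def divide_inverse sum_list_mult_const[symmetric] mult.assoc)
      qed
      have "((\<Sum>x\<in>I N. F x) / len N)\<^sup>2 \<le> (\<Sum>x\<in>I N. (F x)\<^sup>2) / len N" for N
        using sum_squared_le_sum_of_squares[of F "I N"] len0[of N]
        by (simp add: cardI field_simps power2_eq_square)
      then have le: "(\<Sum>u\<leftarrow>xs. fst u * avg {x. x + snd u \<in> E} N)\<^sup>2
          \<le> (\<Sum>u\<leftarrow>xs. \<Sum>v\<leftarrow>xs. fst u * fst v * avg {x. x + snd u \<in> E \<and> x + snd v \<in> E} N)" for N
        unfolding s1 s2 .
      have "(\<Sum>u\<leftarrow>xs. fst u * m {x. x + snd u \<in> E})\<^sup>2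
          \<le> (\<Sum>u\<leftarrow>xs. \<Sum>v\<leftarrow>xs. fst u * fst v * m {x. x + snd u \<in> E \<and> x + snd v \<in> E})"
      proof (rule tendsto_le[OF nb])
        show "((\<lambda>N. \<Sum>u\<leftarrow>xs. \<Sum>v\<leftarrow>xs. fst u * fst v * avg {x. x + snd u \<in> E \<and> x + snd v \<in> E} N) \<longlongrightarrow>
            (\<Sum>u\<leftarrow>xs. \<Sum>v\<leftarrow>xs. fst u * fst v * m {x. x + snd u \<in> E \<and> x + snd v \<in> E})) w"
          by (intro tendsto_sum_list tendsto_mult tendsto_const lim)
        show "((\<lambda>N. (\<Sum>u\<leftarrow>xs. fst u * avg {x. x + snd u \<in> E} N)\<^sup>2) \<longlongrightarrow>
            (\<Sum>u\<leftarrow>xs. fst u * m {x. x + snd u \<in> E})\<^sup>2) w"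
          by (intro tendsto_power tendsto_sum_list tendsto_mult tendsto_const lim)
      qed (simp add: le)
      also have "\<dots> = ip (\<lambda>h. m {x \<in> E. x + h \<in> E}) xs xs"
        by (simp add: ip_def two)
      finally have "(\<Sum>u\<leftarrow>xs. fst u * m E)\<^sup>2 \<le> ip (\<lambda>h. m {x \<in> E. x + h \<in> E}) xs xs"
        by (simp add: shift)
      moreover have "ip (\<lambda>h. (m E)\<^sup>2) xs xs = (\<Sum>u\<leftarrow>xs. fst u * m E)\<^sup>2"
        unfolding ip_def by (simp add: sum_list_const_mult sum_list_mult_const power2_eq_square)
      ultimately show ?thesis by (simp add: ip_diff_fun)
    qed
    with even show ?thesis by (simp add: pdef_def)
  qed
  have "d \<le> avg B N" for N
    using ab(2)[of N] len0[of N] by (simp add: avg_def I_def len_def field_simps)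
  then have "d \<le> m B" using tendsto_lowerbound[OF lim _ nb, of d B] by simp
  with d(1) have "0 < m B" by simp
  moreover have "inv_mean m"
    unfolding inv_mean_def using m01 mU mUn shift mpos pd by blast
  ultimately show ?thesis by blast
qed


lemma inv_mean_modular:
  assumes "inv_mean m"
  shows "m (E \<union> F) + m (E \<inter> F) = m E + m F"
proof -
  have add: "m (E \<union> F) = m E + m F" if "E \<inter> F = {}" for E F
    using assms that by (simp add: inv_mean_def)
  have eq: "(E \<inter> F) \<union> (F - E) = F" "(E \<inter> F) \<inter> (F - E) = {}" by auto
  have "m (E \<union> F) = m E + m (F - E)" "m F = m (E \<inter> F) + m (F - E)"
    using add[of E "F - E"] add[of "E \<inter> F" "F - E", unfolded eq] by auto
  then show ?thesis by simp
qed

lemma inv_mean_empty: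
  assumes "inv_mean m"
  shows "m {} = 0"
proof -
  have "m ({} \<union> {}) = m {} + m {}" using assms unfolding inv_mean_def by blast
  then show ?thesis by simp
qed

lemma inv_mean_Union_null:
  assumes "inv_mean m" "finite S" "\<And>s t. s \<in> S \<Longrightarrow> t \<in> S \<Longrightarrow> s \<noteq> t \<Longrightarrow> m (A s \<inter> A t) = 0"
  shows "m (\<Union>s\<in>S. A s) = (\<Sum>s\<in>S. m (A s))"
  using assms(2,3)
proof (induction S)
  case empty
  then show ?case by (simp add: inv_mean_empty[OF assms(1)])
next
  case (insert s S)
  have nn: "0 \<le> m E" for E using assms(1) by (simp add: inv_mean_def)
  note null = insert.prems
  have "m (\<Union>t\<in>S'. A s \<inter> A t) = 0" if "S' \<subseteq> S" "finite S'" for S'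
    using that(2,1)
  proof (induction S')
    case empty
    then show ?case by (simp add: inv_mean_empty[OF assms(1)])
  next
    case (insert t S')
    have "m (A s \<inter> A t) = 0" using insert.prems \<open>s \<notin> S\<close> by (intro null) auto
    moreover have "m (\<Union>t\<in>S'. A s \<inter> A t) = 0" using insert.IH insert.prems by simp
    ultimately show ?case using inv_mean_modular[OF assms(1), of "A s \<inter> A t" "\<Union>t\<in>S'. A s \<inter> A t"]
      nn[of "A s \<inter> A t \<inter> (\<Union>t\<in>S'. A s \<inter> A t)"] nn[of "A s \<inter> A t \<union> (\<Union>t\<in>S'. A s \<inter> A t)"]
    by simp
  qed
  from this[OF order_refl insert.hyps(1)] have "m (A s \<inter> (\<Union>t\<in>S. A t)) = 0"
    by (simp only: Int_UN_distrib)
  moreover have "m (\<Union>t\<in>S. A t) = (\<Sum>t\<in>S. m (A t))"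
    by (rule insert.IH) (auto intro: null)
  ultimately have "m (A s \<union> (\<Union>t\<in>S. A t)) = m (A s) + (\<Sum>t\<in>S. m (A t))"
    using inv_mean_modular[OF assms(1), of "A s" "\<Union>t\<in>S. A t"] by simp
  then show ?case by (simp only: UN_insert sum.insert[OF insert.hyps])
qed

text \<open>A mean that is positive on the union is subadditive, so it is positive on one of the two
  sets.\<close>

lemma posdens_Un:
  assumes "posdens (E \<union> F)"
  shows "posdens E \<or> posdens F"
proof -
  obtain m where m: "inv_mean m" "0 < m (E \<union> F)" using posdens_inv_mean[OF assms] by blast
  have "0 \<le> m (E \<inter> F)" using m(1) by (simp add: inv_mean_def)
  with m(2) inv_mean_modular[OF m(1), of E F] have "0 < m E \<or> 0 < m F" by linarith
  with m(1) show ?thesis by (auto simp: inv_mean_def)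
qed

lemma posdens_shift:
  assumes "posdens E"
  shows "posdens {x. x + g \<in> E}"
  using posdens_inv_mean[OF assms] by (auto simp: inv_mean_def)

text \<open>If r translates of B had pairwise null intersections, their union would have mean r
  m(B), which exceeds 1 for large r. This r depends on B only.\<close>

lemma posdens_return:
  assumes "posdens B"
  shows "\<exists>r. \<forall>S. finite S \<longrightarrow> card S = r \<longrightarrow> (\<exists>s\<in>S. \<exists>t\<in>S. s < t \<and> posdens {x \<in> B. x + (t - s) \<in> B})"
proof -
  obtain m where m: "inv_mean m" "0 < m B" using posdens_inv_mean[OF assms] by blast
  have mshift: "m {x. x + g \<in> E} = m E" for E g using m(1) by (simp add: inv_mean_def)
  obtain r :: nat where r: "1 < r * m B" using reals_Archimedean3[OF m(2)] by blast
  have "\<exists>s\<in>S. \<exists>t\<in>S. s < t \<and> posdens {x \<in> B. x + (t - s) \<in> B}" if S: "finite S" "card S = r" for S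
  proof (rule ccontr)
    assume neg: "\<not> ?thesis"
    have pair: "m {x \<in> B. x + (t - s) \<in> B} = 0" if "s \<in> S" "t \<in> S" "s < t" for s t
    proof -
      have "\<not> 0 < m {x \<in> B. x + (t - s) \<in> B}" using neg that m(1) unfolding inv_mean_def by blast
      moreover have "0 \<le> m {x \<in> B. x + (t - s) \<in> B}" using m(1) by (simp add: inv_mean_def)
      ultimately show ?thesis by simp
    qed
    define A where "A s = {x. x + s \<in> B}" for s
    have int: "m (A s \<inter> A t) = m {x \<in> B. x + (t - s) \<in> B}" for s t
    proof -
      have "A s \<inter> A t = {x. x + s \<in> {x \<in> B. x + (t - s) \<in> B}}" by (auto simp: A_def)
      then show ?thesis using mshift[of s "{x \<in> B. x + (t - s) \<in> B}"] by simp
    qed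
    have "m (A s \<inter> A t) = 0" if "s \<in> S" "t \<in> S" "s \<noteq> t" for s t
      using that pair[of s t] pair[of t s] int[of s t] int[of t s] by (cases "s < t") (auto simp: Int_commute)
    from inv_mean_Union_null[OF m(1) S(1) this] have "m (\<Union>s\<in>S. A s) = r * m B"
      by (simp add: A_def mshift S(2))
    moreover have "m (\<Union>s\<in>S. A s) \<le> 1" using m(1) by (simp add: inv_mean_def)
    ultimately show False using r by simp
  qed
  then show ?thesis by blast
qed

text \<open>With the squared mean already subtracted from the correlation, the lower bound with
  \<eta> = (m B)^2 says exactly that the correlation at \<open>P ys\<close> is positive.\<close>

theorem (in idem_uf) polynomial_recurrence:
  assumes "posdens B" "zpoly D k P"
  shows "evk p k (\<lambda>ys. posdens {x \<in> B. x + P ys \<in> B})"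
proof -
  obtain m where m: "inv_mean m" "0 < m B" using posdens_inv_mean[OF assms(1)] by blast
  have "m E \<le> 1" for E using m(1) by (simp add: inv_mean_def)
  moreover have "0 \<le> (m B)\<^sup>2" by simp
  ultimately have "m {x \<in> B. x + 0 \<in> B} - (m B)\<^sup>2 \<le> 1" by (smt (verit))
  moreover have "pdef (\<lambda>h. m {x \<in> B. x + h \<in> B} - (m B)\<^sup>2)" using m(1) by (simp add: inv_mean_def)
  moreover have "0 < (m B)\<^sup>2" using m(2) by simp
  ultimately have "evk p k (\<lambda>ys. - (m B)\<^sup>2 < m {x \<in> B. x + P ys \<in> B} - (m B)\<^sup>2)"
    using assms(2) by (intro evk_pdef_lower_bound)
  then show ?thesis
    by (rule evk_mono) (use m(1) in \<open>simp add: inv_mean_def\<close>)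
qed

section \<open>Multivariate polynomials\<close>

lemma zpoly_zero: "zpoly D k (\<lambda>_. 0)"
proof (induction k)
  case (Suc k)
  then show ?case by simp (intro exI[of _ "\<lambda>_. 0"] conjI; simp)
qed simp

lemma zpoly_add: "zpoly D k P \<Longrightarrow> zpoly D k Q \<Longrightarrow> zpoly D k (\<lambda>ys. P ys + Q ys)"
proof (induction k arbitrary: P Q)
  case (Suc k)
  from Suc.prems(1) obtain P0 C where P: "zpoly D k P0"
    "\<And>ys y. length ys = k \<Longrightarrow> P (ys @ [y]) = P0 ys + poly (C ys) (int y)"
    "\<And>ys. length ys = k \<Longrightarrow> coeff (C ys) 0 = 0 \<and> degree (C ys) \<le> D"
    "\<And>a ys zs j. length ys = k \<Longrightarrow> length zs = k \<Longrightarrow> \<forall>y\<in>set ys. a dvd y \<Longrightarrow>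
      \<forall>z\<in>set zs. a dvd z \<Longrightarrow> int a dvd coeff (C ys) j - coeff (C zs) j"
    by auto
  from Suc.prems(2) obtain Q0 E where Q: "zpoly D k Q0"
    "\<And>ys y. length ys = k \<Longrightarrow> Q (ys @ [y]) = Q0 ys + poly (E ys) (int y)"
    "\<And>ys. length ys = k \<Longrightarrow> coeff (E ys) 0 = 0 \<and> degree (E ys) \<le> D"
    "\<And>a ys zs j. length ys = k \<Longrightarrow> length zs = k \<Longrightarrow> \<forall>y\<in>set ys. a dvd y \<Longrightarrow>
      \<forall>z\<in>set zs. a dvd z \<Longrightarrow> int a dvd coeff (E ys) j - coeff (E zs) j"
    by auto
  show ?case
    unfolding zpoly.simps
  proof (intro exI[of _ "\<lambda>ys. P0 ys + Q0 ys"] exI[of _ "\<lambda>ys. C ys + E ys"] conjI allI impI)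
    show "zpoly D k (\<lambda>ys. P0 ys + Q0 ys)" by (rule Suc.IH[OF P(1) Q(1)])
  next
    fix ys :: "nat list" and y assume "length ys = k"
    then show "P (ys @ [y]) + Q (ys @ [y]) = P0 ys + Q0 ys + poly (C ys + E ys) (int y)"
      by (simp add: P(2) Q(2))
  next
    fix ys :: "nat list" assume "length ys = k"
    then show "coeff (C ys + E ys) 0 = 0" "degree (C ys + E ys) \<le> D"
      using P(3) Q(3) by (auto intro: degree_add_le)
  next
    fix a j and ys zs :: "nat list"
    assume "length ys = k \<and> length zs = k \<and> (\<forall>y\<in>set ys. a dvd y) \<and> (\<forall>z\<in>set zs. a dvd z)"
    then have "int a dvd (coeff (C ys) j - coeff (C zs) j) + (coeff (E ys) j - coeff (E zs) j)"
      by (intro dvd_add P(4) Q(4)) auto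
    then show "int a dvd coeff (C ys + E ys) j - coeff (C zs + E zs) j"
      by (simp add: algebra_simps)
  qed
qed simp

lemma zpoly_sum:
  "finite S \<Longrightarrow> (\<And>s. s \<in> S \<Longrightarrow> zpoly D k (P s)) \<Longrightarrow> zpoly D k (\<lambda>ys. \<Sum>s\<in>S. P s ys)"
  by (induction S rule: finite_induct) (auto intro: zpoly_zero zpoly_add)

text \<open>A monomial goes into \<open>C\<close> if the last variable occurs in it, and into
  \<open>P0\<close> otherwise. Its coefficient respects congruences between the tuples, being a
  monomial itself.\<close>

lemma zpoly_monomial:
  "\<exists>j<k. 0 < e j \<Longrightarrow> \<forall>j<k. e j \<le> D \<Longrightarrow> zpoly D k (\<lambda>ys. c * (\<Prod>j<k. int (ys ! j) ^ e j))"
proof (induction k)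
  case (Suc k)
  let ?M = "\<lambda>ys. c * (\<Prod>j<k. int (ys ! j) ^ e j)"
  have snoc: "c * (\<Prod>j<Suc k. int ((ys @ [y]) ! j) ^ e j) = ?M ys * int y ^ e k" if "length ys = k" for ys y
  proof -
    have "(\<Prod>j<k. int ((ys @ [y]) ! j) ^ e j) = (\<Prod>j<k. int (ys ! j) ^ e j)"
      using that by (intro prod.cong) (auto simp: nth_append)
    with that show ?thesis by (simp add: nth_append)
  qed
  show ?case
  proof (cases "e k = 0")
    case True
    have "zpoly D k ?M"
      using Suc True by (intro Suc.IH) (auto simp: less_Suc_eq)
    then show ?thesis
      unfolding zpoly.simps
      by (intro exI[of _ ?M] exI[of _ "\<lambda>_. 0"]) (simp add: snoc True del: prod.lessThan_Suc)
  next
    case False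
    have "int a dvd ?M ys - ?M zs"
      if len: "length ys = k" "length zs = k" "\<forall>y\<in>set ys. a dvd y" "\<forall>z\<in>set zs. a dvd z" for a ys zs
    proof -
      have "(\<Prod>j<k. int (ys ! j) ^ e j) mod int a = (\<Prod>j<k. int (zs ! j) ^ e j) mod int a"
      proof -
        have "(int (ys ! j) ^ e j) mod int a = (int (zs ! j) ^ e j) mod int a" if "j < k" for j
        proof -
          have "int (ys ! j) mod int a = int (zs ! j) mod int a"
            using len that nth_mem[of j ys] nth_mem[of j zs] by (auto simp: zmod_int[symmetric])
          then show ?thesis by (metis power_mod)
        qed
        then have eq: "(\<Prod>j<k. (int (ys ! j) ^ e j) mod int a) = (\<Prod>j<k. (int (zs ! j) ^ e j) mod int a)"
          by (intro prod.cong refl) simp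
        show ?thesis
          unfolding mod_prod_eq[symmetric, of "\<lambda>j. int (ys ! j) ^ e j"]
            mod_prod_eq[symmetric, of "\<lambda>j. int (zs ! j) ^ e j"] eq ..
      qed
      then have "int a dvd (\<Prod>j<k. int (ys ! j) ^ e j) - (\<Prod>j<k. int (zs ! j) ^ e j)"
        by (simp add: mod_eq_dvd_iff)
      then show ?thesis by (simp add: right_diff_distrib[symmetric])
    qed
    then show ?thesis
      unfolding zpoly.simps using False Suc.prems(2) zpoly_zero[of D k]
      by (intro exI[of _ "\<lambda>_. 0"] exI[of _ "\<lambda>ys. monom (?M ys) (e k)"])
        (auto simp: snoc poly_monom degree_monom_le[THEN order_trans] simp del: prod.lessThan_Suc)
  qed
qed simp

lemma mpoly_eval_superset:
  assumes "finite S" "Poly_Mapping.keys f \<subseteq> S"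
  shows "mpoly_eval a f = (\<Sum>m\<in>S. Poly_Mapping.lookup f m *
    (\<Prod>v\<in>Poly_Mapping.keys m. a v ^ Poly_Mapping.lookup m v))"
  unfolding mpoly_eval_def using assms
  by (intro sum.mono_neutral_left) (auto simp: in_keys_iff)

lemma mpoly_eval_zero [simp]: "mpoly_eval a 0 = 0"
  by (simp add: mpoly_eval_def)

lemma mpoly_eval_add: "mpoly_eval a (f + g) = mpoly_eval a f + mpoly_eval a g"
proof -
  let ?S = "Poly_Mapping.keys f \<union> Poly_Mapping.keys g"
  have "Poly_Mapping.keys (f + g) \<subseteq> ?S" by (rule keys_add)
  then show ?thesis
    by (simp add: mpoly_eval_superset[of ?S] lookup_add distrib_right sum.distrib)
qed

lemma mpoly_eval_sum: "mpoly_eval a (\<Sum>i\<in>I. f i) = (\<Sum>i\<in>I. mpoly_eval a (f i))"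
  by (induction I rule: infinite_finite_induct) (simp_all add: mpoly_eval_add)

lemma mpoly_eval_const_times_var: "mpoly_eval a (mpoly_const c * mpoly_var v) = c * a v"
proof -
  have "mpoly_const c * mpoly_var v = Poly_Mapping.single (Poly_Mapping.single v 1) c"
    by (simp add: mpoly_const_def mpoly_var_def mult_single)
  then show ?thesis
    by (simp add: mpoly_eval_superset[of "{Poly_Mapping.single v 1}"])
qed

lemma mpoly_eval_rado_poly:
  "mpoly_eval a (rado_poly n c P) = (\<Sum>i=1..n. c i * a (Inl i)) + mpoly_eval a P"
  by (simp add: rado_poly_def mpoly_eval_add mpoly_eval_sum mpoly_eval_const_times_var)

lemma mpoly_vars_add: "mpoly_vars (f + g) \<subseteq> mpoly_vars f \<union> mpoly_vars g"
  unfolding mpoly_vars_def using keys_add[of f g] by blast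

lemma mpoly_vars_const_times_var: "mpoly_vars (mpoly_const c * mpoly_var v) \<subseteq> {v}"
  by (auto simp: mpoly_vars_def mpoly_const_def mpoly_var_def mult_single split: if_splits)

lemma mpoly_vars_sum: "mpoly_vars (\<Sum>i\<in>I. f i) \<subseteq> (\<Union>i\<in>I. mpoly_vars (f i))"
proof (induction I rule: infinite_finite_induct)
  case (insert i I)
  then show ?case using mpoly_vars_add[of "f i" "\<Sum>i\<in>I. f i"] by auto
qed (simp_all add: mpoly_vars_def)

lemma lookup_const_times_var_zero: "Poly_Mapping.lookup (mpoly_const c * mpoly_var v) 0 = 0"
proof -
  have "Poly_Mapping.single v (1::nat) \<noteq> 0"
    using arg_cong[of _ _ Poly_Mapping.keys] by (metis keys_single keys_zero insert_not_empty zero_neq_one)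
  then show ?thesis
    by (simp add: mpoly_const_def mpoly_var_def mult_single lookup_single when_def)
qed

lemma mpoly_eval_cong:
  assumes "\<And>v. v \<in> mpoly_vars f \<Longrightarrow> a v = b v"
  shows "mpoly_eval a f = mpoly_eval b f"
  unfolding mpoly_eval_def
proof (intro sum.cong prod.cong arg_cong2[of _ _ _ _ "(*)"] refl)
  fix m v assume "m \<in> Poly_Mapping.keys f" "v \<in> Poly_Mapping.keys m"
  then have "v \<in> mpoly_vars f" unfolding mpoly_vars_def by blast
  then show "a v ^ Poly_Mapping.lookup m v = b v ^ Poly_Mapping.lookup m v"
    by (simp add: assms)
qed

lemma zpoly_mpoly_eval:
  assumes "distinct vs" "mpoly_vars f \<subseteq> set vs" "Poly_Mapping.lookup f 0 = 0"
  shows "\<exists>D. zpoly D (length vs) (\<lambda>ys. mpoly_eval (\<lambda>v. int (the (map_of (zip vs ys) v))) f)"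
proof -
  define k where "k = length vs"
  define D where "D = (\<Sum>m\<in>Poly_Mapping.keys f. \<Sum>j<k. Poly_Mapping.lookup m (vs ! j))"
  have le: "Poly_Mapping.lookup m (vs ! j) \<le> D" if "m \<in> Poly_Mapping.keys f" "j < k" for m j
  proof -
    have "Poly_Mapping.lookup m (vs ! j) \<le> (\<Sum>j<k. Poly_Mapping.lookup m (vs ! j))"
      using that by (intro member_le_sum) auto
    also have "\<dots> \<le> D" unfolding D_def using that by (intro member_le_sum) auto
    finally show ?thesis .
  qed
  define Q where "Q ys = (\<Sum>m\<in>Poly_Mapping.keys f. Poly_Mapping.lookup f m *
      (\<Prod>j<k. int (ys ! j) ^ Poly_Mapping.lookup m (vs ! j)))" for ys :: "nat list"
  have zQ: "zpoly D k Q"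
    unfolding Q_def
  proof (rule zpoly_sum)
    fix m assume m: "m \<in> Poly_Mapping.keys f"
    then have "m \<noteq> 0" using assms(3) by (auto simp: in_keys_iff)
    then obtain v where v: "v \<in> Poly_Mapping.keys m" by fastforce
    with m assms(2) have "v \<in> set vs" by (auto simp: mpoly_vars_def)
    then obtain j where "j < k" "vs ! j = v" by (auto simp: in_set_conv_nth k_def)
    with v have "\<exists>j<k. 0 < Poly_Mapping.lookup m (vs ! j)" by (auto simp: in_keys_iff)
    with le[OF m] show "zpoly D k (\<lambda>ys. Poly_Mapping.lookup f m *
        (\<Prod>j<k. int (ys ! j) ^ Poly_Mapping.lookup m (vs ! j)))"
      by (intro zpoly_monomial) auto
  qed simp
  have eq: "mpoly_eval (\<lambda>v. int (the (map_of (zip vs ys) v))) f = Q ys" if "length ys = k" for ys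
    unfolding mpoly_eval_def Q_def
  proof (intro sum.cong refl arg_cong2[of _ _ _ _ "(*)"])
    fix m assume m: "m \<in> Poly_Mapping.keys f"
    let ?a = "\<lambda>v. int (the (map_of (zip vs ys) v))"
    have "Poly_Mapping.keys m \<subseteq> set vs" using m assms(2) unfolding mpoly_vars_def by blast
    then have "(\<Prod>v\<in>Poly_Mapping.keys m. ?a v ^ Poly_Mapping.lookup m v)
        = (\<Prod>v\<in>set vs. ?a v ^ Poly_Mapping.lookup m v)"
      by (intro prod.mono_neutral_left) (simp_all add: in_keys_iff)
    also have "\<dots> = (\<Prod>j<k. ?a (vs ! j) ^ Poly_Mapping.lookup m (vs ! j))"
      using assms(1) by (intro prod.reindex_bij_betw[symmetric])
        (auto simp: k_def bij_betw_def inj_on_def nth_eq_iff_index_eq set_conv_nth)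
    also have "\<dots> = (\<Prod>j<k. int (ys ! j) ^ Poly_Mapping.lookup m (vs ! j))"
      using assms(1) that by (intro prod.cong) (auto simp: map_of_zip_nth k_def)
    finally show "(\<Prod>v\<in>Poly_Mapping.keys m. ?a v ^ Poly_Mapping.lookup m v)
        = (\<Prod>j<k. int (ys ! j) ^ Poly_Mapping.lookup m (vs ! j))" .
  qed
  have zcong: "zpoly D k P' \<Longrightarrow> (\<And>ys. length ys = k \<Longrightarrow> P' ys = P'' ys) \<Longrightarrow> zpoly D k P''" for k P' P''
    by (cases k) auto
  from zcong[OF zQ] eq have "zpoly D k (\<lambda>ys. mpoly_eval (\<lambda>v. int (the (map_of (zip vs ys) v))) f)"
    by simp
  then show ?thesis unfolding k_def by blast
qed

text \<open>Distinctness of the values and membership in A hold for most tuples, so they can be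
  imposed together with recurrence.\<close>

lemma (in idem_uf) mpoly_recurrence:
  assumes "posdens B" "finite Y" "mpoly_vars f \<subseteq> Y" "Poly_Mapping.lookup f 0 = 0"
    and "eventually (\<lambda>n. n \<in> A) p"
  obtains y :: "'v \<Rightarrow> nat" where "inj_on y Y" "y ` Y \<subseteq> A"
    "posdens {x \<in> B. x + mpoly_eval (\<lambda>v. int (y v)) f \<in> B}"
proof -
  obtain vs where vs: "set vs = Y" "distinct vs" using finite_distinct_list[OF assms(2)] by blast
  define k where "k = length vs"
  define asg where "asg ys v = the (map_of (zip vs ys) v)" for ys :: "nat list" and v
  obtain D where "zpoly D k (\<lambda>ys. mpoly_eval (\<lambda>v. int (asg ys v)) f)"
    using zpoly_mpoly_eval[OF vs(2), of f] assms(3,4) vs(1) unfolding k_def asg_def by auto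
  from polynomial_recurrence[OF assms(1) this]
  have "evk p k (\<lambda>ys. posdens {x \<in> B. x + mpoly_eval (\<lambda>v. int (asg ys v)) f \<in> B})" .
  from evk_conj[OF this evk_conj[OF evk_distinct evk_set[OF assms(5)]]]
  obtain ys where ys: "length ys = k" "posdens {x \<in> B. x + mpoly_eval (\<lambda>v. int (asg ys v)) f \<in> B}"
    "distinct ys" "set ys \<subseteq> A"
    using evk_ex[OF ultra] by blast
  have asg: "asg ys (vs ! j) = ys ! j" if "j < k" for j
    using that vs(2) ys(1) by (simp add: asg_def map_of_zip_nth k_def)
  show thesis
  proof (rule that)
    show "inj_on (asg ys) Y"
    proof (rule inj_onI)
      fix u v assume "u \<in> Y" "v \<in> Y" and eq: "asg ys u = asg ys v"
      then obtain i j where "i < k" "j < k" "u = vs ! i" "v = vs ! j"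
        using vs(1) by (auto simp: in_set_conv_nth k_def)
      with eq asg ys(1,3) show "u = v" by (simp add: nth_eq_iff_index_eq)
    qed
    show "asg ys ` Y \<subseteq> A"
    proof
      fix z assume "z \<in> asg ys ` Y"
      then obtain j where "j < k" "z = asg ys (vs ! j)"
        using vs(1) by (auto simp: in_set_conv_nth k_def)
      with asg ys(1,4) show "z \<in> A" by auto
    qed
  qed (rule ys(2))
qed

lemma mpoly_eval_linear:
  assumes "mpoly_linear f" "Poly_Mapping.lookup f 0 = 0" "mpoly_vars f \<subseteq> Y" "finite Y"
  shows "mpoly_eval a f = (\<Sum>v\<in>Y. Poly_Mapping.lookup f (Poly_Mapping.single v 1) * a v)"
    and "f \<noteq> 0 \<Longrightarrow> \<exists>v\<in>Y. Poly_Mapping.lookup f (Poly_Mapping.single v 1) \<noteq> 0"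
proof -
  have sub: "Poly_Mapping.keys f \<subseteq> (\<lambda>v. Poly_Mapping.single v 1) ` Y"
  proof
    fix m assume m: "m \<in> Poly_Mapping.keys f"
    then have "m \<noteq> 0" using assms(2) by (auto simp: in_keys_iff)
    then obtain v where v: "v \<in> Poly_Mapping.keys m" by fastforce
    have "(\<Sum>u\<in>Poly_Mapping.keys m. Poly_Mapping.lookup m u) \<le> 1"
      using assms(1) m by (auto simp: mpoly_linear_def)
    then have le: "Poly_Mapping.lookup m v + (\<Sum>u\<in>Poly_Mapping.keys m - {v}. Poly_Mapping.lookup m u) \<le> 1"
      using v by (simp add: sum.remove)
    have "Poly_Mapping.lookup m v \<noteq> 0" using v by (simp add: in_keys_iff)
    with le have 1: "Poly_Mapping.lookup m v = 1"
      and 2: "(\<Sum>u\<in>Poly_Mapping.keys m - {v}. Poly_Mapping.lookup m u) = 0" by linarith+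
    from 2 have "\<forall>u\<in>Poly_Mapping.keys m - {v}. Poly_Mapping.lookup m u = 0" by simp
    then have "m = Poly_Mapping.single v 1"
      using 1 by (intro poly_mapping_eqI) (auto simp: lookup_single when_def in_keys_iff)
    moreover have "v \<in> Y" using m v assms(3) by (auto simp: mpoly_vars_def)
    ultimately show "m \<in> (\<lambda>v. Poly_Mapping.single v 1) ` Y" by blast
  qed
  have inj: "inj_on (\<lambda>v. Poly_Mapping.single v (1::nat)) Y"
    by (rule inj_onI) (metis keys_single zero_neq_one singleton_inject)
  have "mpoly_eval a f = (\<Sum>m\<in>(\<lambda>v. Poly_Mapping.single v 1) ` Y. Poly_Mapping.lookup f m *
      (\<Prod>v\<in>Poly_Mapping.keys m. a v ^ Poly_Mapping.lookup m v))"
    using assms(4) sub by (intro mpoly_eval_superset) auto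
  also have "\<dots> = (\<Sum>v\<in>Y. Poly_Mapping.lookup f (Poly_Mapping.single v 1) * a v)"
    by (subst sum.reindex[OF inj]) simp
  finally show "mpoly_eval a f = (\<Sum>v\<in>Y. Poly_Mapping.lookup f (Poly_Mapping.single v 1) * a v)" .
  assume "f \<noteq> 0"
  then obtain m where "m \<in> Poly_Mapping.keys f" by fastforce
  with sub show "\<exists>v\<in>Y. Poly_Mapping.lookup f (Poly_Mapping.single v 1) \<noteq> 0"
    by (fastforce simp: in_keys_iff)
qed

text \<open>Only \<open>v\<close> can occur, so a constant assignment loses nothing; the polynomial
  \<open>q\<close> is nonzero because different monomials in \<open>v\<close> have different
  exponents.\<close>

lemma finite_roots_univariate:
  fixes f :: "'v int_mpoly"
  assumes "f \<noteq> 0" "mpoly_vars f \<subseteq> {v}"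
  shows "finite {n::nat. mpoly_eval (\<lambda>_. int n) f = 0}"
proof -
  have single: "m = Poly_Mapping.single v (Poly_Mapping.lookup m v)" if "m \<in> Poly_Mapping.keys f" for m
  proof (rule poly_mapping_eqI)
    fix u
    have "Poly_Mapping.keys m \<subseteq> {v}" using that assms(2) by (auto simp: mpoly_vars_def)
    then show "Poly_Mapping.lookup m u = Poly_Mapping.lookup (Poly_Mapping.single v (Poly_Mapping.lookup m v)) u"
      by (cases "u = v") (auto simp: lookup_single when_def in_keys_iff)
  qed
  define q where "q = (\<Sum>m\<in>Poly_Mapping.keys f. monom (Poly_Mapping.lookup f m) (Poly_Mapping.lookup m v))"
  have "poly q x = mpoly_eval (\<lambda>_. x) f" for x
    unfolding q_def mpoly_eval_def poly_sum
  proof (intro sum.cong refl)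
    fix m assume "m \<in> Poly_Mapping.keys f"
    from single[OF this] have "(\<Prod>v\<in>Poly_Mapping.keys m. x ^ Poly_Mapping.lookup m v) = x ^ Poly_Mapping.lookup m v"
      by (cases "Poly_Mapping.lookup m v = 0") (metis (no_types, lifting) keys_zero power_0 prod.empty single_zero,
        metis (no_types, lifting) finite.emptyI insert_absorb insert_not_empty keys_single mult.right_neutral prod.empty prod.insert)
    then show "poly (monom (Poly_Mapping.lookup f m) (Poly_Mapping.lookup m v)) x =
        Poly_Mapping.lookup f m * (\<Prod>v\<in>Poly_Mapping.keys m. x ^ Poly_Mapping.lookup m v)"
      by (simp add: poly_monom)
  qed
  moreover have "q \<noteq> 0"
  proof -
    obtain m0 where m0: "m0 \<in> Poly_Mapping.keys f" using assms(1) by fastforce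
    have "coeff q (Poly_Mapping.lookup m0 v) = (\<Sum>m\<in>Poly_Mapping.keys f. if m = m0 then Poly_Mapping.lookup f m else 0)"
      unfolding q_def coeff_sum using single m0 by (intro sum.cong refl) (metis coeff_monom)
    also have "\<dots> = Poly_Mapping.lookup f m0" using m0 by simp
    finally show ?thesis using m0 by (auto simp: in_keys_iff)
  qed
  ultimately have "finite {x. mpoly_eval (\<lambda>_. x) f = 0}"
    using poly_roots_finite[of q] by simp
  then have "finite (int -` {x. mpoly_eval (\<lambda>_. x) f = 0})"
    by (rule finite_vimageI) simp
  then show ?thesis by (simp add: vimage_def)
qed

section \<open>Arithmetic progressions and the ideal of multiplicative witnesses\<close>

definition has_ap :: "nat \<Rightarrow> nat set \<Rightarrow> bool" where
  "has_ap l A \<longleftrightarrow> (\<exists>a d. 0 < d \<and> (\<forall>i<l. a + i * d \<in> A))"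

text \<open>The next term \<open>a + l * d\<close> must stay below N although its colour is free:
  colour focusing needs room for it.\<close>

definition waerden :: "nat \<Rightarrow> nat \<Rightarrow> nat \<Rightarrow> bool" where
  "waerden l r N \<longleftrightarrow> (\<forall>f::nat \<Rightarrow> nat. (\<forall>i<N. f i < r) \<longrightarrow>
     (\<exists>a d. 0 < d \<and> a + l * d < N \<and> (\<forall>i<l. f (a + i * d) = f a)))"

text \<open>The second alternative is colour focusing: \<open>s\<close> progressions of distinct colours have the
  common next term \<open>b\<close>.\<close>

definition focused :: "nat \<Rightarrow> nat \<Rightarrow> nat \<Rightarrow> nat \<Rightarrow> bool" where
  "focused l r s N \<longleftrightarrow> (\<forall>f::nat \<Rightarrow> nat. (\<forall>i<N. f i < r) \<longrightarrow>
     (\<exists>a d. 0 < d \<and> a + l * d < N \<and> (\<forall>i\<le>l. f (a + i * d) = f a)) \<or>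
     (\<exists>b<N. \<exists>a d::nat \<Rightarrow> nat. (\<forall>j<s. 0 < d j \<and> a j + l * d j = b \<and> (\<forall>i<l. f (a j + i * d j) = f (a j)))
        \<and> inj_on (\<lambda>j. f (a j)) {..<s}))"

text \<open>Blocks of length N are coloured by their patterns, and l equal blocks in progression are
  followed by block \<open>A + l * D\<close>. Each focused progression of block A is combined with
  the step from block to block; the focus b, moved by that step alone, gives one more progression.
  All of them meet at position b of block \<open>A + l * D\<close>.\<close>

lemma focused_Suc:
  assumes l: "0 < l" and fcs: "focused l r s N" and vdw: "\<And>r. \<exists>M. waerden l r M"
  shows "\<exists>N'. focused l r (Suc s) N'"
proof -
  define S where "S = {xs::nat list. set xs \<subseteq> {..<r} \<and> length xs = N}"
  have "finite S" unfolding S_def by (rule finite_lists_length_eq) simp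
  then obtain h where h: "bij_betw h S {0..<card S}" using ex_bij_betw_finite_nat by blast
  obtain M where M: "waerden l (card S) M" using vdw by blast
  have "focused l r (Suc s) (N * M)"
    unfolding focused_def
  proof (intro allI impI)
    fix f :: "nat \<Rightarrow> nat" assume f: "\<forall>i<N * M. f i < r"
    define blk where "blk i = map (\<lambda>j. f (i * N + j)) [0..<N]" for i
    have idx: "i * N + j < N * M" if "i < M" "j < N" for i j
    proof -
      have "i * N + j < Suc i * N" using that by simp
      also have "\<dots> \<le> M * N" using that by (intro mult_le_mono1) simp
      finally show ?thesis by (simp add: mult.commute)
    qed
    have blkS: "blk i \<in> S" if "i < M" for i
      using f idx that by (auto simp: S_def blk_def)
    then have "\<forall>i<M. h (blk i) < card S"
      using h by (auto simp: bij_betw_def)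
    then obtain A D where AD: "0 < D" "A + l * D < M" "\<And>i. i < l \<Longrightarrow> h (blk (A + i * D)) = h (blk A)"
      using M[unfolded waerden_def, THEN spec, of "\<lambda>i. h (blk i)"] by auto
    have lt: "A + i * D < M" if "i \<le> l" for i
      using AD(2) mult_le_mono1[OF that, of D] by linarith
    have same: "f ((A + i * D) * N + j) = f (A * N + j)" if "i < l" "j < N" for i j
    proof -
      have "blk (A + i * D) = blk A"
        using AD(3)[OF that(1)] blkS lt[of i] lt[of 0] that(1) h by (auto simp: bij_betw_def inj_on_def)
      then have "blk (A + i * D) ! j = blk A ! j" by simp
      then show ?thesis using that(2) by (simp add: blk_def)
    qed
    have "\<forall>j<N. f (A * N + j) < r" using f idx lt[of 0] by simp
    then consider (long) a d where "0 < d" "a + l * d < N" "\<forall>i\<le>l. f (A * N + (a + i * d)) = f (A * N + a)"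
      | (foc) b a d where "b < N" "\<forall>j<s. 0 < d j \<and> a j + l * d j = b \<and> (\<forall>i<l. f (A * N + (a j + i * d j)) = f (A * N + a j))"
        "inj_on (\<lambda>j. f (A * N + a j)) {..<s}"
      using fcs[unfolded focused_def, THEN spec, of "\<lambda>j. f (A * N + j)"] by blast
    then show "(\<exists>a d. 0 < d \<and> a + l * d < N * M \<and> (\<forall>i\<le>l. f (a + i * d) = f a)) \<or>
      (\<exists>b<N * M. \<exists>a d. (\<forall>j<Suc s. 0 < d j \<and> a j + l * d j = b \<and> (\<forall>i<l. f (a j + i * d j) = f (a j)))
        \<and> inj_on (\<lambda>j. f (a j)) {..<Suc s})"
    proof cases
      case long
      have "A * N + (a + l * d) < N * M" using idx[OF _ long(2), of A] lt[of 0] by simp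
      with long show ?thesis
        by (intro disjI1 exI[of _ "A * N + a"] exI[of _ d]) (auto simp: algebra_simps)
    next
      case foc
      show ?thesis
      \<comment> \<open>If the focus repeats the colour of one of its progressions, that progression
        extends by one term; otherwise the focus brings a new colour.\<close>
      proof (cases "\<exists>j<s. f (A * N + a j) = f (A * N + b)")
        case True
        then obtain j where j: "j < s" "f (A * N + a j) = f (A * N + b)" by blast
        have fb: "0 < d j" "a j + l * d j = b" "\<And>i. i < l \<Longrightarrow> f (A * N + (a j + i * d j)) = f (A * N + a j)"
          using foc(2) j(1) by auto
        have "A * N + b < N * M" using idx[OF _ foc(1), of A] lt[of 0] by simp
        moreover have "f (A * N + a j + i * d j) = f (A * N + a j)" if "i \<le> l" for i
          using fb j(2) that by (cases "i = l") (auto simp: add.assoc)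
        ultimately show ?thesis
          using fb by (intro disjI1 exI[of _ "A * N + a j"] exI[of _ "d j"]) (auto simp: add.assoc)
      next
        case False
        define b' where "b' = (A + l * D) * N + b"
        define a' where "a' j = (if j < s then A * N + a j else A * N + b)" for j
        define d' where "d' j = (if j < s then d j + D * N else D * N)" for j
        have N: "0 < N" using foc(1) by simp
        have "b' < N * M" unfolding b'_def using idx[OF AD(2) foc(1)] .
        moreover have "0 < d' j \<and> a' j + l * d' j = b' \<and> (\<forall>i<l. f (a' j + i * d' j) = f (a' j))" if "j < Suc s" for j
        proof (cases "j < s")
          case True
          then have fb: "0 < d j" "a j + l * d j = b" "\<And>i. i < l \<Longrightarrow> f (A * N + (a j + i * d j)) = f (A * N + a j)"
            using foc(2) by auto
          have "f (a' j + i * d' j) = f (a' j)" if i: "i < l" for i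
          proof -
            have "a j + i * d j \<le> a j + l * d j" using i by simp
            then have "a j + i * d j < N" using fb(2) foc(1) by simp
            from same[OF i this] fb(3)[OF i]
            show ?thesis using True by (simp add: a'_def d'_def algebra_simps)
          qed
          moreover have "a' j + l * d' j = b'"
            using True fb(2) by (simp add: a'_def d'_def b'_def algebra_simps)
          ultimately show ?thesis using True fb(1) by (simp add: d'_def)
        next
          case False
          have "f (a' j + i * d' j) = f (a' j)" if i: "i < l" for i
            using same[OF i foc(1)] False by (simp add: a'_def d'_def algebra_simps)
          then show ?thesis using False AD(1) N by (simp add: a'_def d'_def b'_def algebra_simps)
        qed
        moreover have "inj_on (\<lambda>j. f (a' j)) {..<Suc s}"
        proof (rule inj_onI)
          fix i j assume "i \<in> {..<Suc s}" "j \<in> {..<Suc s}" "f (a' i) = f (a' j)"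
          then show "i = j"
            using foc(3) False by (cases "i < s"; cases "j < s") (auto simp: a'_def less_Suc_eq dest: inj_onD)
        qed
        ultimately show ?thesis by blast
      qed
    qed
  qed
  then show ?thesis ..
qed

text \<open>With r focused progressions every colour occurs among them, so the focus prolongs the
  one that shares its colour.\<close>

lemma van_der_Waerden: "0 < l \<Longrightarrow> \<exists>N. waerden l r N"
proof (induction l arbitrary: r rule: nat_induct_non_zero)
  case 1
  show ?case unfolding waerden_def
    by (intro exI[of _ 2] allI impI exI[of _ 0] exI[of _ 1]) auto
next
  case (Suc l)
  note vdw = Suc.IH
  have "\<exists>N. focused l r s N" for s
  proof (induction s)
    case 0
    show ?case unfolding focused_def
      by (intro exI[of _ 1] allI impI disjI2 exI[of _ 0]) auto
  next
    case (Suc s)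
    then obtain N where "focused l r s N" ..
    then show ?case using vdw by (rule focused_Suc[OF \<open>0 < l\<close>])
  qed
  then obtain N where N: "focused l r r N" by blast
  \<comment> \<open>Doubling leaves room for one more term, since d <= l * d < N.\<close>
  have "waerden (Suc l) r (2 * N)"
    unfolding waerden_def
  proof (intro allI impI)
    fix f :: "nat \<Rightarrow> nat" assume f: "\<forall>i<2 * N. f i < r"
    then have f': "\<forall>i<N. f i < r" by simp
    have "\<exists>a d. 0 < d \<and> a + l * d < N \<and> (\<forall>i\<le>l. f (a + i * d) = f a)"
    proof (rule disjE[OF N[unfolded focused_def, rule_format, OF f'[rule_format]]])
      assume "\<exists>b<N. \<exists>a d. (\<forall>j<r. 0 < d j \<and> a j + l * d j = b \<and> (\<forall>i<l. f (a j + i * d j) = f (a j)))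
        \<and> inj_on (\<lambda>j. f (a j)) {..<r}"
      then obtain b a d where b: "b < N" "\<And>j. j < r \<Longrightarrow> 0 < d j \<and> a j + l * d j = b \<and> (\<forall>i<l. f (a j + i * d j) = f (a j))"
        "inj_on (\<lambda>j. f (a j)) {..<r}" by blast
      have "(\<lambda>j. f (a j)) ` {..<r} \<subseteq> {..<r}"
      proof
        fix z assume "z \<in> (\<lambda>j. f (a j)) ` {..<r}"
        then obtain j where j: "j < r" "z = f (a j)" by auto
        have "a j < N" using b(2)[OF j(1)] b(1) by linarith
        with f' j(2) show "z \<in> {..<r}" by simp
      qed
      then have "(\<lambda>j. f (a j)) ` {..<r} = {..<r}"
        using b(3) by (intro endo_inj_surj) auto
      moreover have "f b \<in> {..<r}" using f' b(1) by simp
      ultimately obtain j where j: "j < r" "f b = f (a j)" by (metis imageE lessThan_iff)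
      from b(2)[OF j(1)] have bj: "0 < d j" "a j + l * d j = b" "\<And>i. i < l \<Longrightarrow> f (a j + i * d j) = f (a j)" by auto
      have "f (a j + i * d j) = f (a j)" if "i \<le> l" for i
        using bj j(2) that by (cases "i = l") auto
      with bj b(1) show ?thesis by (intro exI[of _ "a j"] exI[of _ "d j"]) auto
    qed simp
    then obtain a d where ad: "0 < d" "a + l * d < N" "\<And>i. i \<le> l \<Longrightarrow> f (a + i * d) = f a" by blast
    have "d \<le> l * d" using \<open>0 < l\<close> by (cases l) auto
    then have "a + Suc l * d < 2 * N" using ad(2) unfolding mult_Suc by linarith
    with ad show "\<exists>a d. 0 < d \<and> a + Suc l * d < 2 * N \<and> (\<forall>i<Suc l. f (a + i * d) = f a)"
      by (intro exI[of _ a] exI[of _ d]) auto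
  qed
  then show ?case ..
qed

lemma has_ap_mono: "has_ap l A \<Longrightarrow> A \<subseteq> B \<Longrightarrow> k \<le> l \<Longrightarrow> has_ap k B"
  unfolding has_ap_def by (meson less_le_trans subsetD)

text \<open>Two-colour a long progression in the union; a monochromatic subprogression lies in A or
  in B.\<close>

lemma has_ap_Un:
  assumes "\<And>l. has_ap l (A \<union> B)"
  shows "(\<forall>l. has_ap l A) \<or> (\<forall>l. has_ap l B)"
proof (rule ccontr)
  assume "\<not> ?thesis"
  then obtain l1 l2 where l12: "\<not> has_ap l1 A" "\<not> has_ap l2 B" by blast
  define l where "l = max 1 (max l1 l2)"
  have nA: "\<not> has_ap l A" and nB: "\<not> has_ap l B"
    using l12 has_ap_mono[OF _ order_refl, of l] by (auto simp: l_def)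
  have "0 < l" by (simp add: l_def)
  then obtain N where N: "waerden l 2 N" using van_der_Waerden[of l 2] by blast
  obtain a d where ad: "0 < d" "\<And>i. i < N \<Longrightarrow> a + i * d \<in> A \<union> B"
    using assms[of N] by (auto simp: has_ap_def)
  define f where "f i = (if a + i * d \<in> A then 0 else 1::nat)" for i
  have "\<forall>i<N. f i < 2" by (simp add: f_def)
  with N obtain a' d' where *: "0 < d'" "a' + l * d' < N" "\<And>i. i < l \<Longrightarrow> f (a' + i * d') = f a'"
    unfolding waerden_def by blast
  have lt: "a' + i * d' < N" if "i < l" for i
    using *(2) mult_le_mono1[of i l d'] that by linarith
  have eq: "(a + a' * d) + i * (d' * d) = a + (a' + i * d') * d" for i by (simp add: algebra_simps)
  show False
  proof (cases "f a' = 0")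
    case True
    then have "a + (a' + i * d') * d \<in> A" if "i < l" for i
      using *(3)[OF that] by (simp add: f_def split: if_splits)
    then have "has_ap l A" unfolding has_ap_def
      using *(1) ad(1) by (intro exI[of _ "a + a' * d"] exI[of _ "d' * d"]) (simp add: eq)
    with nA show False ..
  next
    case False
    then have "a + (a' + i * d') * d \<in> B" if "i < l" for i
      using *(3)[OF that] ad(2)[OF lt[OF that]] by (auto simp: f_def split: if_splits)
    then have "has_ap l B" unfolding has_ap_def
      using *(1) ad(1) by (intro exI[of _ "a + a' * d"] exI[of _ "d' * d"]) (simp add: eq)
    with nB show False ..
  qed
qed

section \<open>Ultrafilters on the positive integers and the multiplicative ideal\<close>

lemma betaN_D:
  assumes "U \<in> betaN"
  shows "\<And>A. A \<in> U \<Longrightarrow> A \<subseteq> Npos" "Npos \<in> U" "{} \<notin> U"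
    "\<And>A B. A \<in> U \<Longrightarrow> A \<subseteq> B \<Longrightarrow> B \<subseteq> Npos \<Longrightarrow> B \<in> U"
    "\<And>A B. A \<in> U \<Longrightarrow> B \<in> U \<Longrightarrow> A \<inter> B \<in> U"
    "\<And>A. A \<subseteq> Npos \<Longrightarrow> A \<in> U \<or> Npos - A \<in> U"
  using assms unfolding betaN_def by auto

text \<open>The sets with \<open>tiny\<close> complement form a proper filter, and an ultrafilter
  refining it has no \<open>tiny\<close> member.\<close>

lemma betaN_exists:
  fixes tiny :: "nat set \<Rightarrow> bool"
  assumes "tiny {}" "\<And>A B. tiny A \<Longrightarrow> tiny B \<Longrightarrow> tiny (A \<union> B)"
    "\<And>A B. tiny A \<Longrightarrow> B \<subseteq> A \<Longrightarrow> tiny B" "\<not> tiny Npos"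
  shows "\<exists>U\<in>betaN. \<forall>A\<in>U. \<not> tiny A"
proof -
  define F where "F = Abs_filter (\<lambda>P. tiny {n\<in>Npos. \<not> P n})"
  have evF: "eventually P F \<longleftrightarrow> tiny {n\<in>Npos. \<not> P n}" for P
    unfolding F_def
  proof (rule eventually_Abs_filter, unfold_locales)
    show "tiny {n \<in> Npos. \<not> True}" using assms(1) by simp
    show "tiny {n \<in> Npos. \<not> (P n \<and> Q n)}"
      if "tiny {n \<in> Npos. \<not> P n}" "tiny {n \<in> Npos. \<not> Q n}" for P Q
      by (rule assms(3)[OF assms(2)[OF that]]) auto
    show "tiny {n \<in> Npos. \<not> Q n}" if "\<forall>x. P x \<longrightarrow> Q x" "tiny {n \<in> Npos. \<not> P n}" for P Q
      by (rule assms(3)[OF that(2)]) (use that(1) in auto)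
  qed
  have "F \<noteq> bot" using assms(4) by (simp add: trivial_limit_def evF)
  from ultra_exists[OF this] obtain G where G: "G \<le> F" "ultra G" by blast
  define U where "U = {A. A \<subseteq> Npos \<and> eventually (\<lambda>n. n \<in> A) G}"
  have "{n \<in> Npos. \<not> 0 < n} = {}" by auto
  with evF[of "\<lambda>n. 0 < n"] assms(1) have "eventually (\<lambda>n. 0 < n) F" by metis
  then have pos: "eventually (\<lambda>n. 0 < n) G" by (rule filter_leD[OF G(1)])
  have "U \<in> betaN"
    unfolding betaN_def
  proof (intro CollectI conjI allI impI)
    show "U \<subseteq> Pow Npos" "Npos \<in> U" using pos by (auto simp: U_def)
    show "{} \<notin> U" using ultra_not_bot[OF G(2)] by (simp add: U_def)
  next
    fix A B assume "A \<in> U" "A \<subseteq> B" "B \<subseteq> Npos"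
    then show "B \<in> U" by (auto simp: U_def elim: eventually_mono)
  next
    fix A B assume "A \<in> U" "B \<in> U"
    then show "A \<inter> B \<in> U" by (auto simp: U_def eventually_conj_iff)
  next
    fix A :: "nat set" assume A: "A \<subseteq> Npos"
    show "A \<in> U \<or> Npos - A \<in> U"
    proof (cases "eventually (\<lambda>n. n \<in> A) G")
      case True
      with A show ?thesis by (simp add: U_def)
    next
      case False
      then have "eventually (\<lambda>n. n \<notin> A) G" using G(2) by (simp add: ultra_not)
      with pos show ?thesis by (simp add: U_def eventually_conj_iff)
    qed
  qed
  moreover have "\<not> tiny A" if "A \<in> U" for A
  proof
    assume "tiny A"
    have "{n \<in> Npos. \<not> n \<notin> A} = A" using that by (auto simp: U_def)
    with \<open>tiny A\<close> have "eventually (\<lambda>n. n \<notin> A) G"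
      using filter_leD[OF G(1)] evF[of "\<lambda>n. n \<notin> A"] by simp
    with that show False using ultra_not[OF G(2), of "\<lambda>n. n \<in> A"] by (simp add: U_def)
  qed
  ultimately show ?thesis by blast
qed

lemma uf_times_betaN:
  assumes U: "U \<in> betaN" and V: "V \<in> betaN"
  shows "uf_times U V \<in> betaN"
proof -
  note u = betaN_D[OF U] and v = betaN_D[OF V]
  define q where "q A n = {m \<in> Npos. m * n \<in> A}" for A n
  have mem: "A \<in> uf_times U V \<longleftrightarrow> A \<subseteq> Npos \<and> {n \<in> Npos. q A n \<in> V} \<in> U" for A
    by (simp add: uf_times_def q_def)
  show ?thesis
    unfolding betaN_def
  proof (intro CollectI conjI allI impI)
    show "uf_times U V \<subseteq> Pow Npos" by (auto simp: mem)
    have "n \<in> Npos \<Longrightarrow> q Npos n = Npos" for n by (auto simp: q_def)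
    then have "{n \<in> Npos. q Npos n \<in> V} = Npos" using v(2) by auto
    then show "Npos \<in> uf_times U V" using u(2) by (simp add: mem)
    have "{n \<in> Npos. q {} n \<in> V} = {}" using v(3) by (auto simp: q_def)
    then show "{} \<notin> uf_times U V" using u(3) mem by metis
  next
    fix A B assume A: "A \<in> uf_times U V" and AB: "A \<subseteq> B" "B \<subseteq> Npos"
    have "{n \<in> Npos. q A n \<in> V} \<subseteq> {n \<in> Npos. q B n \<in> V}"
      using AB v(4)[of "q A n" "q B n" for n] by (auto simp: q_def)
    with A AB u(4) show "B \<in> uf_times U V" by (auto simp: mem)
  next
    fix A B assume A: "A \<in> uf_times U V" and B: "B \<in> uf_times U V"
    have "{n \<in> Npos. q A n \<in> V} \<inter> {n \<in> Npos. q B n \<in> V} \<subseteq> {n \<in> Npos. q (A \<inter> B) n \<in> V}"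
    proof
      fix n assume n: "n \<in> {n \<in> Npos. q A n \<in> V} \<inter> {n \<in> Npos. q B n \<in> V}"
      then have "q A n \<inter> q B n \<in> V" by (intro v(5)) auto
      moreover have "q A n \<inter> q B n = q (A \<inter> B) n" by (auto simp: q_def)
      ultimately show "n \<in> {n \<in> Npos. q (A \<inter> B) n \<in> V}" using n by auto
    qed
    moreover have "{n \<in> Npos. q A n \<in> V} \<inter> {n \<in> Npos. q B n \<in> V} \<in> U"
      using A B by (intro u(5)) (auto simp: mem)
    ultimately have "{n \<in> Npos. q (A \<inter> B) n \<in> V} \<in> U" by (intro u(4)[of _ "{n \<in> Npos. q (A \<inter> B) n \<in> V}"]) auto
    with A show "A \<inter> B \<in> uf_times U V" by (auto simp: mem)
  next
    fix A :: "nat set" assume A: "A \<subseteq> Npos"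
    have "Npos - {n \<in> Npos. q A n \<in> V} \<subseteq> {n \<in> Npos. q (Npos - A) n \<in> V}"
    proof
      fix n assume n: "n \<in> Npos - {n \<in> Npos. q A n \<in> V}"
      then have "Npos - q A n \<in> V" using v(6)[of "q A n"] by (auto simp: q_def)
      moreover have "Npos - q A n = q (Npos - A) n" using n by (auto simp: q_def)
      ultimately show "n \<in> {n \<in> Npos. q (Npos - A) n \<in> V}" using n by auto
    qed
    with A show "A \<in> uf_times U V \<or> Npos - A \<in> uf_times U V"
      using u(6)[of "{n \<in> Npos. q A n \<in> V}"] u(4)[of "Npos - {n \<in> Npos. q A n \<in> V}" "{n \<in> Npos. q (Npos - A) n \<in> V}"]
      by (auto simp: mem)
  qed
qed

lemma closure_of_member:
  assumes "U \<in> betaN_topology closure_of S" "A \<in> U"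
  shows "\<exists>V\<in>S. A \<in> V"
proof -
  have top: "U \<in> topspace betaN_topology" and
    cl: "\<And>T. U \<in> T \<Longrightarrow> openin betaN_topology T \<Longrightarrow> \<exists>y\<in>S. y \<in> T"
    using assms(1) by (auto simp: in_closure_of)
  have "U \<in> betaN" using top unfolding betaN_topology_def topology_generated_by_topspace by auto
  with assms(2) have "A \<subseteq> Npos" "U \<in> {U \<in> betaN. A \<in> U}" using betaN_D(1) by blast+
  moreover from this(1) have "openin betaN_topology {U \<in> betaN. A \<in> U}"
    unfolding betaN_topology_def by (intro topology_generated_by_Basis) blast
  ultimately have "\<exists>y\<in>S. y \<in> {U \<in> betaN. A \<in> U}" by (intro cl)
  then show ?thesis by blast
qed

lemma closure_of_betaN: "U \<in> betaN_topology closure_of S \<Longrightarrow> U \<in> betaN"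
  unfolding in_closure_of betaN_topology_def topology_generated_by_topspace by auto

text \<open>The witnesses of a dilation invariant family of finite configurations form a two-sided ideal.\<close>

lemma closure_of_K_times_configuration:
  assumes fin: "\<And>F. F \<in> \<F> \<Longrightarrow> finite F \<and> F \<subseteq> Npos"
    and dil: "\<And>F m. F \<in> \<F> \<Longrightarrow> 0 < m \<Longrightarrow> (*) m ` F \<in> \<F>"
    and ex: "\<exists>U\<in>betaN. \<forall>A\<in>U. \<exists>F\<in>\<F>. F \<subseteq> A"
    and U: "U \<in> betaN_topology closure_of K_times" "A \<in> U"
  shows "\<exists>F\<in>\<F>. F \<subseteq> A"
proof -
  define W where "W = {U \<in> betaN. \<forall>A\<in>U. \<exists>F\<in>\<F>. F \<subseteq> A}"
  have "two_sided_ideal uf_times betaN W"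
    unfolding two_sided_ideal_def
  proof (intro conjI ballI)
    show "W \<noteq> {}" "W \<subseteq> betaN" using ex by (auto simp: W_def)
    fix U V assume U: "U \<in> betaN" and "V \<in> W"
    then have V: "V \<in> betaN" and wit: "\<And>A. A \<in> V \<Longrightarrow> \<exists>F\<in>\<F>. F \<subseteq> A" by (auto simp: W_def)
    note u = betaN_D[OF U] and v = betaN_D[OF V]
    \<comment> \<open>Some quotient A/n belongs to V; dilating a configuration inside it by n gives
      one inside A.\<close>
    have "\<exists>F\<in>\<F>. F \<subseteq> A" if "A \<in> uf_times U V" for A
    proof -
      have "{n \<in> Npos. {m \<in> Npos. m * n \<in> A} \<in> V} \<in> U"
        using that unfolding uf_times_def by blast
      with u(3) have "{n \<in> Npos. {m \<in> Npos. m * n \<in> A} \<in> V} \<noteq> {}" by metis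
      then obtain n where n: "0 < n" "{m \<in> Npos. m * n \<in> A} \<in> V" by auto
      obtain F where "F \<in> \<F>" "F \<subseteq> {m \<in> Npos. m * n \<in> A}" using wit[OF n(2)] by blast
      then show ?thesis using dil[OF _ n(1), of F] by (intro bexI[of _ "(*) n ` F"]) (auto simp: mult.commute)
    qed
    then show "uf_times U V \<in> W" using uf_times_betaN[OF U V] by (simp add: W_def)
    \<comment> \<open>A configuration F of elements n with A/n in U is finite, so these quotients
      have a common element m, and the dilate of F by m lies in A.\<close>
    have "\<exists>F\<in>\<F>. F \<subseteq> A" if A: "A \<in> uf_times V U" for A
    proof -
      obtain F where F: "F \<in> \<F>" "F \<subseteq> {n \<in> Npos. {m \<in> Npos. m * n \<in> A} \<in> U}"
        using wit[of "{n \<in> Npos. {m \<in> Npos. m * n \<in> A} \<in> U}"] A by (auto simp: uf_times_def)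
      have "Npos \<inter> (\<Inter>n\<in>G. {m \<in> Npos. m * n \<in> A}) \<in> U" if "finite G" "G \<subseteq> F" for G
        using that
      proof (induction G rule: finite_induct)
        case (insert n G)
        have "{m \<in> Npos. m * n \<in> A} \<in> U" using insert.prems F(2) by auto
        moreover have "Npos \<inter> (\<Inter>n\<in>G. {m \<in> Npos. m * n \<in> A}) \<in> U" using insert by auto
        ultimately have "{m \<in> Npos. m * n \<in> A} \<inter> (Npos \<inter> (\<Inter>n\<in>G. {m \<in> Npos. m * n \<in> A})) \<in> U" by (rule u(5))
        also have "{m \<in> Npos. m * n \<in> A} \<inter> (Npos \<inter> (\<Inter>n\<in>G. {m \<in> Npos. m * n \<in> A}))
            = Npos \<inter> (\<Inter>n\<in>insert n G. {m \<in> Npos. m * n \<in> A})" by auto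
        finally show ?case .
      qed (simp add: u(2))
      from this[of F] fin[OF F(1)] have "Npos \<inter> (\<Inter>n\<in>F. {m \<in> Npos. m * n \<in> A}) \<noteq> {}" using u(3) by auto
      then obtain m where "0 < m" "\<forall>n\<in>F. m * n \<in> A" by auto
      then show ?thesis using dil[OF F(1), of m] by (intro bexI[of _ "(*) m ` F"]) auto
    qed
    then show "uf_times V U \<in> W" using uf_times_betaN[OF V U] by (simp add: W_def)
  qed
  then have "K_times \<subseteq> W" by (auto simp: K_times_def smallest_ideal_def)
  moreover obtain V where "V \<in> K_times" "A \<in> V" using closure_of_member[OF U] by blast
  ultimately show ?thesis by (auto simp: W_def)
qed

lemma ex_betaN_has_ap: "\<exists>U\<in>betaN. \<forall>A\<in>U. \<forall>l. has_ap l A"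
proof -
  have "\<exists>U\<in>betaN. \<forall>A\<in>U. \<not> \<not> (\<forall>l. has_ap l A)"
  proof (rule betaN_exists)
    show "\<not> (\<forall>l. has_ap l {})" using has_ap_def[of 1 "{}"] by auto
    have "\<forall>i<l. 1 + i * 1 \<in> Npos" for l :: nat by simp
    then show "\<not> \<not> (\<forall>l. has_ap l Npos)" unfolding has_ap_def using zero_less_one by blast
    show "\<not> (\<forall>l. has_ap l (A \<union> B))" if "\<not> (\<forall>l. has_ap l A)" "\<not> (\<forall>l. has_ap l B)" for A B
      using that has_ap_Un by blast
    show "\<not> (\<forall>l. has_ap l B)" if "\<not> (\<forall>l. has_ap l A)" "B \<subseteq> A" for A B
      using that has_ap_mono by blast
  qed
  then show ?thesis by simp
qed

lemma closure_of_K_times_has_ap: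
  assumes "U \<in> betaN_topology closure_of K_times" "A \<in> U"
  shows "has_ap l A"
proof -
  define \<F> where "\<F> = {(\<lambda>i. a + i * d) ` {..<l} | a d. 0 < a \<and> 0 < (d::nat)}"
  have "\<exists>F\<in>\<F>. F \<subseteq> A"
  proof (rule closure_of_K_times_configuration[OF _ _ _ assms])
    fix F assume "F \<in> \<F>"
    then obtain a d where F: "F = (\<lambda>i. a + i * d) ` {..<l}" "0 < a" "0 < d" by (auto simp: \<F>_def)
    then show "finite F \<and> F \<subseteq> Npos" by auto
    fix m :: nat assume "0 < m"
    then show "(*) m ` F \<in> \<F>" unfolding F image_image \<F>_def using F(2,3)
      by (intro CollectI exI[of _ "m * a"] exI[of _ "m * d"]) (auto simp: algebra_simps)
  next
    obtain U where U: "U \<in> betaN" "\<And>A l. A \<in> U \<Longrightarrow> has_ap l A" using ex_betaN_has_ap by blast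
    have "\<exists>F\<in>\<F>. F \<subseteq> A" if A: "A \<in> U" for A
    proof -
      \<comment> \<open>The extra term puts a itself into A, and hence makes it positive, even for l
        = 0.\<close>
      obtain a d where ad: "0 < d" "\<forall>i<Suc l. a + i * d \<in> A"
        using U(2)[OF A, of "Suc l"] unfolding has_ap_def by blast
      then have "a \<in> A" by force
      then have "0 < a" using betaN_D(1)[OF U(1) A] by auto
      with ad show ?thesis unfolding \<F>_def by (intro bexI[of _ "(\<lambda>i. a + i * d) ` {..<l}"]) auto
    qed
    with U(1) show "\<exists>U\<in>betaN. \<forall>A\<in>U. \<exists>F\<in>\<F>. F \<subseteq> A" by blast
  qed
  then show ?thesis by (auto simp: \<F>_def has_ap_def)
qed

lemma centered_ap_member:
  assumes "U \<in> betaN" "\<And>A. A \<in> U \<Longrightarrow> has_ap (Suc (2 * L)) A" "A \<in> U"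
  shows "{t \<in> A. \<exists>d>0. \<forall>\<mu>::int. \<bar>\<mu>\<bar> \<le> int L \<longrightarrow> int t + \<mu> * d \<in> int ` A} \<in> U" (is "?A1 \<in> U")
proof (rule ccontr)
  note u = betaN_D[OF assms(1)]
  assume "?A1 \<notin> U"
  moreover have "?A1 \<subseteq> Npos" using u(1)[OF assms(3)] by auto
  ultimately have "Npos - ?A1 \<in> U" using u(6) by blast
  with assms(3) have "A \<inter> (Npos - ?A1) \<in> U" by (rule u(5))
  from assms(2)[OF this] obtain a d where ad0: "0 < d" "\<forall>i<Suc (2 * L). a + i * d \<in> A \<inter> (Npos - ?A1)"
    unfolding has_ap_def by blast
  have ad: "0 < d" "\<And>i. i \<le> 2 * L \<Longrightarrow> a + i * d \<in> A \<inter> (Npos - ?A1)"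
    using ad0 by (simp_all only: less_Suc_eq_le)
  \<comment> \<open>The middle one of 2 L + 1 terms has L steps on either side, so it is a
    centre.\<close>
  have "int (a + L * d) + \<mu> * int d \<in> int ` A" if "\<bar>\<mu>\<bar> \<le> int L" for \<mu>
  proof -
    have "int (a + L * d) + \<mu> * int d = int (a + nat (int L + \<mu>) * d)"
      using that by (simp add: algebra_simps)
    moreover have "nat (int L + \<mu>) \<le> 2 * L" using that by linarith
    then have "a + nat (int L + \<mu>) * d \<in> A" using ad(2) by blast
    ultimately show ?thesis by (metis imageI)
  qed
  moreover have "0 < int d" using ad(1) by simp
  moreover have "L \<le> 2 * L" by simp
  then have "a + L * d \<in> A \<inter> (Npos - ?A1)" by (rule ad(2))
  ultimately show False by blast
qed

section \<open>Ultrafilters for linear equations\<close>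

definition ufilter :: "nat set set \<Rightarrow> nat filter" where
  "ufilter U = Abs_filter (\<lambda>P. {n \<in> Npos. P n} \<in> U)"

lemma eventually_ufilter:
  assumes "U \<in> betaN"
  shows "eventually P (ufilter U) \<longleftrightarrow> {n \<in> Npos. P n} \<in> U"
  unfolding ufilter_def
proof (rule eventually_Abs_filter, unfold_locales)
  note u = betaN_D[OF assms]
  show "{n \<in> Npos. True} \<in> U" using u(2) by simp
  show "{n \<in> Npos. P n \<and> Q n} \<in> U" if "{n \<in> Npos. P n} \<in> U" "{n \<in> Npos. Q n} \<in> U" for P Q
  proof -
    have "{n \<in> Npos. P n \<and> Q n} = {n \<in> Npos. P n} \<inter> {n \<in> Npos. Q n}" by blast
    with u(5)[OF that] show ?thesis by metis
  qed
  show "{n \<in> Npos. Q n} \<in> U" if "\<forall>x. P x \<longrightarrow> Q x" "{n \<in> Npos. P n} \<in> U" for P Q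
    by (rule u(4)[OF that(2)]) (use that(1) in blast)+
qed

lemma idem_uf_ufilter:
  assumes "U \<in> I_plus"
  shows "idem_uf (ufilter U)"
proof
  have U: "U \<in> betaN" and idem: "uf_plus U U = U" using assms by (auto simp: I_plus_def)
  note u = betaN_D[OF U] and ev = eventually_ufilter[OF U]
  show "ultra (ufilter U)"
    unfolding ultra_def
  proof (intro conjI allI)
    have "{n \<in> Npos. False} \<notin> U" using u(3) by simp
    then show "ufilter U \<noteq> bot" using ev[of "\<lambda>_. False"] by (metis eventually_bot)
    fix P
    have "Npos - {n \<in> Npos. P n} = {n \<in> Npos. \<not> P n}" by blast
    then show "eventually P (ufilter U) \<or> eventually (\<lambda>x. \<not> P x) (ufilter U)"
      using u(6)[of "{n \<in> Npos. P n}"] unfolding ev by auto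
  qed
  show "eventually P (ufilter U) \<longleftrightarrow> eventually (\<lambda>n. eventually (\<lambda>m. P (n + m)) (ufilter U)) (ufilter U)" for P
  proof -
    have "{n \<in> Npos. P n} \<in> U \<longleftrightarrow> {n \<in> Npos. P n} \<in> uf_plus U U" using idem by simp
    also have "\<dots> \<longleftrightarrow> {n \<in> Npos. {m \<in> Npos. m + n \<in> {n \<in> Npos. P n}} \<in> U} \<in> U"
      unfolding uf_plus_def by blast
    also have "{n \<in> Npos. {m \<in> Npos. m + n \<in> {n \<in> Npos. P n}} \<in> U} = {n \<in> Npos. {m \<in> Npos. P (n + m)} \<in> U}"
    proof -
      have "{m \<in> Npos. m + n \<in> {n \<in> Npos. P n}} = {m \<in> Npos. P (n + m)}" for n
        by (auto simp: add.commute)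
      then show ?thesis by simp
    qed
    finally show ?thesis unfolding ev .
  qed
  have "{n \<in> Npos. 0 < n} = Npos" by blast
  then show "eventually (\<lambda>n. 0 < n) (ufilter U)" unfolding ev using u(2) by simp
qed

section \<open>Return times and difference sets\<close>

text \<open>Known as the sets of class Delta_r^*, for some r. The uniform r is what allows Ramsey's
  theorem and the choice of a largest difference-free set below.\<close>

definition delta_star :: "nat set \<Rightarrow> bool" where
  "delta_star Z \<longleftrightarrow> (\<exists>r. \<forall>S. finite S \<longrightarrow> card S = r \<longrightarrow> (\<exists>s\<in>S. \<exists>t\<in>S. s < t \<and> t - s \<in> Z))"

text \<open>Join two points of a large set when their difference lies in \<open>Z1\<close>. An
  independent set of size r1 is impossible, and a clique of size r2 contains a pair whose difference
  is also in \<open>Z2\<close>.\<close>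

lemma delta_star_Int:
  assumes "delta_star Z1" "delta_star Z2"
  shows "delta_star (Z1 \<inter> Z2)"
proof -
  obtain r1 where r1: "\<And>S. finite S \<Longrightarrow> card S = r1 \<Longrightarrow> \<exists>s\<in>S. \<exists>t\<in>S. s < t \<and> t - s \<in> Z1"
    using assms(1) unfolding delta_star_def by blast
  obtain r2 where r2: "\<And>S. finite S \<Longrightarrow> card S = r2 \<Longrightarrow> \<exists>s\<in>S. \<exists>t\<in>S. s < t \<and> t - s \<in> Z2"
    using assms(2) unfolding delta_star_def by blast
  obtain r where r: "\<And>(V::nat set) E. finite V \<Longrightarrow> card V \<ge> r \<Longrightarrow>
      \<exists>R\<subseteq>V. card R = r2 \<and> clique R E \<or> card R = r1 \<and> indep R E"
    using ramsey2[of r2 r1] by blast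
  have "\<exists>s\<in>S. \<exists>t\<in>S. s < t \<and> t - s \<in> Z1 \<inter> Z2" if S: "finite S" "card S = r" for S
  proof -
    define E where "E = {{s, t} | s t. s < t \<and> t - s \<in> Z1}"
    have E: "{s, t} \<in> E \<longleftrightarrow> t - s \<in> Z1" if "s < t" for s t
      using that unfolding E_def by (auto simp: doubleton_eq_iff)
    obtain R where R: "R \<subseteq> S" "card R = r2 \<and> clique R E \<or> card R = r1 \<and> indep R E"
      using r[of S E] S by auto
    have fin: "finite R" using R(1) S(1) by (rule finite_subset)
    from R(2) show ?thesis
    proof
      assume c: "card R = r2 \<and> clique R E"
      then obtain s t where st: "s \<in> R" "t \<in> R" "s < t" "t - s \<in> Z2" using r2[OF fin] by blast
      then have "{s, t} \<in> E" using c unfolding clique_def by auto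
      with st E R(1) show ?thesis by blast
    next
      assume c: "card R = r1 \<and> indep R E"
      then obtain s t where st: "s \<in> R" "t \<in> R" "s < t" "t - s \<in> Z1" using r1[OF fin] by blast
      then have "{s, t} \<notin> E" using c unfolding indep_def by auto
      with st E show ?thesis by blast
    qed
  qed
  then show ?thesis unfolding delta_star_def by blast
qed

lemma posdens_ray: "posdens (int ` {n. k < n})"
proof (rule posdensI[of 1])
  fix L :: int assume "0 \<le> L"
  define a where "a = int k + 1"
  have "int ` {n. k < n} \<inter> {a..a + L} = {a..a + L}"
  proof -
    have "x \<in> int ` {n. k < n}" if "a \<le> x" for x
      using that by (intro image_eqI[of _ _ "nat x"]) (auto simp: a_def)
    then show ?thesis by auto
  qed
  with \<open>0 \<le> L\<close> show "\<exists>a b. L \<le> b - a \<and> 1 * real_of_int (b - a + 1) \<le> real (card (int ` {n. k < n} \<inter> {a..b}))"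
    by (intro exI[of _ a] exI[of _ "a + L"]) simp
qed simp

lemma posdens_finite_UN:
  assumes "finite S" "posdens (\<Union>s\<in>S. E s)"
  shows "\<exists>s\<in>S. posdens (E s)"
  using assms
proof (induction S rule: finite_induct)
  case empty
  then show ?case using posdens_infinite[of "{}"] by simp
next
  case (insert s S)
  then show ?case using posdens_Un[of "E s" "\<Union>s\<in>S. E s"] by auto
qed

text \<open>Take a largest S without differences in Z. Every n beyond S must differ by an element of
  Z from some member of S, so finitely many translates of Z cover a ray.\<close>

lemma delta_star_posdens:
  assumes "delta_star Z"
  shows "posdens (int ` (Npos \<inter> Z))"
proof -
  obtain r where r: "\<And>S. finite S \<Longrightarrow> card S = r \<Longrightarrow> \<exists>s\<in>S. \<exists>t\<in>S. s < t \<and> t - s \<in> Z"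
    using assms unfolding delta_star_def by blast
  define G where "G S \<longleftrightarrow> finite S \<and> (\<forall>s\<in>S. \<forall>t\<in>S. s < t \<longrightarrow> t - s \<notin> Z)" for S
  have bound: "card S \<le> r" if "G S" for S
  proof (rule ccontr)
    assume "\<not> card S \<le> r"
    then obtain R where "R \<subseteq> S" "card R = r" "finite R"
      using obtain_subset_with_card_n[of r S] by auto
    with r that show False unfolding G_def by blast
  qed
  have "G {}" by (simp add: G_def)
  moreover have "\<forall>S'. G S' \<longrightarrow> card S' < Suc r" using bound by (simp add: less_Suc_eq_le)
  ultimately have "\<exists>S. G S \<and> (\<forall>S'. G S' \<longrightarrow> card S' \<le> card S)"
    by (rule ex_has_greatest_nat)
  then obtain S where S: "G S" "\<And>S'. G S' \<Longrightarrow> card S' \<le> card S" by blast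
  have finS: "finite S" using S(1) by (simp add: G_def)
  obtain k where k: "\<And>s. s \<in> S \<Longrightarrow> s \<le> k" using finite_nat_set_iff_bounded_le finS by auto
  have "int ` {n. k < n} \<subseteq> (\<Union>s\<in>S. {x. x + - int s \<in> int ` (Npos \<inter> Z)})"
  proof
    fix x assume "x \<in> int ` {n. k < n}"
    then obtain n where n: "x = int n" "k < n" by auto
    have "n \<notin> S" using k[of n] n(2) by auto
    then have "card (insert n S) = Suc (card S)" using finS by simp
    then have "\<not> G (insert n S)" using S(2)[of "insert n S"] by auto
    then obtain s t where st: "s \<in> insert n S" "t \<in> insert n S" "s < t" "t - s \<in> Z"
      using finS unfolding G_def by blast
    have "\<not> (s \<in> S \<and> t \<in> S)" using S(1) st unfolding G_def by blast
    moreover have "s \<noteq> n" using st k[of t] n(2) by auto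
    ultimately have "s \<in> S" "t = n" using st by auto
    then have "x + - int s \<in> int ` (Npos \<inter> Z)"
      using st n by (intro image_eqI[of _ _ "n - s"]) auto
    with \<open>s \<in> S\<close> show "x \<in> (\<Union>s\<in>S. {x. x + - int s \<in> int ` (Npos \<inter> Z)})" by blast
  qed
  from posdens_finite_UN[OF finS posdens_mono[OF posdens_ray this]]
  obtain s where "posdens {x. x + - int s \<in> int ` (Npos \<inter> Z)}" by blast
  from posdens_shift[OF this, of "int s"] show ?thesis by simp
qed

text \<open>The factor d keeps the family closed under quotients: the quotient of
  \<open>returns B d\<close> by n is the return set for the factor d n.\<close>

definition returns :: "int set \<Rightarrow> int \<Rightarrow> nat set" where
  "returns B d = {z \<in> Npos. posdens {x \<in> B. x + d * int z \<in> B}}"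

lemma posdens_return_uminus:
  assumes "posdens {x \<in> B. x + h \<in> B}"
  shows "posdens {x \<in> B. x + - h \<in> B}"
proof -
  have "{x. x + - h \<in> {x \<in> B. x + h \<in> B}} = {x \<in> B. x + - h \<in> B}" by auto
  with posdens_shift[OF assms, of "- h"] show ?thesis by simp
qed

text \<open>Apply \<open>posdens_return\<close> to the dilate of S by d. A negative d reverses the
  order, which the symmetry of return times repairs; for d = 0 every difference is a return
  time.\<close>

lemma delta_star_returns:
  assumes "posdens B"
  shows "delta_star (returns B d)"
proof (cases "d = 0")
  case True
  have "\<exists>s\<in>S. \<exists>t\<in>S. s < t \<and> t - s \<in> returns B d" if S: "finite S" "card S = 2" for S :: "nat set"
  proof -
    obtain s t where "S = {s, t}" "s \<noteq> t" using S(2) by (auto simp: card_2_iff)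
    with True assms show ?thesis
      by (cases "s < t") (auto simp: returns_def)
  qed
  then show ?thesis unfolding delta_star_def by blast
next
  case False
  obtain r where r: "\<And>S. finite S \<Longrightarrow> card S = r \<Longrightarrow> \<exists>s\<in>S. \<exists>t\<in>S. s < t \<and> posdens {x \<in> B. x + (t - s) \<in> B}"
    using posdens_return[OF assms] by blast
  have "\<exists>s\<in>S. \<exists>t\<in>S. s < t \<and> t - s \<in> returns B d" if S: "finite S" "card S = r" for S :: "nat set"
  proof -
    have "inj_on (\<lambda>s. d * int s) S" using False by (auto simp: inj_on_def)
    then have "card ((\<lambda>s. d * int s) ` S) = r" using S(2) by (simp add: card_image)
    with r[of "(\<lambda>s. d * int s) ` S"] S(1) obtain s t where st: "s \<in> S" "t \<in> S" "d * int s < d * int t"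
      "posdens {x \<in> B. x + (d * int t - d * int s) \<in> B}" by auto
    show ?thesis
    proof (cases "s < t")
      case True
      then have "d * int (t - s) = d * int t - d * int s" by (simp add: of_nat_diff algebra_simps)
      with st True show ?thesis by (intro bexI[of _ s] bexI[of _ t]) (auto simp: returns_def)
    next
      case False
      with st(3) have "t < s" by (metis linorder_neqE_nat order.irrefl)
      then have eq: "d * int (s - t) = - (d * int t - d * int s)" by (simp add: of_nat_diff algebra_simps)
      from posdens_return_uminus[OF st(4)] have "posdens {x \<in> B. x + d * int (s - t) \<in> B}"
        unfolding eq .
      with st \<open>t < s\<close> show ?thesis by (intro bexI[of _ t] bexI[of _ s]) (auto simp: returns_def)
    qed
  qed
  then show ?thesis unfolding delta_star_def by blast
qed

text \<open>The ultrafilters meeting these conditions form a left ideal of \<open>(\<beta>\<nat>, \<odot>)\<close>, whereas those whose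
  members contain long progressions form a two-sided ideal; hence the product below has both.\<close>

definition rich :: "nat set set \<Rightarrow> bool" where
  "rich U \<longleftrightarrow> (\<forall>A\<in>U. posdens (int ` A)) \<and> (\<forall>B d. posdens B \<longrightarrow> returns B d \<in> U)"

text \<open>Let a set be tiny if it has no positive density within some \<open>delta_star\<close>
  set. Intersections of \<open>delta_star\<close> sets show that tiny sets are closed under unions,
  and \<open>delta_star_posdens\<close> that \<open>Npos\<close> is not tiny. An ultrafilter without
  tiny members contains each return set, the complement being tiny.\<close>

lemma ex_rich: "\<exists>U\<in>betaN. rich U"
proof -
  define tiny where "tiny A \<longleftrightarrow> (\<exists>Z. delta_star Z \<and> \<not> posdens (int ` (A \<inter> Z)))" for A
  have univ: "delta_star UNIV"
  proof -
    have "\<exists>s\<in>S. \<exists>t\<in>S. s < t \<and> t - s \<in> UNIV" if "finite S" "card S = 2" for S :: "nat set"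
      using that(2) by (auto simp: card_2_iff)
    then show ?thesis unfolding delta_star_def by blast
  qed
  have emp: "\<not> posdens {}" using posdens_infinite by blast
  have "\<exists>U\<in>betaN. \<forall>A\<in>U. \<not> tiny A"
  proof (rule betaN_exists)
    show "tiny {}" using univ emp by (auto simp: tiny_def)
    show "tiny (A \<union> B)" if A: "tiny A" and B: "tiny B" for A B
    proof -
      obtain Z1 Z2 where Z: "delta_star Z1" "\<not> posdens (int ` (A \<inter> Z1))"
        "delta_star Z2" "\<not> posdens (int ` (B \<inter> Z2))" using A B by (auto simp: tiny_def)
      have "\<not> posdens (int ` ((A \<union> B) \<inter> (Z1 \<inter> Z2)))"
      proof
        assume "posdens (int ` ((A \<union> B) \<inter> (Z1 \<inter> Z2)))"
        then have "posdens (int ` (A \<inter> Z1) \<union> int ` (B \<inter> Z2))" by (rule posdens_mono) auto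
        with Z posdens_Un show False by blast
      qed
      with delta_star_Int[OF Z(1,3)] show ?thesis unfolding tiny_def by blast
    qed
    show "tiny B" if "tiny A" "B \<subseteq> A" for A B
    proof -
      obtain Z where Z: "delta_star Z" "\<not> posdens (int ` (A \<inter> Z))" using \<open>tiny A\<close> by (auto simp: tiny_def)
      have "int ` (B \<inter> Z) \<subseteq> int ` (A \<inter> Z)" using \<open>B \<subseteq> A\<close> by blast
      then have "\<not> posdens (int ` (B \<inter> Z))" using Z(2) posdens_mono by blast
      with Z(1) show ?thesis unfolding tiny_def by blast
    qed
    show "\<not> tiny Npos" using delta_star_posdens unfolding tiny_def by blast
  qed
  then obtain U where U: "U \<in> betaN" "\<And>A. A \<in> U \<Longrightarrow> \<not> tiny A" by blast
  have "posdens (int ` A)" if "A \<in> U" for A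
    using U(2)[OF that] univ by (auto simp: tiny_def)
  moreover have "returns B d \<in> U" if "posdens B" for B d
  proof (rule ccontr)
    assume "returns B d \<notin> U"
    moreover have "returns B d \<subseteq> Npos" by (auto simp: returns_def)
    ultimately have "Npos - returns B d \<in> U" using betaN_D(6)[OF U(1)] by blast
    then have "\<not> tiny (Npos - returns B d)" by (rule U(2))
    moreover have "(Npos - returns B d) \<inter> returns B d = {}" by blast
    ultimately show False using delta_star_returns[OF that, of d] emp unfolding tiny_def by (metis image_empty)
  qed
  ultimately show ?thesis using U(1) unfolding rich_def by blast
qed

lemma ex_rich_has_ap: "\<exists>U\<in>betaN. rich U \<and> (\<forall>A\<in>U. \<forall>l. has_ap l A)"
proof -
  obtain U where U: "U \<in> betaN" "rich U" using ex_rich by blast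
  obtain V where V: "V \<in> betaN" "\<And>A l. A \<in> V \<Longrightarrow> has_ap l A" using ex_betaN_has_ap by blast
  note u = betaN_D[OF U(1)] and v = betaN_D[OF V(1)]
  let ?q = "\<lambda>A n. {m \<in> Npos. m * n \<in> A}"
  have mem: "A \<in> uf_times V U \<longleftrightarrow> A \<subseteq> Npos \<and> {n \<in> Npos. ?q A n \<in> U} \<in> V" for A
    by (simp add: uf_times_def)
  have "has_ap l A" if A: "A \<in> uf_times V U" for A l
  proof -
    have "{n \<in> Npos. ?q A n \<in> U} \<in> V" using A mem by blast
    from V(2)[OF this, of l] obtain a d where ad: "0 < d" "\<And>i. i < l \<Longrightarrow> ?q A (a + i * d) \<in> U"
      unfolding has_ap_def by blast
    have "Npos \<inter> (\<Inter>i\<in>{..<k}. ?q A (a + i * d)) \<in> U" if "k \<le> l" for k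
      using that
    proof (induction k)
      case (Suc k)
      have 1: "Npos \<inter> (\<Inter>i\<in>{..<k}. ?q A (a + i * d)) \<in> U" using Suc by simp
      have 2: "?q A (a + k * d) \<in> U" using Suc.prems by (intro ad(2)) simp
      have "?q A (a + k * d) \<inter> (Npos \<inter> (\<Inter>i\<in>{..<k}. ?q A (a + i * d))) \<in> U"
        by (rule u(5)[OF 2 1])
      moreover have "?q A (a + k * d) \<inter> (Npos \<inter> (\<Inter>i\<in>{..<k}. ?q A (a + i * d)))
          = Npos \<inter> (\<Inter>i\<in>{..<Suc k}. ?q A (a + i * d))" by (auto simp: less_Suc_eq)
      ultimately show ?case by metis
    qed (use u(2) in simp)
    from this[of l] u(3) have "Npos \<inter> (\<Inter>i\<in>{..<l}. ?q A (a + i * d)) \<noteq> {}" by (metis order_refl)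
    then obtain m where m: "0 < m" "\<And>i. i < l \<Longrightarrow> m * (a + i * d) \<in> A" by auto
    then show ?thesis unfolding has_ap_def
      using ad(1) by (intro exI[of _ "m * a"] exI[of _ "m * d"]) (auto simp: algebra_simps)
  qed
  moreover have "posdens (int ` A)" if A: "A \<in> uf_times V U" for A
  proof -
    have "{n \<in> Npos. ?q A n \<in> U} \<in> V" using A mem by blast
    with v(3) have "{n \<in> Npos. ?q A n \<in> U} \<noteq> {}" by metis
    then obtain n where n: "0 < n" "?q A n \<in> U" by auto
    then have "posdens ((*) (int n) ` int ` ?q A n)"
      using U(2) by (intro posdens_dilate) (auto simp: rich_def)
    then show ?thesis by (rule posdens_mono) (auto simp: mult.commute simp flip: of_nat_mult)
  qed
  moreover have "returns B d \<in> uf_times V U" if "posdens B" for B d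
  proof -
    have "?q (returns B d) n \<in> U" if n: "0 < n" for n
    proof -
      have "?q (returns B d) n = returns B (d * int n)"
        using n by (auto simp: returns_def mult_ac)
      then show ?thesis using U(2) \<open>posdens B\<close> by (simp add: rich_def)
    qed
    then have "{n \<in> Npos. ?q (returns B d) n \<in> U} = Npos" by blast
    moreover have "returns B d \<subseteq> Npos" by (auto simp: returns_def)
    ultimately show ?thesis using v(2) unfolding mem by simp
  qed
  ultimately show ?thesis using uf_times_betaN[OF V(1) U(1)] unfolding rich_def by blast
qed

text \<open>One variable is added at a time: if h is the sum so far, the points of B that remain in
  B after the shift by h have positive density, and a return time of this set serves the longer sum.
  There are infinitely many candidates in A, so finitely many may be avoided.\<close>

lemma rich_linear_recurrence:
  assumes U: "U \<in> betaN" "rich U" and A: "A \<in> U" and B: "posdens B" and Y: "finite Y"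
  shows "\<exists>y. inj_on y Y \<and> y ` Y \<subseteq> A \<and> posdens {x \<in> B. x + (\<Sum>v\<in>Y. d v * int (y v)) \<in> B} \<and>
    ((\<exists>v\<in>Y. d v \<noteq> 0) \<longrightarrow> (\<Sum>v\<in>Y. d v * int (y v)) \<noteq> 0)"
  using Y
proof (induction Y rule: finite_induct)
  case empty
  then show ?case using B by simp
next
  case (insert v Y)
  then obtain y where y: "inj_on y Y" "y ` Y \<subseteq> A" "posdens {x \<in> B. x + (\<Sum>v\<in>Y. d v * int (y v)) \<in> B}"
    "(\<exists>v\<in>Y. d v \<noteq> 0) \<longrightarrow> (\<Sum>v\<in>Y. d v * int (y v)) \<noteq> 0" by blast
  define h where "h = (\<Sum>v\<in>Y. d v * int (y v))"
  define B1 where "B1 = {x \<in> B. x + h \<in> B}"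
  have B1: "posdens B1" using y(3) by (simp add: B1_def h_def)
  \<comment> \<open>At most one value, for which the new sum would vanish.\<close>
  define E where "E = {z::nat. d v \<noteq> 0 \<and> h + d v * int z = 0}"
  have "finite E"
  proof (rule finite_subset)
    show "E \<subseteq> {nat (- h div d v)}"
    proof
      fix z assume "z \<in> E"
      then have "d v \<noteq> 0" "- h = d v * int z" by (auto simp: E_def)
      then show "z \<in> {nat (- h div d v)}" by simp
    qed
  qed simp
  have "A \<inter> returns B1 (d v) \<in> U"
    using U(2) A B1 by (intro betaN_D(5)[OF U(1)]) (auto simp: rich_def)
  then have "infinite (int ` (A \<inter> returns B1 (d v)))" using U(2) posdens_infinite unfolding rich_def by blast
  then have "infinite (A \<inter> returns B1 (d v))" by blast
  then have "infinite (A \<inter> returns B1 (d v) - (y ` Y \<union> E))"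
    using \<open>finite E\<close> insert.hyps(1) by (intro Diff_infinite_finite) auto
  then obtain z where z: "z \<in> A" "z \<in> returns B1 (d v)" "z \<notin> y ` Y" "z \<notin> E"
    using infinite_imp_nonempty by blast
  define y' where "y' = y(v := z)"
  have y': "y' u = y u" if "u \<in> Y" for u using that insert.hyps(2) by (auto simp: y'_def)
  have sum: "(\<Sum>v\<in>insert v Y. d v * int (y' v)) = h + d v * int z"
  proof -
    have "(\<Sum>v\<in>Y. d v * int (y' v)) = h" unfolding h_def by (intro sum.cong) (simp_all add: y')
    then show ?thesis using insert.hyps by (simp add: y'_def)
  qed
  have "inj_on y' (insert v Y)"
    using y(1) z(3) y' insert.hyps(2) by (auto simp: inj_on_def y'_def)
  moreover have "y' ` insert v Y \<subseteq> A" using y(2) z(1) y' by (auto simp: y'_def)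
  moreover have "posdens {x \<in> B. x + (\<Sum>v\<in>insert v Y. d v * int (y' v)) \<in> B}"
  proof (rule posdens_mono)
    show "posdens {x \<in> B1. x + d v * int z \<in> B1}" using z(2) by (simp add: returns_def)
    show "{x \<in> B1. x + d v * int z \<in> B1} \<subseteq> {x \<in> B. x + (\<Sum>v\<in>insert v Y. d v * int (y' v)) \<in> B}"
      unfolding sum by (auto simp: B1_def algebra_simps)
  qed
  moreover have "(\<exists>u\<in>insert v Y. d u \<noteq> 0) \<longrightarrow> (\<Sum>v\<in>insert v Y. d v * int (y' v)) \<noteq> 0"
    unfolding sum using y(4) z(4) by (auto simp: E_def h_def)
  ultimately show ?case by blast
qed

section \<open>Solutions of Rado equations\<close>

text \<open>The index j minus the weighted mean of the indices, cleared of denominators. With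
  nonzero coefficient sum these weights are distinct, and their combination with the coefficients is
  0.\<close>

definition spread :: "(nat \<Rightarrow> int) \<Rightarrow> nat set \<Rightarrow> nat \<Rightarrow> int" where
  "spread c I j = (\<Sum>i\<in>I. c i) * int j - (\<Sum>i\<in>I. c i * int i)"

lemma sum_spread: "(\<Sum>j\<in>I. c j * spread c I j) = 0"
proof -
  define S E where "S = (\<Sum>i\<in>I. c i)" and "E = (\<Sum>i\<in>I. c i * int i)"
  have "(\<Sum>j\<in>I. c j * spread c I j) = (\<Sum>j\<in>I. c j * int j * S - c j * E)"
    unfolding spread_def S_def[symmetric] E_def[symmetric] by (intro sum.cong) (auto simp: algebra_simps)
  also have "\<dots> = E * S - S * E"
    unfolding sum_subtractf sum_distrib_right[symmetric] S_def[symmetric] E_def[symmetric] ..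
  finally show ?thesis by simp
qed

text \<open>The dilation factor \<open>s\<close> serves to avoid \<open>F\<close>.\<close>

lemma spread_solution:
  fixes c :: "nat \<Rightarrow> int" and d :: int
  assumes fin: "finite I" "finite F" and N: "card I * card F < N" and S: "(\<Sum>i\<in>I. c i) \<noteq> 0"
    and d: "0 < d" and t: "t \<notin> F"
    and A: "\<And>s j. s \<in> {1..N} \<Longrightarrow> j \<in> I \<Longrightarrow> int t + int s * spread c I j * d \<in> int ` A"
  shows "\<exists>x. (\<forall>j\<in>I. x j \<in> A - F) \<and> inj_on x I \<and> (\<Sum>j\<in>I. c j * int (x j)) = (\<Sum>i\<in>I. c i) * int t"
proof -
  define bad where "bad j f = {s \<in> {1..N}. int t + int s * spread c I j * d = int f}" for j f
  \<comment> \<open>For each j a forbidden value excludes at most one factor s. If the weight is 0,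
    the value is always t, which is outside F.\<close>
  have one: "card (bad j f) \<le> 1" if "f \<in> F" for j f
  proof (cases "spread c I j = 0")
    case True
    then have "bad j f = {}" using t that by (auto simp: bad_def)
    then show ?thesis by simp
  next
    case False
    have "s = s'" if "s \<in> bad j f" "s' \<in> bad j f" for s s'
    proof -
      have "int t + int s * spread c I j * d = int f" "int t + int s' * spread c I j * d = int f"
        using that unfolding bad_def by blast+
      then have "int s * spread c I j * d = int s' * spread c I j * d" by linarith
      then show ?thesis using False d by simp
    qed
    then show ?thesis by (simp add: card_le_Suc0_iff_eq bad_def)
  qed
  have "card (\<Union>j\<in>I. \<Union>f\<in>F. bad j f) \<le> (\<Sum>j\<in>I. card (\<Union>f\<in>F. bad j f))"
    by (rule card_UN_le[OF fin(1)])
  also have "\<dots> \<le> (\<Sum>j\<in>I. \<Sum>f\<in>F. card (bad j f))"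
    by (intro sum_mono card_UN_le fin(2))
  also have "\<dots> \<le> (\<Sum>j\<in>I. \<Sum>f\<in>F. 1)"
    by (intro sum_mono one)
  also have "\<dots> < card {1..N}" using N by simp
  finally have "\<not> {1..N} \<subseteq> (\<Union>j\<in>I. \<Union>f\<in>F. bad j f)"
    using card_mono[of "\<Union>j\<in>I. \<Union>f\<in>F. bad j f" "{1..N}"] fin by (force simp: bad_def)
  then obtain s where s: "s \<in> {1..N}" "\<And>j f. j \<in> I \<Longrightarrow> f \<in> F \<Longrightarrow> s \<notin> bad j f" by blast
  have "\<exists>x. \<forall>j\<in>I. x j \<in> A \<and> int (x j) = int t + int s * spread c I j * d"
    using A[OF s(1)] by (intro bchoice) (metis imageE)
  then obtain x where x: "\<And>j. j \<in> I \<Longrightarrow> x j \<in> A" "\<And>j. j \<in> I \<Longrightarrow> int (x j) = int t + int s * spread c I j * d"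
    by blast
  have "x j \<notin> F" if "j \<in> I" for j
    using s(2)[OF that, of "x j"] x(2)[OF that] s(1) by (auto simp: bad_def)
  moreover have "inj_on x I"
  proof (rule inj_onI)
    fix i j assume ij: "i \<in> I" "j \<in> I" "x i = x j"
    then have "int s * spread c I i * d = int s * spread c I j * d" using x(2)[OF ij(1)] x(2)[OF ij(2)] by linarith
    then have "spread c I i = spread c I j" using s(1) d by simp
    then show "i = j" using S by (simp add: spread_def)
  qed
  moreover have "(\<Sum>j\<in>I. c j * int (x j)) = (\<Sum>i\<in>I. c i) * int t"
  proof -
    have "(\<Sum>j\<in>I. c j * int (x j)) = (\<Sum>j\<in>I. c j * int t + int s * d * (c j * spread c I j))"
      by (intro sum.cong refl) (simp add: x(2) algebra_simps)
    also have "\<dots> = (\<Sum>i\<in>I. c i) * int t"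
      by (simp add: sum.distrib sum_distrib_left[symmetric] sum_spread sum_distrib_right)
    finally show ?thesis .
  qed
  ultimately show ?thesis using x(1) by blast
qed

lemma ap_subset_member:
  assumes "U \<in> betaN" "\<And>A l. A \<in> U \<Longrightarrow> has_ap l A" "A \<in> U" "finite I"
  shows "\<exists>A1\<in>U. A1 \<subseteq> A \<and> (\<forall>t\<in>A1. \<exists>d::int>0. \<forall>s\<in>{1..N}. \<forall>j\<in>I. int t + int s * lam j * d \<in> int ` A)"
proof -
  \<comment> \<open>Bounds all multiples \<open>s * lam j\<close> that occur, so that one centred
    progression serves every dilation factor.\<close>
  define L where "L = nat (int N * (\<Sum>j\<in>I. \<bar>lam j\<bar>))"
  have L: "\<bar>int s * lam j\<bar> \<le> int L" if "s \<in> {1..N}" "j \<in> I" for s j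
  proof -
    have "\<bar>lam j\<bar> \<le> (\<Sum>j\<in>I. \<bar>lam j\<bar>)"
      using that(2) assms(4) by (intro member_le_sum) auto
    then have "int s * \<bar>lam j\<bar> \<le> int N * (\<Sum>j\<in>I. \<bar>lam j\<bar>)"
      using that(1) by (intro mult_mono) auto
    then show ?thesis by (simp add: L_def abs_mult)
  qed
  let ?A1 = "{t \<in> A. \<exists>d>0. \<forall>\<mu>::int. \<bar>\<mu>\<bar> \<le> int L \<longrightarrow> int t + \<mu> * d \<in> int ` A}"
  have "?A1 \<in> U" using assms by (intro centered_ap_member)
  moreover have "\<exists>d::int>0. \<forall>s\<in>{1..N}. \<forall>j\<in>I. int t + int s * lam j * d \<in> int ` A" if "t \<in> ?A1" for t
    using that L by blast
  ultimately show ?thesis by (intro bexI[of _ ?A1]) blast+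
qed

definition rest_vars :: "nat \<Rightarrow> nat \<Rightarrow> nat set \<Rightarrow> (nat + nat) set" where
  "rest_vars n k J = y_vars k \<union> Inl ` ({1..n} - J)"

definition rest_poly :: "nat \<Rightarrow> (nat \<Rightarrow> int) \<Rightarrow> nat set \<Rightarrow> (nat + nat) int_mpoly \<Rightarrow> (nat + nat) int_mpoly" where
  "rest_poly n c J P = (\<Sum>i\<in>{1..n} - J. mpoly_const (c i) * mpoly_var (Inl i)) + P"

lemma finite_rest_vars: "finite (rest_vars n k J)"
  by (simp add: rest_vars_def y_vars_def)

lemma mpoly_eval_rest_poly:
  "mpoly_eval a (rest_poly n c J P) = (\<Sum>i\<in>{1..n} - J. c i * a (Inl i)) + mpoly_eval a P"
  by (simp add: rest_poly_def mpoly_eval_add mpoly_eval_sum mpoly_eval_const_times_var)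

lemma mpoly_eval_rado_rest:
  assumes "J \<subseteq> {1..n}"
  shows "mpoly_eval a (rado_poly n c P) = (\<Sum>j\<in>J. c j * a (Inl j)) + mpoly_eval a (rest_poly n c J P)"
  using sum.subset_diff[OF assms, of "\<lambda>i. c i * a (Inl i)"]
  by (simp add: mpoly_eval_rado_poly mpoly_eval_rest_poly)

lemma mpoly_vars_rest_poly:
  assumes "mpoly_vars P \<subseteq> y_vars k"
  shows "mpoly_vars (rest_poly n c J P) \<subseteq> rest_vars n k J"
proof -
  have "mpoly_vars (\<Sum>i\<in>{1..n} - J. mpoly_const (c i) * mpoly_var (Inl i :: nat + nat)) \<subseteq> Inl ` ({1..n} - J)"
  proof (rule order_trans[OF mpoly_vars_sum], rule UN_least)
    fix i assume "i \<in> {1..n} - J"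
    then show "mpoly_vars (mpoly_const (c i) * mpoly_var (Inl i :: nat + nat)) \<subseteq> Inl ` ({1..n} - J)"
      using mpoly_vars_const_times_var[of "c i" "Inl i :: nat + nat"] by blast
  qed
  then have "mpoly_vars (\<Sum>i\<in>{1..n} - J. mpoly_const (c i) * mpoly_var (Inl i :: nat + nat)) \<union> mpoly_vars P
      \<subseteq> rest_vars n k J"
    using assms unfolding rest_vars_def by (intro Un_least) (auto simp: subset_iff)
  then show ?thesis
    unfolding rest_poly_def by (rule order_trans[OF mpoly_vars_add])
qed

lemma lookup_rest_poly_zero:
  "Poly_Mapping.lookup P 0 = 0 \<Longrightarrow> Poly_Mapping.lookup (rest_poly n c J P) 0 = 0"
  by (simp add: rest_poly_def lookup_add lookup_sum lookup_const_times_var_zero)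

lemma rado_solution:
  assumes J: "J \<subseteq> {1..n}" "j0 \<in> J" "\<And>j. j \<in> J \<Longrightarrow> c j \<noteq> 0" "(\<Sum>j\<in>J. c j) = 0"
    and P: "mpoly_vars P \<subseteq> y_vars k"
    and N: "N = card (J - {j0}) * (card (rest_vars n k J) + 1) + 1"
    and A1: "A1 \<subseteq> A" "\<And>t. t \<in> A1 \<Longrightarrow> \<exists>d::int>0. \<forall>s\<in>{1..N}. \<forall>j\<in>J - {j0}.
      int t + int s * spread c (J - {j0}) j * d \<in> int ` A"
    and y: "inj_on y (rest_vars n k J)" "y ` rest_vars n k J \<subseteq> A"
    and h: "h = mpoly_eval (\<lambda>v. int (y v)) (rest_poly n c J P)"
    and B: "B = (*) (c j0) ` int ` A1" "posdens {x \<in> B. x + h \<in> B}"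
  shows "\<exists>a. (\<forall>v\<in>x_vars n \<union> y_vars k. a v \<in> A) \<and> mpoly_eval (\<lambda>v. int (a v)) (rado_poly n c P) = 0 \<and>
    inj_on a (x_vars n \<union> y_vars k - {Inl j0}) \<and> (h \<noteq> 0 \<longrightarrow> inj_on a (x_vars n \<union> y_vars k))"
proof -
  define Y where "Y = rest_vars n k J"
  define I where "I = J - {j0}"
  have finY: "finite Y" by (simp add: Y_def finite_rest_vars)
  have finJ: "finite J" using J(1) finite_subset by blast
  have finI: "finite I" using finJ by (simp add: I_def)
  \<comment> \<open>Leaving out E and its translate by -h keeps both x1 and t away from the values
    of y.\<close>
  define E where "E = (*) (c j0) ` int ` y ` Y"
  have "finite (E \<union> (\<lambda>z. z - h) ` E)" using finY by (simp add: E_def)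
  then have "infinite ({x \<in> B. x + h \<in> B} - (E \<union> (\<lambda>z. z - h) ` E))"
    using posdens_infinite[OF B(2)] by (rule Diff_infinite_finite)
  then obtain x where x: "x \<in> B" "x + h \<in> B" "x \<notin> E" "x \<notin> (\<lambda>z. z - h) ` E"
    using infinite_imp_nonempty by blast
  from x(1,2) B(1) obtain x1 t where x1: "x1 \<in> A1" "x = c j0 * int x1" and t: "t \<in> A1" "x + h = c j0 * int t"
    by auto
  have x1Y: "x1 \<notin> y ` Y" using x(3) x1(2) by (auto simp: E_def)
  have tY: "t \<notin> y ` Y"
  proof
    assume "t \<in> y ` Y"
    then have "x + h \<in> E" using t(2) by (auto simp: E_def)
    then have "x \<in> (\<lambda>z. z - h) ` E" by (intro image_eqI[of _ _ "x + h"]) auto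
    with x(4) show False ..
  qed
  \<comment> \<open>Forbidden for the variables in I. The value x1 is included only if it differs
    from t, since t must stay outside F; this is where h nonzero yields full injectivity. At most
    \<open>card Y + 1\<close> values are forbidden, whence N.\<close>
  define F where "F = y ` Y \<union> ({x1} - {t})"
  have finF: "finite F" using finY by (simp add: F_def)
  have "card F \<le> card (y ` Y) + card ({x1} - {t})" unfolding F_def by (rule card_Un_le)
  also have "\<dots> \<le> card Y + 1"
    using card_image_le[OF finY, of y] card_mono[of "{x1}" "{x1} - {t}"] by auto
  finally have "card I * card F \<le> card I * (card Y + 1)" by (rule mult_le_mono2)
  then have cardN: "card I * card F < N" unfolding N I_def Y_def by simp
  have tF: "t \<notin> F" using tY by (simp add: F_def)
  have sumI: "(\<Sum>i\<in>I. c i) = - c j0"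
    using J(2,4) finJ by (simp add: I_def sum_diff1)
  obtain d :: int where d: "0 < d" "\<And>s j. s \<in> {1..N} \<Longrightarrow> j \<in> I \<Longrightarrow> int t + int s * spread c I j * d \<in> int ` A"
    using A1(2)[OF t(1)] unfolding I_def by blast
  obtain xs where xs: "\<And>j. j \<in> I \<Longrightarrow> xs j \<in> A" "\<And>j. j \<in> I \<Longrightarrow> xs j \<notin> F" "inj_on xs I"
    "(\<Sum>j\<in>I. c j * int (xs j)) = - c j0 * int t"
    using spread_solution[OF finI finF cardN _ d(1) tF d(2)] J(2,3) sumI by force
  define a where "a v = (case v of Inl i \<Rightarrow> if i = j0 then x1 else if i \<in> J then xs i else y v | Inr j \<Rightarrow> y v)" for v
  have aY: "a v = y v" if "v \<in> Y" for v
    using that J(2) by (auto simp: a_def Y_def rest_vars_def y_vars_def)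
  have aI: "a (Inl j) = xs j" if "j \<in> I" for j
    using that by (auto simp: a_def I_def)
  have a0: "a (Inl j0) = x1" by (simp add: a_def)
  have V: "x_vars n \<union> y_vars k = insert (Inl j0) (Inl ` I \<union> Y)"
    using J(1,2) by (auto simp: x_vars_def Y_def rest_vars_def I_def)
  have j0Y: "Inl j0 \<notin> Inl ` I \<union> Y"
    using J(2) by (auto simp: Y_def rest_vars_def I_def y_vars_def)
  have "a v \<in> A" if "v \<in> x_vars n \<union> y_vars k" for v
    using that unfolding V using a0 x1(1) A1(1) aI xs(1) aY y(2) by (auto simp: Y_def)
  moreover have "mpoly_eval (\<lambda>v. int (a v)) (rado_poly n c P) = 0"
  proof -
    have "mpoly_eval (\<lambda>v. int (a v)) (rest_poly n c J P) = h"
      unfolding h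
    proof (rule mpoly_eval_cong)
      fix v assume "v \<in> mpoly_vars (rest_poly n c J P)"
      then have "v \<in> Y" using mpoly_vars_rest_poly[OF P, of n c J] unfolding Y_def by blast
      then show "int (a v) = int (y v)" by (simp add: aY)
    qed
    moreover have "(\<Sum>j\<in>J. c j * int (a (Inl j))) = c j0 * int x1 + (\<Sum>j\<in>I. c j * int (xs j))"
      using J(2) finJ aI by (simp add: sum.remove[of J j0] a0 I_def)
    ultimately show ?thesis
      using x1(2) t(2) xs(4) by (simp add: mpoly_eval_rado_rest[OF J(1)])
  qed
  moreover have inj: "inj_on a (Inl ` I \<union> Y)"
  proof (rule inj_onI)
    fix u v assume uv: "u \<in> Inl ` I \<union> Y" "v \<in> Inl ` I \<union> Y" "a u = a v"
    have F: "a w \<in> F" if "w \<in> Y" for w using that aY by (auto simp: F_def)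
    have nF: "a w \<notin> F" if "w \<in> Inl ` I" for w using that aI xs(2) by auto
    have "u \<in> Y \<longleftrightarrow> a u \<in> F" "v \<in> Y \<longleftrightarrow> a v \<in> F"
      using uv(1,2) F nF by blast+
    then consider "u \<in> Y" "v \<in> Y" | "u \<in> Inl ` I" "v \<in> Inl ` I"
      using uv by auto
    then show "u = v"
    proof cases
      case 1
      with uv(3) aY y(1) show ?thesis by (auto simp: Y_def dest: inj_onD)
    next
      case 2
      with uv(3) aI xs(3) show ?thesis by (auto dest: inj_onD)
    qed
  qed
  moreover have "inj_on a (insert (Inl j0) (Inl ` I \<union> Y))" if "h \<noteq> 0"
  proof -
    have "x1 \<noteq> t" using x1(2) t(2) that by auto
    then have "x1 \<in> F" by (simp add: F_def)
    then have "x1 \<notin> a ` (Inl ` I)" using aI xs(2) by auto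
    moreover have "x1 \<notin> a ` Y" using x1Y aY by auto
    ultimately show ?thesis using inj j0Y a0 by auto
  qed
  moreover have "x_vars n \<union> y_vars k - {Inl j0} = Inl ` I \<union> Y" using V j0Y by auto
  ultimately show ?thesis using V by metis
qed

text \<open>Two ultrafilters cooperate: U supplies the density of A1, and an idempotent V containing
  A, which may depend on A, supplies the values of y.\<close>

lemma recurrence_in_closure:
  assumes "U \<in> betaN_topology closure_of I_plus" "U \<in> BD" "A \<in> U" "A1 \<in> U" "finite E" "c0 \<noteq> 0"
    and "mpoly_vars f \<subseteq> Y" "finite Y" "Poly_Mapping.lookup f 0 = 0" and B: "B = (*) c0 ` int ` A1"
  shows "\<exists>y. inj_on y Y \<and> y ` Y \<subseteq> A - E \<and> posdens {x \<in> B. x + mpoly_eval (\<lambda>v. int (y v)) f \<in> B}"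
proof -
  obtain V where V: "V \<in> I_plus" "A \<in> V" using closure_of_member[OF assms(1,3)] by blast
  then have "V \<in> betaN" by (simp add: I_plus_def)
  interpret idem_uf "ufilter V" using V(1) by (rule idem_uf_ufilter)
  have "{n \<in> Npos. n \<in> A} = A" using betaN_D(1)[OF \<open>V \<in> betaN\<close> V(2)] by blast
  then have "eventually (\<lambda>n. n \<in> A) (ufilter V)"
    unfolding eventually_ufilter[OF \<open>V \<in> betaN\<close>] using V(2) by simp
  moreover have "eventually (\<lambda>n. \<forall>e\<in>E. n \<noteq> e) (ufilter V)"
    by (intro eventually_ball_finite[OF assms(5)] ballI eventually_neq)
  ultimately have ev: "eventually (\<lambda>n. n \<in> A - E) (ufilter V)"
    by eventually_elim auto
  have "posdens (int ` A1)" using assms(2,4) by (intro banach_density_posdens) (auto simp: BD_def)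
  then have "posdens B" unfolding B using assms(6) by (rule posdens_dilate)
  from mpoly_recurrence[OF this assms(8,7,9) ev] show ?thesis by metis
qed

lemma card_x_vars: "card (x_vars n) = n"
  by (simp add: x_vars_def card_image)

lemma card_y_vars: "card (y_vars k) = k"
  by (simp add: y_vars_def card_image)

lemma card_x_y_vars: "card (x_vars n \<union> y_vars k) = n + k"
proof -
  have "card (x_vars n \<union> y_vars k) = card (x_vars n) + card (y_vars k)"
    by (intro card_Un_disjoint) (auto simp: x_vars_def y_vars_def)
  then show ?thesis by (simp only: card_x_vars card_y_vars)
qed

lemma injective_but_one_card:
  assumes "inj_on a (x_vars n \<union> y_vars k - {Inl j0})" "j0 \<in> {1..n}"
  shows "n - 1 \<le> card (a ` x_vars n)" "k \<le> card (a ` y_vars k)"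
proof -
  have fin: "finite (x_vars n)" by (simp add: x_vars_def)
  have "inj_on a (x_vars n - {Inl j0})" using assms(1) by (rule inj_on_subset) auto
  then have "card (a ` (x_vars n - {Inl j0})) = n - 1"
    using assms(2) fin by (simp add: card_image card_Diff_singleton card_x_vars x_vars_def)
  then show "n - 1 \<le> card (a ` x_vars n)"
    using card_mono[of "a ` x_vars n" "a ` (x_vars n - {Inl j0})"] fin by auto
  have "inj_on a (y_vars k)" using assms(1) by (rule inj_on_subset) (auto simp: y_vars_def)
  then show "k \<le> card (a ` y_vars k)" by (simp add: card_image card_y_vars)
qed

lemma linear_rado_solution_in_closure:
  assumes J: "J \<subseteq> {1..n}" "j0 \<in> J" "\<And>j. j \<in> J \<Longrightarrow> c j \<noteq> 0" "(\<Sum>j\<in>J. c j) = 0"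
    and P: "mpoly_vars P \<subseteq> y_vars k" "Poly_Mapping.lookup P 0 = 0" "P \<noteq> 0" "mpoly_linear P"
    and U: "U \<in> betaN_topology closure_of K_times" "A \<in> U"
  shows "\<exists>a. (\<forall>v\<in>x_vars n \<union> y_vars k. a v \<in> A) \<and> mpoly_eval (\<lambda>v. int (a v)) (rado_poly n c P) = 0 \<and>
    inj_on a (x_vars n \<union> y_vars k)"
proof -
  let ?V = "x_vars n \<union> y_vars k"
  define d where "d v = Poly_Mapping.lookup P (Poly_Mapping.single v 1)" for v
  have fin: "finite (y_vars k)" by (simp add: y_vars_def)
  have evP: "mpoly_eval a P = (\<Sum>v\<in>y_vars k. d v * a v)" for a
    unfolding d_def by (rule mpoly_eval_linear(1)[OF P(4,2,1) fin])
  obtain v0 where v0: "v0 \<in> y_vars k" "d v0 \<noteq> 0"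
    using mpoly_eval_linear(2)[OF P(4,2,1) fin P(3)] unfolding d_def by blast
  define \<F> where "\<F> = {a ` ?V | a. inj_on a ?V \<and> a ` ?V \<subseteq> Npos \<and>
    mpoly_eval (\<lambda>v. int (a v)) (rado_poly n c P) = 0}"
  have "\<exists>F\<in>\<F>. F \<subseteq> A"
  proof (rule closure_of_K_times_configuration[OF _ _ _ U])
    fix F assume "F \<in> \<F>"
    then obtain a where F: "F = a ` ?V" and a: "inj_on a ?V" "a ` ?V \<subseteq> Npos"
      "mpoly_eval (\<lambda>v. int (a v)) (rado_poly n c P) = 0" by (auto simp: \<F>_def)
    show "finite F \<and> F \<subseteq> Npos" using a(2) F by (simp add: x_vars_def y_vars_def)
    fix m :: nat assume m: "0 < m"
    \<comment> \<open>For linear P without constant term the equation is homogeneous, so the family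
      of solution sets is invariant under dilation.\<close>
    have "mpoly_eval (\<lambda>v. int (m * a v)) (rado_poly n c P) = int m * mpoly_eval (\<lambda>v. int (a v)) (rado_poly n c P)"
      by (simp add: mpoly_eval_rado_poly evP distrib_left sum_distrib_left mult_ac)
    with a m have "inj_on (\<lambda>v. m * a v) ?V \<and> (\<lambda>v. m * a v) ` ?V \<subseteq> Npos \<and>
        mpoly_eval (\<lambda>v. int (m * a v)) (rado_poly n c P) = 0"
      by (auto simp: inj_on_def)
    then show "(*) m ` F \<in> \<F>" unfolding F image_image \<F>_def by blast
  next
    \<comment> \<open>One ultrafilter all of whose members contain solutions makes the ideal
      nonempty; it need not be related to the given one.\<close>
    obtain U where U: "U \<in> betaN" "rich U" "\<And>A l. A \<in> U \<Longrightarrow> has_ap l A" using ex_rich_has_ap by blast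
    have "\<exists>F\<in>\<F>. F \<subseteq> A" if A: "A \<in> U" for A
    proof -
      define N where "N = card (J - {j0}) * (card (rest_vars n k J) + 1) + 1"
      have finJ: "finite J" using J(1) finite_subset by blast
      obtain A1 where A1: "A1 \<in> U" "A1 \<subseteq> A" "\<And>t. t \<in> A1 \<Longrightarrow> \<exists>d::int>0. \<forall>s\<in>{1..N}. \<forall>j\<in>J - {j0}.
          int t + int s * spread c (J - {j0}) j * d \<in> int ` A"
        using ap_subset_member[OF U(1,3) A, of "J - {j0}" N "spread c (J - {j0})"] finJ by blast
      define B where "B = (*) (c j0) ` int ` A1"
      have B: "posdens B" unfolding B_def using A1(1) U(2) J(2,3) by (intro posdens_dilate) (auto simp: rich_def)
      define e where "e v = (case v of Inl i \<Rightarrow> c i | Inr j \<Rightarrow> d v)" for v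
      have sum: "(\<Sum>v\<in>rest_vars n k J. e v * int (y v)) = mpoly_eval (\<lambda>v. int (y v)) (rest_poly n c J P)" for y
      proof -
        have "(\<Sum>v\<in>rest_vars n k J. e v * int (y v)) =
            (\<Sum>v\<in>y_vars k. e v * int (y v)) + (\<Sum>v\<in>Inl ` ({1..n} - J). e v * int (y v))"
          unfolding rest_vars_def by (intro sum.union_disjoint) (auto simp: y_vars_def)
        also have "(\<Sum>v\<in>y_vars k. e v * int (y v)) = (\<Sum>v\<in>y_vars k. d v * int (y v))"
          by (intro sum.cong) (auto simp: e_def y_vars_def)
        also have "(\<Sum>v\<in>Inl ` ({1..n} - J). e v * int (y v)) = (\<Sum>i\<in>{1..n} - J. c i * int (y (Inl i)))"
          by (subst sum.reindex) (auto simp: e_def)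
        finally show ?thesis by (simp add: mpoly_eval_rest_poly evP)
      qed
      \<comment> \<open>A nonzero coefficient allows h to be chosen nonzero, which makes all
        variables distinct.\<close>
      have "\<exists>v\<in>rest_vars n k J. e v \<noteq> 0"
        using v0 by (intro bexI[of _ v0]) (auto simp: e_def rest_vars_def y_vars_def)
      with rich_linear_recurrence[OF U(1,2) A B finite_rest_vars, of n k J e]
      obtain y where y: "inj_on y (rest_vars n k J)" "y ` rest_vars n k J \<subseteq> A"
        "posdens {x \<in> B. x + mpoly_eval (\<lambda>v. int (y v)) (rest_poly n c J P) \<in> B}"
        "mpoly_eval (\<lambda>v. int (y v)) (rest_poly n c J P) \<noteq> 0"
        unfolding sum by blast
      from rado_solution[OF J P(1) N_def A1(2,3) y(1,2) refl B_def y(3)] y(4)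
      obtain a where a: "\<forall>v\<in>?V. a v \<in> A" "mpoly_eval (\<lambda>v. int (a v)) (rado_poly n c P) = 0" "inj_on a ?V"
        by blast
      have "a ` ?V \<subseteq> Npos" using a(1) betaN_D(1)[OF U(1) A] by blast
      with a show ?thesis unfolding \<F>_def by blast
    qed
    with U(1) show "\<exists>U\<in>betaN. \<forall>A\<in>U. \<exists>F\<in>\<F>. F \<subseteq> A" by blast
  qed
  then show ?thesis unfolding \<F>_def by blast
qed

theorem theorem2p7:
  fixes n k :: nat and c :: "nat \<Rightarrow> int" and P R :: "(nat + nat) int_mpoly"
  assumes "is_rado n k c P"
    and "R = rado_poly n c P"
  shows "(\<forall>U \<in> betaN_topology closure_of K_times \<inter> betaN_topology closure_of I_plus \<inter> BD.
           PR_witness U (x_vars n \<union> y_vars k) R {(x_vars n, n - 1), (y_vars k, k)})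
    \<and> (n = 2 \<longrightarrow> (\<forall>U \<in> betaN_topology closure_of I_plus \<inter> BD.
           PR_witness U (x_vars n \<union> y_vars k) R {(x_vars n, n - 1), (y_vars k, k)}
           \<and> (k = 1 \<and> P \<noteq> 0 \<longrightarrow>
                PR_witness U (x_vars n \<union> y_vars k) R {(x_vars n, 2), (y_vars k, k)})))
    \<and> (P \<noteq> 0 \<and> mpoly_linear P \<longrightarrow> (\<forall>U \<in> betaN_topology closure_of K_times.
           PR_witness U (x_vars n \<union> y_vars k) R {(x_vars n \<union> y_vars k, n + k)}))"
proof -
  let ?V = "x_vars n \<union> y_vars k"
  from assms(1) obtain J where P: "mpoly_vars P \<subseteq> y_vars k" "Poly_Mapping.lookup P 0 = 0"
    and J: "J \<subseteq> {1..n}" "J \<noteq> {}" "\<And>j. j \<in> J \<Longrightarrow> c j \<noteq> 0" "(\<Sum>j\<in>J. c j) = 0"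
    unfolding is_rado_def by blast
  from J(2) obtain j0 where j0: "j0 \<in> J" by blast
  then have j0n: "j0 \<in> {1..n}" using J(1) by blast
  have finJ: "finite J" using J(1) finite_subset by blast
  define N where "N = card (J - {j0}) * (card (rest_vars n k J) + 1) + 1"
  \<comment> \<open>The finite set E of values that y has to avoid is empty, except for n = 2, k = 1
    and P nonzero, where it consists of the roots of P.\<close>
  have recurrent: "\<exists>a y. (\<forall>v\<in>?V. a v \<in> A) \<and> mpoly_eval (\<lambda>v. int (a v)) R = 0 \<and>
      inj_on a (?V - {Inl j0}) \<and> y ` rest_vars n k J \<subseteq> A - E \<and>
      (mpoly_eval (\<lambda>v. int (y v)) (rest_poly n c J P) \<noteq> 0 \<longrightarrow> inj_on a ?V)"
    if U: "U \<in> betaN_topology closure_of I_plus" "U \<in> BD" "A \<in> U" and E: "finite E"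
      and A1: "A1 \<in> U" "A1 \<subseteq> A" "\<And>t. t \<in> A1 \<Longrightarrow> \<exists>d::int>0. \<forall>s\<in>{1..N}. \<forall>j\<in>J - {j0}.
          int t + int s * spread c (J - {j0}) j * d \<in> int ` A" for U A A1 E
  proof -
    define B where "B = (*) (c j0) ` int ` A1"
    obtain y where y: "inj_on y (rest_vars n k J)" "y ` rest_vars n k J \<subseteq> A - E"
      "posdens {x \<in> B. x + mpoly_eval (\<lambda>v. int (y v)) (rest_poly n c J P) \<in> B}"
      using recurrence_in_closure[OF U A1(1) E J(3)[OF j0] mpoly_vars_rest_poly[OF P(1)]
          finite_rest_vars lookup_rest_poly_zero[OF P(2)] B_def] by blast
    have "y ` rest_vars n k J \<subseteq> A" using y(2) by blast
    from rado_solution[OF J(1) j0 J(3,4) P(1) N_def A1(2,3) y(1) this refl B_def y(3)] y(2)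
    show ?thesis unfolding assms(2) by blast
  qed
  have 1: "PR_witness U ?V R {(x_vars n, n - 1), (y_vars k, k)}"
    if U: "U \<in> betaN_topology closure_of K_times" "U \<in> betaN_topology closure_of I_plus" "U \<in> BD" for U
    unfolding PR_witness_def
  proof
    fix A assume A: "A \<in> U"
    obtain A1 where "A1 \<in> U" "A1 \<subseteq> A" "\<And>t. t \<in> A1 \<Longrightarrow> \<exists>d::int>0. \<forall>s\<in>{1..N}. \<forall>j\<in>J - {j0}.
        int t + int s * spread c (J - {j0}) j * d \<in> int ` A"
      using ap_subset_member[OF closure_of_betaN[OF U(1)] closure_of_K_times_has_ap[OF U(1)] A,
          of "J - {j0}" N "spread c (J - {j0})"] finJ by blast
    from recurrent[OF U(2,3) A finite.emptyI this] obtain a where a: "\<forall>v\<in>?V. a v \<in> A"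
      "mpoly_eval (\<lambda>v. int (a v)) R = 0" "inj_on a (?V - {Inl j0})" by blast
    show "\<exists>a. (\<forall>v\<in>?V. a v \<in> A) \<and> mpoly_eval (\<lambda>v. int (a v)) R = 0 \<and>
        (\<forall>(W, s)\<in>{(x_vars n, n - 1), (y_vars k, k)}. s \<le> card (a ` W))"
      using a(1,2) injective_but_one_card[OF a(3) j0n] by (intro exI[of _ a]) auto
  qed
  have 2: "\<exists>a. (\<forall>v\<in>?V. a v \<in> A) \<and> mpoly_eval (\<lambda>v. int (a v)) R = 0 \<and>
      inj_on a (?V - {Inl j0}) \<and> (k = 1 \<and> P \<noteq> 0 \<longrightarrow> inj_on a ?V)"
    if n: "n = 2" and U: "U \<in> betaN_topology closure_of I_plus" "U \<in> BD" and A: "A \<in> U" for U A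
  proof -
    \<comment> \<open>A single nonzero coefficient does not sum to 0.\<close>
    have "J = {1, 2}"
    proof -
      have "J \<subseteq> {1, 2}" using J(1) n by auto
      then have "J = {1} \<or> J = {2} \<or> J = {1, 2}" using J(2) by blast
      then show ?thesis using J(3,4) by auto
    qed
    then obtain i where i: "J - {j0} = {i}" using j0 by fastforce
    \<comment> \<open>The only variable of J besides the one with index j0 has weight 0 and takes
      the value t, so A can serve as its own set of centres.\<close>
    have "spread c {i} i = 0" by (simp add: spread_def)
    then have A1: "\<exists>d::int>0. \<forall>s\<in>{1..N}. \<forall>j\<in>J - {j0}.
        int t + int s * spread c (J - {j0}) j * d \<in> int ` A" if "t \<in> A" for t
      using that by (intro exI[of _ 1]) (simp add: i)
    \<comment> \<open>For k = 1 no x-variable is left in \<open>rest_poly\<close>, so h is the value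
      of P at the single y; away from the roots it is nonzero.\<close>
    define E where "E = (if k = 1 \<and> P \<noteq> 0 then {m::nat. mpoly_eval (\<lambda>_. int m) P = 0} else {})"
    have "finite E"
      unfolding E_def using finite_roots_univariate[of P "Inr 1"] P(1) by (auto simp: y_vars_def)
    from recurrent[OF U A this A order_refl A1] obtain a y where ay:
      "\<forall>v\<in>?V. a v \<in> A" "mpoly_eval (\<lambda>v. int (a v)) R = 0" "inj_on a (?V - {Inl j0})"
      "y ` rest_vars n k J \<subseteq> A - E"
      "mpoly_eval (\<lambda>v. int (y v)) (rest_poly n c J P) \<noteq> 0 \<longrightarrow> inj_on a ?V" by blast
    have "mpoly_eval (\<lambda>v. int (y v)) (rest_poly n c J P) \<noteq> 0" if k: "k = 1" "P \<noteq> 0"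
    proof -
      have emp: "{1..n} - J = {}" using n \<open>J = {1, 2}\<close> by auto
      have "mpoly_eval (\<lambda>v. int (y v)) (rest_poly n c J P) = mpoly_eval (\<lambda>v. int (y v)) P"
        unfolding mpoly_eval_rest_poly emp by simp
      also have "\<dots> = mpoly_eval (\<lambda>_. int (y (Inr 1))) P"
        using P(1) k(1) by (intro mpoly_eval_cong) (auto simp: y_vars_def)
      also have "\<dots> \<noteq> 0"
      proof -
        have "Inr 1 \<in> rest_vars n k J" using k(1) by (simp add: rest_vars_def y_vars_def)
        then have "y (Inr 1) \<notin> E" using ay(4) by blast
        then show ?thesis using k by (simp add: E_def)
      qed
      finally show ?thesis .
    qed
    with ay show ?thesis by blast
  qed
  have 2: "PR_witness U ?V R {(x_vars n, n - 1), (y_vars k, k)} \<and>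
      (k = 1 \<and> P \<noteq> 0 \<longrightarrow> PR_witness U ?V R {(x_vars n, 2), (y_vars k, k)})"
    if n: "n = 2" and U: "U \<in> betaN_topology closure_of I_plus" "U \<in> BD" for U
    unfolding PR_witness_def
  proof (intro conjI impI ballI)
    fix A assume A: "A \<in> U"
    from 2[OF n U A] obtain a where a: "\<forall>v\<in>?V. a v \<in> A"
      "mpoly_eval (\<lambda>v. int (a v)) R = 0" "inj_on a (?V - {Inl j0})" by blast
    show "\<exists>a. (\<forall>v\<in>?V. a v \<in> A) \<and> mpoly_eval (\<lambda>v. int (a v)) R = 0 \<and>
        (\<forall>(W, s)\<in>{(x_vars n, n - 1), (y_vars k, k)}. s \<le> card (a ` W))"
      using a(1,2) injective_but_one_card[OF a(3) j0n] by (intro exI[of _ a]) auto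
  next
    fix A assume kP: "k = 1 \<and> P \<noteq> 0" and A: "A \<in> U"
    from 2[OF n U A] kP obtain a where a: "\<forall>v\<in>?V. a v \<in> A" "mpoly_eval (\<lambda>v. int (a v)) R = 0" "inj_on a ?V"
      by blast
    have "card (a ` x_vars n) = 2" "card (a ` y_vars k) = k"
      using a(3) n by (simp_all add: card_image inj_on_Un card_x_vars card_y_vars)
    with a(1,2) show "\<exists>a. (\<forall>v\<in>?V. a v \<in> A) \<and> mpoly_eval (\<lambda>v. int (a v)) R = 0 \<and>
        (\<forall>(W, s)\<in>{(x_vars n, 2), (y_vars k, k)}. s \<le> card (a ` W))" by (intro exI[of _ a]) auto
  qed
  have 3: "PR_witness U ?V R {(?V, n + k)}"
    if P': "P \<noteq> 0" "mpoly_linear P" and U: "U \<in> betaN_topology closure_of K_times" for U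
    unfolding PR_witness_def
  proof
    fix A assume A: "A \<in> U"
    obtain a where a: "\<forall>v\<in>?V. a v \<in> A" "mpoly_eval (\<lambda>v. int (a v)) R = 0" "inj_on a ?V"
      using linear_rado_solution_in_closure[OF J(1) j0 J(3,4) P P' U A] unfolding assms(2) by blast
    then have "card (a ` ?V) = n + k" by (simp only: card_image card_x_y_vars)
    with a(1,2) show "\<exists>a. (\<forall>v\<in>?V. a v \<in> A) \<and> mpoly_eval (\<lambda>v. int (a v)) R = 0 \<and>
        (\<forall>(W, s)\<in>{(?V, n + k)}. s \<le> card (a ` W))" by (intro exI[of _ a]) auto
  qed
  from 1 2 3 show ?thesis by blast
qed

end
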